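(* Let $n\geq 2$ be an integer. Then the mixed cycle $C^{1}_{2n}$ is determined by its Hermitian spectrum (DHS) if and only if $n\neq 6$.
   Context: A mixed graph has undirected edges and directed edges (ordered pairs $(x,y)$). For vertices $v_1,\dots,v_n$, its Hermitian adjacency matrix $H(X)$ has $(j,k)$ entry $1$ if $v_jv_k$ is an undirected edge, $i$ if $(v_j,v_k)$ is a directed edge, $-i$ if $(v_k,v_j)$ is a directed edge, $0$ otherwise; $\mathrm{Spec}_H(X)$ is its multiset of eigenvalues. Mixed graphs $X,Y$ on the same vertex set are switching equivalent if $H(X)=D^{-1}H(Y)D$ for a diagonal $D$ with diagonal entries in $\{\pm1,\pm i\}$. A mixed graph $X$ is DHS if every mixed graph $Y$ with $\mathrm{Spec}_H(Y)=\mathrm{Spec}_H(X)$ is switching equivalent to a mixed graph isomorphic to $X$. $C^1_m$ is the mixed cycle of order $m$ with exactly one directed edge and all other edges undirected. *)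

theory Defs
  imports
    "HOL-Computational_Algebra.Fundamental_Theorem_Algebra"
    "Jordan_Normal_Form.Char_Poly"
begin

text \<open>The vertices of a mixed graph with \<open>n\<close> vertices are \<open>0, \<dots>, n - 1\<close>, in this order.\<close>

record mixed_graph =
  nverts :: nat
  uedges :: "nat set set"
  dedges :: "(nat \<times> nat) set"

text \<open>There are no loops, and two vertices are joined by at most one undirected or directed edge;
  this is what makes the entries of the Hermitian adjacency matrix well defined.\<close>

definition is_mixed_graph :: "mixed_graph \<Rightarrow> bool" where
  "is_mixed_graph X \<longleftrightarrow>
     uedges X \<subseteq> {{x, y} | x y. x < nverts X \<and> y < nverts X \<and> x \<noteq> y} \<and>
     dedges X \<subseteq> {(x, y). x < nverts X \<and> y < nverts X \<and> x \<noteq> y} \<and>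
     (\<forall>(x, y) \<in> dedges X. (y, x) \<notin> dedges X \<and> {x, y} \<notin> uedges X)"

definition herm_adj :: "mixed_graph \<Rightarrow> complex mat" where
  "herm_adj X = mat (nverts X) (nverts X) (\<lambda>(j, k).
     if {j, k} \<in> uedges X then 1
     else if (j, k) \<in> dedges X then \<i>
     else if (k, j) \<in> dedges X then - \<i>
     else 0)"

text \<open>Eigenvalues are counted with multiplicity.\<close>

definition herm_spec :: "mixed_graph \<Rightarrow> complex multiset" where
  "herm_spec X = proots (char_poly (herm_adj X))"

text \<open>In the following definition, \<open>D'\<close> is the inverse of \<open>D\<close>: the predicate
  \<^const>\<open>similar_mat_wit\<close> states that \<open>D' * D = D * D' = 1\<close> and
  \<open>herm_adj X = D' * herm_adj Y * D\<close>.\<close>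

definition switching_equivalent :: "mixed_graph \<Rightarrow> mixed_graph \<Rightarrow> bool" where
  "switching_equivalent X Y \<longleftrightarrow>
     nverts X = nverts Y \<and>
     (\<exists>D D'. diagonal_mat D \<and> (\<forall>j < nverts X. D $$ (j, j) \<in> {1, -1, \<i>, -\<i>}) \<and>
        similar_mat_wit (herm_adj X) (herm_adj Y) D' D)"

definition mixed_graph_iso :: "mixed_graph \<Rightarrow> mixed_graph \<Rightarrow> bool" where
  "mixed_graph_iso X Y \<longleftrightarrow>
     (\<exists>f. bij_betw f {..<nverts X} {..<nverts Y} \<and>
        (\<forall>x < nverts X. \<forall>y < nverts X.
           ({x, y} \<in> uedges X \<longleftrightarrow> {f x, f y} \<in> uedges Y) \<and>
           ((x, y) \<in> dedges X \<longleftrightarrow> (f x, f y) \<in> dedges Y)))"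

definition DHS :: "mixed_graph \<Rightarrow> bool" where
  "DHS X \<longleftrightarrow>
     (\<forall>Y. is_mixed_graph Y \<and> herm_spec Y = herm_spec X \<longrightarrow>
        (\<exists>Z. is_mixed_graph Z \<and> mixed_graph_iso Z X \<and> switching_equivalent Y Z))"

text \<open>The mixed cycle with exactly one directed edge, meaningful for \<open>m \<ge> 3\<close>.\<close>

definition mixed_cycle1 :: "nat \<Rightarrow> mixed_graph" where
  "mixed_cycle1 m =
     \<lparr> nverts = m, uedges = {{k, k + 1} | k. k + 1 < m}, dedges = {(m - 1, 0)} \<rparr>"

lemma is_mixed_graph_mixed_cycle1:
  assumes "m \<ge> 3"
  shows "is_mixed_graph (mixed_cycle1 m)"
  using assms unfolding is_mixed_graph_def mixed_cycle1_def
  by (auto simp: doubleton_eq_iff) force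

end

theory Submission
  imports Defs "HOL-Number_Theory.Residues"
begin

text \<open>The eigenvalues of the cycle are the \<open>2 n\<close> numbers \<open>2 cos ((4 j + 1) \<pi> / 4 n)\<close>. They are distinct
  and lie in the open interval from \<open>-2\<close> to \<open>2\<close>, and their product is \<open>\<plusminus> 2\<close>. Let \<open>h\<close> be the matrix of a
  cospectral mixed graph.

  On a union of components the trace of \<open>h\<^sup>2 - 2\<close> vanishes: it is an integer combination of \<open>8 n\<close>-th roots
  of unity whose value is unchanged under raising these roots to the power \<open>g\<close> if all prime factors of \<open>g\<close>
  are large, because \<open>tr (A\<^sup>p) \<equiv> tr A\<close> modulo \<open>p\<close>; a suitable such \<open>g\<close> changes its sign. So every component
  is unicyclic. The norm bound gives maximal degree 3, and the trace of \<open>h\<^sup>4\<close> shows that the number of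
  vertices of degree 3 is twice the number of negative quadrangles. As 4 does not divide the determinant, each
  negative quadrangle has two adjacent vertices of degree 3, and the norm bound leaves only arms of lengths
  1 and 1, 1 and 2, or 1 and 3. The largest eigenvalue occurs in none of these components unless \<open>n = 6\<close>, so it
  occurs in a component that is a cycle, and following an eigenvector around this cycle shows that the cycle
  has length \<open>2 n\<close> and weight \<open>\<plusminus> \<i>\<close>. For \<open>n = 6\<close> the arms of lengths 1 and 3 do yield a cospectral mate.\<close>

section \<open>Traces of prime powers of Gaussian integer matrices\<close>

text \<open>The obstacle is that only the spectrum of the whole graph is known, while the argument
  needs information on single components. The spectrum of a union of components is an unknown part
  of the known one; what can be said is that it is stable under Galois conjugation, its
  characteristic polynomial having integer coefficients. The congruences modulo primes are an
  elementary substitute for the Galois action: they need only integrality, a bound, and closed walks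
  taken up to rotation. The polynomial h^2 - 2 is chosen for two reasons. Its eigenvalues 2 cos 2t
  are sums of an odd power of a primitive 4n-th root of unity and its inverse, so the exponent 1 +
  2n negates all of them at once; and its diagonal entries are the degrees minus 2, so a vanishing
  trace says that there are as many edges as vertices. The exception comes from the arms of lengths
  1 and 3: the largest eigenvalue of that component is 2 cos (pi / 24), which is 2 cos (pi / 4n)
  exactly for n = 6.\<close>

definition gint :: "complex set" where
  "gint = {z. Re z \<in> \<int> \<and> Im z \<in> \<int>}"

lemma gint_0 [simp]: "0 \<in> gint" and gint_1 [simp]: "1 \<in> gint"
  by (auto simp: gint_def)

lemma gint_add [simp]: "x \<in> gint \<Longrightarrow> y \<in> gint \<Longrightarrow> x + y \<in> gint"
  and gint_uminus [simp]: "x \<in> gint \<Longrightarrow> - x \<in> gint"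
  and gint_mult [simp]: "x \<in> gint \<Longrightarrow> y \<in> gint \<Longrightarrow> x * y \<in> gint"
  by (auto simp: gint_def)

lemma gint_sum: "(\<And>x. x \<in> A \<Longrightarrow> f x \<in> gint) \<Longrightarrow> sum f A \<in> gint"
  by (induction A rule: infinite_finite_induct) auto

lemma gint_prod: "(\<And>x. x \<in> A \<Longrightarrow> f x \<in> gint) \<Longrightarrow> prod f A \<in> gint"
  by (induction A rule: infinite_finite_induct) auto

lemma gint_cmod_sq: "z \<in> gint \<Longrightarrow> (cmod z)\<^sup>2 \<in> \<int>"
  by (auto simp: gint_def cmod_power2)

section \<open>Rotations of lists of prime length\<close>

lemma rotate_mult_fixed: "rotate k xs = xs \<Longrightarrow> rotate (m * k) xs = xs"
  by (induction m) (auto simp flip: rotate_rotate)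

lemma rotate1_fixed_imp_const:
  assumes "rotate1 xs = xs"
  shows "\<forall>x \<in> set xs. x = hd xs"
proof (cases xs)
  case (Cons a ys)
  have "xs ! i = a" if "i < length xs" for i
    using that
  proof (induction i)
    case 0
    then show ?case by (simp add: Cons)
  next
    case (Suc i)
    have "xs ! Suc i = rotate1 xs ! i"
      using Suc.prems by (simp add: nth_rotate1)
    then show ?case using Suc assms by simp
  qed
  then show ?thesis using Cons by (metis in_set_conv_nth list.sel(1))
qed simp

text \<open>An amount \<open>k\<close> strictly between 0 and the prime length is invertible modulo
  the length, so some multiple of it is rotation by one.\<close>

lemma rotate_fixed_imp_const:
  assumes p: "prime (length xs)" and k: "0 < k" "k < length xs" and rot: "rotate k xs = xs"
  shows "\<forall>x \<in> set xs. x = hd xs"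
proof -
  have "coprime k (length xs)"
    using p k by (metis coprime_commute nat_dvd_not_less prime_imp_coprime_nat)
  then obtain m where m: "[k * m = 1] (mod length xs)"
    using cong_solve_coprime_nat[of k "length xs"] by auto
  have "rotate 1 xs = rotate (m * k) xs"
    using m by (metis cong_def mult.commute rotate_conv_mod)
  also have "\<dots> = xs"
    using rot by (rule rotate_mult_fixed)
  finally show ?thesis
    using rotate1_fixed_imp_const by simp
qed

text \<open>Non-constant lists of prime length \<open>p\<close> have \<open>p\<close> distinct
  rotations, and \<open>f\<close> is constant on each orbit. The induction removes one whole orbit
  at a time.\<close>

lemma sum_rotation_invariant:
  fixes f :: "'a list \<Rightarrow> complex"
  assumes p: "prime p" and "finite X"
    and "\<And>xs. xs \<in> X \<Longrightarrow> length xs = p"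
    and "\<And>xs. xs \<in> X \<Longrightarrow> rotate1 xs \<in> X"
    and "\<And>xs. xs \<in> X \<Longrightarrow> \<not> (\<forall>x \<in> set xs. x = hd xs)"
    and f: "\<And>xs. f (rotate1 xs) = f xs"
    and "\<And>xs. xs \<in> X \<Longrightarrow> f xs \<in> gint"
  shows "\<exists>w \<in> gint. sum f X = of_nat p * w"
  using assms(2-5,7)
proof (induction X rule: finite_psubset_induct)
  case (psubset X)
  show ?case
  proof (cases "X = {}")
    case True
    then show ?thesis by (auto intro!: bexI[of _ 0])
  next
    case False
    then obtain xs where xs: "xs \<in> X" by auto
    define orb where "orb = (\<lambda>k. rotate k xs) ` {..<p}"
    have len: "length xs = p" using psubset xs by auto
    have p0: "p > 0" using p by (simp add: prime_gt_0_nat)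
    have inX: "rotate k xs \<in> X" for k
      by (induction k) (use psubset xs in \<open>auto\<close>)
    have fr: "f (rotate k xs) = f xs" for k
      by (induction k) (auto simp: f)
    have inj: "inj_on (\<lambda>k. rotate k xs) {..<p}"
    proof (rule linorder_inj_onI')
      fix i j assume ij: "i \<in> {..<p}" "j \<in> {..<p}" "i < j"
      show "rotate i xs \<noteq> rotate j xs"
      proof
        assume eq: "rotate i xs = rotate j xs"
        define ys where "ys = rotate i xs"
        have "rotate (j - i) ys = ys"
          unfolding ys_def rotate_rotate using eq ij by simp
        moreover have "ys \<in> X" "length ys = p" using inX len by (auto simp: ys_def)
        ultimately show False
          using rotate_fixed_imp_const[of ys "j - i"] p ij psubset.prems(3)[of ys]
          by (metis lessThan_iff less_imp_diff_less zero_less_diff)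
      qed
    qed
    have orbX: "orb \<subseteq> X" using inX by (auto simp: orb_def)
    have sumorb: "sum f orb = of_nat p * f xs"
      unfolding orb_def using inj by (subst sum.reindex) (auto simp: fr)
    have closed: "rotate1 ys \<in> X - orb" if "ys \<in> X - orb" for ys
    proof -
      have "ys \<in> orb" if r: "rotate1 ys \<in> orb"
      proof -
        obtain k where k: "rotate1 ys = rotate k xs" using r unfolding orb_def by blast
        have ly: "length ys = p" using \<open>ys \<in> X - orb\<close> psubset.prems(1) by auto
        \<comment> \<open>Rotation by \<open>p - 1\<close> undoes \<open>rotate1\<close>, so a list
          whose rotation lies in the orbit lies there itself.\<close>
        have "ys = rotate (p - 1 + 1) ys" using ly p0 by simp
        also have "\<dots> = rotate (p - 1) (rotate1 ys)"
          unfolding rotate_rotate[symmetric] by simp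
        also have "\<dots> = rotate (p - 1 + k) xs" by (simp only: k rotate_rotate)
        also have "\<dots> = rotate ((p - 1 + k) mod p) xs" by (subst rotate_conv_mod) (simp only: len)
        finally show ?thesis unfolding orb_def using p0 by force
      qed
      then show ?thesis using that psubset.prems(2) by blast
    qed
    have "X - orb \<subset> X" using xs p0 inX unfolding orb_def by force
    then obtain w where w: "w \<in> gint" "sum f (X - orb) = of_nat p * w"
      using psubset.IH[of "X - orb"] psubset.prems closed by (metis DiffD1)
    have "sum f X = of_nat p * (w + f xs)"
      using sum.subset_diff[OF orbX, of f] psubset.hyps w sumorb by (simp add: algebra_simps)
    then show ?thesis using w xs psubset.prems(4) by (metis gint_add)
  qed
qed

text \<open>Matrices are functions with a separate index set, because that set will be
  \<open>K \<times> UNIV\<close> for a set \<open>K\<close> of vertices; nothing has to be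
  renumbered.\<close>

fun mpow :: "'v set \<Rightarrow> ('v \<Rightarrow> 'v \<Rightarrow> complex) \<Rightarrow> nat \<Rightarrow> 'v \<Rightarrow> 'v \<Rightarrow> complex" where
  "mpow I a 0 u v = of_bool (u = v)"
| "mpow I a (Suc k) u v = (\<Sum>x\<in>I. a u x * mpow I a k x v)"

lemma mpow_add:
  assumes "finite I" "u \<in> I"
  shows "mpow I a (k + l) u v = (\<Sum>x\<in>I. mpow I a k u x * mpow I a l x v)"
  using assms(2)
proof (induction k arbitrary: u)
  case 0
  then show ?case using assms(1) by (simp add: of_bool_def if_distrib if_distribR cong: if_cong)
next
  case (Suc k)
  have "mpow I a (Suc k + l) u v = (\<Sum>x\<in>I. a u x * (\<Sum>y\<in>I. mpow I a k x y * mpow I a l y v))"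
    using Suc.IH by simp
  also have "\<dots> = (\<Sum>y\<in>I. (\<Sum>x\<in>I. a u x * mpow I a k x y) * mpow I a l y v)"
    unfolding sum_distrib_left sum_distrib_right mult.assoc by (rule sum.swap)
  finally show ?case by simp
qed

lemma mpow_mult:
  assumes "finite I" "u \<in> I"
  shows "mpow I a (k * l) u v = mpow I (mpow I a k) l u v"
  using assms(2)
proof (induction l arbitrary: u)
  case (Suc l)
  have "mpow I a (k * Suc l) u v = (\<Sum>x\<in>I. mpow I a k u x * mpow I a (k * l) x v)"
    using mpow_add[OF assms(1) Suc.prems, of a k "k * l" v] by simp
  also have "\<dots> = mpow I (mpow I a k) (Suc l) u v"
    using Suc.IH by simp
  finally show ?case .
qed simp

section \<open>Matrix powers as sums over walks\<close>

fun walk :: "('v \<Rightarrow> 'v \<Rightarrow> complex) \<Rightarrow> 'v \<Rightarrow> 'v list \<Rightarrow> 'v \<Rightarrow> complex" where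
  "walk a u [] v = a u v"
| "walk a u (x # xs) v = a u x * walk a x xs v"

lemma walk_snoc: "walk a u (xs @ [y]) v = walk a u xs y * a y v"
  by (induction xs arbitrary: u) auto

lemma walk_gint:
  "(\<And>x y. a x y \<in> gint) \<Longrightarrow> walk a u xs v \<in> gint"
  by (induction xs arbitrary: u) auto

lemma sum_lists_Suc:
  assumes "finite I"
  shows "(\<Sum>xs | set xs \<subseteq> I \<and> length xs = Suc k. f xs)
    = (\<Sum>x\<in>I. \<Sum>xs | set xs \<subseteq> I \<and> length xs = k. f (x # xs))"
proof -
  have "(\<Sum>xs | set xs \<subseteq> I \<and> length xs = Suc k. f xs)
      = (\<Sum>(xs, x)\<in>{xs. set xs \<subseteq> I \<and> length xs = k} \<times> I. f (x # xs))"
    unfolding lists_length_Suc_eq by (subst sum.reindex) (auto simp: inj_on_def intro!: sum.cong)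
  also have "\<dots> = (\<Sum>xs | set xs \<subseteq> I \<and> length xs = k. \<Sum>x\<in>I. f (x # xs))"
    by (rule sum.cartesian_product[symmetric])
  also have "\<dots> = (\<Sum>x\<in>I. \<Sum>xs | set xs \<subseteq> I \<and> length xs = k. f (x # xs))"
    by (rule sum.swap)
  finally show ?thesis .
qed

lemma mpow_eq_walks:
  assumes "finite I" "v \<in> I"
  shows "mpow I a (Suc k) u v = (\<Sum>xs | set xs \<subseteq> I \<and> length xs = k. walk a u xs v)"
proof (induction k arbitrary: u)
  case 0
  have "{xs. set xs \<subseteq> I \<and> xs = []} = {[]}" by auto
  then show ?case using assms by (simp add: of_bool_def if_distrib cong: if_cong)
next
  case (Suc k)
  have "mpow I a (Suc (Suc k)) u v = (\<Sum>x\<in>I. a u x * mpow I a (Suc k) x v)"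
    by (rule mpow.simps(2))
  also have "\<dots> = (\<Sum>x\<in>I. \<Sum>xs | set xs \<subseteq> I \<and> length xs = k. walk a u (x # xs) v)"
    unfolding Suc.IH by (simp add: sum_distrib_left)
  finally show ?case unfolding sum_lists_Suc[OF assms(1)] .
qed

text \<open>The trace of a \<open>p\<close>-th power is a sum over closed walks of length
  \<open>p\<close>, and changing the starting point rotates the walk. Walks that stay at one vertex
  give the diagonal terms; all others come in orbits of size \<open>p\<close>.\<close>

lemma trace_prime_power:
  fixes a :: "'v \<Rightarrow> 'v \<Rightarrow> complex"
  assumes I: "finite I" and p: "prime p" and a: "\<And>x y. a x y \<in> gint"
  shows "\<exists>w \<in> gint. (\<Sum>u\<in>I. mpow I a p u u) = (\<Sum>u\<in>I. a u u ^ p) + of_nat p * w"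
proof -
  obtain k where k: "p = Suc k" using p prime_gt_0_nat gr0_conv_Suc by blast
  \<comment> \<open>The value at \<open>[]\<close> is a filler: the lists in \<open>L\<close> have
    positive length.\<close>
  define cyc where "cyc xs = (case xs of [] \<Rightarrow> 0 | u # us \<Rightarrow> walk a u us u)" for xs
  define L where "L = {xs. set xs \<subseteq> I \<and> length xs = p}"
  define C where "C = (\<lambda>u. replicate p u) ` I"
  have finL: "finite L" unfolding L_def by (rule finite_lists_length_eq[OF I])
  have rot: "cyc (rotate1 xs) = cyc xs" for xs
  proof (cases xs)
    case (Cons u us)
    then show ?thesis by (cases us) (auto simp: cyc_def walk_snoc)
  qed simp
  have "(\<Sum>u\<in>I. mpow I a p u u) = sum cyc L"
    unfolding k L_def sum_lists_Suc[OF I] by (intro sum.cong refl) (simp only: mpow_eq_walks[OF I] cyc_def list.case)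
  also have CL: "C \<subseteq> L" by (auto simp: C_def L_def)
  then have "sum cyc L = sum cyc C + sum cyc (L - C)"
    using finL by (simp add: sum.subset_diff add.commute)
  also have "sum cyc C = (\<Sum>u\<in>I. cyc (replicate p u))"
    unfolding C_def by (subst sum.reindex) (auto simp: inj_on_def k)
  also have "\<dots> = (\<Sum>u\<in>I. a u u ^ p)"
  proof -
    have "walk a u (replicate m u) u = a u u ^ Suc m" for u m by (induction m) auto
    then show ?thesis unfolding k cyc_def by simp
  qed
  finally have eq: "(\<Sum>u\<in>I. mpow I a p u u) = (\<Sum>u\<in>I. a u u ^ p) + sum cyc (L - C)" .
  have "\<exists>w \<in> gint. sum cyc (L - C) = of_nat p * w"
  proof (rule sum_rotation_invariant[OF p])
    show "finite (L - C)" using finL by simp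
    fix xs assume xs: "xs \<in> L - C"
    show "length xs = p" using xs by (simp add: L_def)
    show nc: "\<not> (\<forall>x \<in> set xs. x = hd xs)"
    proof
      assume "\<forall>x \<in> set xs. x = hd xs"
      then have "xs = replicate p (hd xs)" using xs by (intro replicate_eqI) (auto simp: L_def)
      moreover have "xs \<noteq> []" "set xs \<subseteq> I" using xs by (auto simp: L_def k)
      then have "hd xs \<in> I" using hd_in_set by blast
      ultimately show False using xs unfolding C_def by blast
    qed
    have "rotate1 xs \<notin> C"
    proof
      assume "rotate1 xs \<in> C"
      then obtain u where "rotate1 xs = replicate p u" by (auto simp: C_def)
      then have "set xs = set (replicate p u)" by (metis set_rotate1)
      moreover have "xs \<noteq> []" using xs by (auto simp: L_def k)
      then have "hd xs \<in> set xs" by simp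
      ultimately show False using nc by (auto simp: k)
    qed
    then show "rotate1 xs \<in> L - C" using xs by (auto simp: L_def)
    show "cyc xs \<in> gint" by (cases xs) (auto simp: cyc_def walk_gint a)
  qed (rule rot)
  then show ?thesis using eq by auto
qed

lemma fermat_int:
  fixes z :: int
  assumes "prime p"
  shows "[z ^ p = z] (mod int p)"
proof -
  define m where "m = nat (z mod int p)"
  have p0: "p > 0" using assms by (simp add: prime_gt_0_nat)
  have m: "[z = int m] (mod int p)" using p0 by (simp add: m_def cong_def)
  have "[m ^ p = m] (mod p)"
  proof (cases "p dvd m")
    case True
    then have "p dvd m ^ p" using p0 by (simp add: dvd_power_same dvd_trans[OF _ dvd_power])
    then show ?thesis using True by (meson cong_0_iff cong_sym cong_trans)
  next
    case False
    then have "[m * m ^ (p - 1) = m * 1] (mod p)"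
      using fermat_theorem[OF assms] by (intro cong_mult) auto
    then show ?thesis using p0 by (simp add: power_eq_if)
  qed
  then have "[int m ^ p = int m] (mod int p)"
    by (metis cong_int_iff of_nat_power)
  then show ?thesis using m by (meson cong_pow cong_sym cong_trans)
qed

text \<open>Fermat's congruence fails for Gaussian integers, for instance for the imaginary unit and
  the prime 3. Therefore the diagonal is required to be real.\<close>

lemma trace_prime_power_int:
  fixes a :: "'v \<Rightarrow> 'v \<Rightarrow> complex"
  assumes I: "finite I" and p: "prime p" and a: "\<And>x y. a x y \<in> gint"
    and diag: "\<And>x. x \<in> I \<Longrightarrow> Im (a x x) = 0"
  shows "\<exists>k :: int. Re (\<Sum>u\<in>I. mpow I a p u u) = Re (\<Sum>u\<in>I. a u u) + real p * of_int k"
proof -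
  obtain w where w: "w \<in> gint" "(\<Sum>u\<in>I. mpow I a p u u) = (\<Sum>u\<in>I. a u u ^ p) + of_nat p * w"
    using trace_prime_power[of I p a] I p a by blast
  define d where "d u = \<lfloor>Re (a u u)\<rfloor>" for u
  have d: "a u u = of_int (d u)" if "u \<in> I" for u
    using a[of u u] diag[OF that] by (auto simp: d_def gint_def complex_eq_iff elim: Ints_cases)
  have "\<exists>k. d u ^ p = d u + int p * k" for u
    using fermat_int[OF p, of "d u"] by (metis cong_iff_lin cong_sym)
  then obtain k where k: "\<And>u. d u ^ p = d u + int p * k u" by metis
  have "(\<Sum>u\<in>I. a u u ^ p) = (\<Sum>u\<in>I. of_int (d u ^ p))" by (simp add: d cong: sum.cong)
  also have "\<dots> = (\<Sum>u\<in>I. of_int (d u) + of_nat p * of_int (k u))" by (simp add: k)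
  also have "\<dots> = (\<Sum>u\<in>I. a u u) + of_nat p * of_int (\<Sum>u\<in>I. k u)"
    by (simp add: d sum.distrib sum_distrib_left cong: sum.cong)
  finally have 1: "(\<Sum>u\<in>I. a u u ^ p) = (\<Sum>u\<in>I. a u u) + of_nat p * of_int (\<Sum>u\<in>I. k u)" .
  obtain x where x: "Re w = of_int x" using w(1) by (auto simp: gint_def elim: Ints_cases)
  show ?thesis
    unfolding w(2) 1 by (intro exI[of _ "(\<Sum>u\<in>I. k u) + x"]) (simp add: algebra_simps x)
qed

section \<open>Simple spectra\<close>

lemma monic_poly_eq_prod_roots:
  fixes p :: "'a :: field_char_0 poly"
  assumes "monic p" "degree p = m" "inj_on r {..<m}" "\<And>j. j < m \<Longrightarrow> poly p (r j) = 0"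
  shows "p = (\<Prod>j<m. [:- r j, 1:])"
proof (rule poly_eqI_degree_lead_coeff[where A = "r ` {..<m}"])
  have deg: "degree (\<Prod>j<m. [:- r j, 1:]) = m"
    by (subst degree_prod_eq_sum_degree) auto
  have mon: "monic (\<Prod>j<m. [:- r j, 1:])"
    by (intro monic_prod) simp
  show "card (r ` {..<m}) \<ge> m" using assms(3) by (simp add: card_image)
  show "degree p \<le> m" "degree (\<Prod>j<m. [:- r j, 1:]) \<le> m" using assms deg by auto
  show "poly.coeff p m = poly.coeff (\<Prod>j<m. [:- r j, 1:]) m" using assms mon deg by simp
  fix z assume "z \<in> r ` {..<m}"
  then show "poly p z = poly (\<Prod>j<m. [:- r j, 1:]) z"
    using assms(4) by (force simp: poly_prod prod_zero_iff)
qed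

definition is_eigvec :: "nat \<Rightarrow> (nat \<Rightarrow> nat \<Rightarrow> complex) \<Rightarrow> complex \<Rightarrow> (nat \<Rightarrow> complex) \<Rightarrow> bool" where
  "is_eigvec m h l x \<longleftrightarrow> (\<exists>u<m. x u \<noteq> 0) \<and> (\<forall>u<m. (\<Sum>v<m. h u v * x v) = l * x u)"

lemma root_char_poly_iff_eigvec:
  "poly (char_poly (mat m m (\<lambda>(u, v). h u v))) l = 0 \<longleftrightarrow> (\<exists>x. is_eigvec m h l x)"
    (is "poly (char_poly ?A) l = 0 \<longleftrightarrow> _")
proof -
  have ev: "eigenvector ?A (vec m x) l \<longleftrightarrow> is_eigvec m h l x" for x
  proof -
    have "(?A *\<^sub>v vec m x) $ u = (\<Sum>v<m. h u v * x v)" if "u < m" for u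
      using that by (simp add: scalar_prod_def lessThan_atLeast0)
    moreover have "?A *\<^sub>v vec m x = l \<cdot>\<^sub>v vec m x \<longleftrightarrow> (\<forall>u<m. (?A *\<^sub>v vec m x) $ u = l * x u)"
      unfolding vec_eq_iff by simp
    moreover have "vec m x \<noteq> 0\<^sub>v m \<longleftrightarrow> (\<exists>u<m. x u \<noteq> 0)"
      unfolding vec_eq_iff by simp
    ultimately show ?thesis unfolding eigenvector_def is_eigvec_def by simp
  qed
  have "poly (char_poly ?A) l = 0 \<longleftrightarrow> (\<exists>v. eigenvector ?A v l)"
    using eigenvalue_root_char_poly[of ?A m l] unfolding eigenvalue_def by simp
  also have "\<dots> \<longleftrightarrow> (\<exists>x. eigenvector ?A (vec m x) l)"
  proof
    assume "\<exists>v. eigenvector ?A v l"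
    then obtain v where v: "eigenvector ?A v l" by (elim exE)
    then have "v \<in> carrier_vec m" by (simp add: eigenvector_def)
    then have "v = vec m (\<lambda>i. v $ i)" by (intro eq_vecI) auto
    then show "\<exists>x. eigenvector ?A (vec m x) l" using v by (intro exI[of _ "\<lambda>i. v $ i"]) simp
  qed blast
  finally show ?thesis unfolding ev .
qed

text \<open>This avoids evaluating determinants: an eigenvector for each of \<open>m\<close>
  distinct values pins down a monic polynomial of degree \<open>m\<close>. Both the cycle and its
  mate of order 12 are treated in this way.\<close>

lemma char_poly_simple_spectrum:
  assumes "inj_on l {..<m}" "\<And>j. j < m \<Longrightarrow> \<exists>x. is_eigvec m h (l j) x"
  shows "char_poly (mat m m (\<lambda>(u, v). h u v)) = (\<Prod>j<m. [:- l j, 1:])"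
proof (rule monic_poly_eq_prod_roots)
  have "mat m m (\<lambda>(u, v). h u v) \<in> carrier_mat m m" by simp
  from degree_monic_char_poly[OF this]
  show "monic (char_poly (mat m m (\<lambda>(u, v). h u v)))" "degree (char_poly (mat m m (\<lambda>(u, v). h u v))) = m"
    by auto
qed (use assms root_char_poly_iff_eigvec in auto)

lemma hermitian_eigvecs_orthogonal:
  fixes h :: "nat \<Rightarrow> nat \<Rightarrow> complex" and k l :: real
  assumes "\<And>u v. h v u = cnj (h u v)"
    and x: "\<And>u. u < m \<Longrightarrow> (\<Sum>v<m. h u v * x v) = of_real k * x u"
    and y: "\<And>u. u < m \<Longrightarrow> (\<Sum>v<m. h u v * y v) = of_real l * y u"
    and "k \<noteq> l"
  shows "(\<Sum>v<m. cnj (x v) * y v) = 0"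
proof -
  have "of_real l * (\<Sum>u<m. cnj (x u) * y u) = (\<Sum>u<m. \<Sum>v<m. cnj (x u) * (h u v * y v))"
    unfolding sum_distrib_left by (rule sum.cong) (simp_all flip: sum_distrib_left add: y)
  also have "\<dots> = (\<Sum>v<m. \<Sum>u<m. cnj (x u) * (h u v * y v))" by (rule sum.swap)
  also have "\<dots> = (\<Sum>v<m. cnj (\<Sum>u<m. h v u * x u) * y v)"
    unfolding cnj_sum sum_distrib_right complex_cnj_mult assms(1)[symmetric]
    by (simp add: mult_ac)
  also have "\<dots> = (\<Sum>v<m. of_real k * (cnj (x v) * y v))"
    by (rule sum.cong) (simp_all add: x)
  also have "\<dots> = of_real k * (\<Sum>v<m. cnj (x v) * y v)" by (simp add: sum_distrib_left)
  finally show ?thesis using \<open>k \<noteq> l\<close> by simp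
qed

text \<open>A one-sided inverse of a square matrix is two-sided.\<close>

lemma orthonormal_rows_imp_columns:
  fixes w :: "nat \<Rightarrow> nat \<Rightarrow> complex"
  assumes "\<And>i j. i < m \<Longrightarrow> j < m \<Longrightarrow> (\<Sum>v<m. cnj (w i v) * w j v) = of_bool (i = j)"
    and "u < m" "v < m"
  shows "(\<Sum>j<m. w j u * cnj (w j v)) = of_bool (u = v)"
proof -
  define P where "P = mat m m (\<lambda>(i, v). cnj (w i v))"
  define Q where "Q = mat m m (\<lambda>(v, j). w j v)"
  have "P * Q = 1\<^sub>m m"
    by (rule eq_matI) (auto simp: P_def Q_def scalar_prod_def assms(1) simp flip: lessThan_atLeast0)
  then have "Q * P = 1\<^sub>m m"
    by (intro mat_mult_left_right_inverse[of P m Q]) (auto simp: P_def Q_def)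
  then have "(Q * P) $$ (u, v) = 1\<^sub>m m $$ (u, v)" by simp
  then show ?thesis using assms(2,3)
    by (simp add: P_def Q_def scalar_prod_def lessThan_atLeast0)
qed

text \<open>For a simple real spectrum the spectral theorem is elementary: one normalised
  eigenvector per eigenvalue suffices, since eigenvectors for distinct eigenvalues are
  orthogonal.\<close>

lemma hermitian_eigenbasis:
  fixes h :: "nat \<Rightarrow> nat \<Rightarrow> complex" and l :: "nat \<Rightarrow> real"
  assumes herm: "\<And>u v. h v u = cnj (h u v)" and inj: "inj_on l {..<m}"
    and cp: "char_poly (mat m m (\<lambda>(u, v). h u v)) = (\<Prod>j<m. [:- of_real (l j), 1:])"
  obtains w where
    "\<And>u j. u < m \<Longrightarrow> j < m \<Longrightarrow> (\<Sum>v<m. h u v * w j v) = of_real (l j) * w j u"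
    "\<And>i j. i < m \<Longrightarrow> j < m \<Longrightarrow> (\<Sum>v<m. cnj (w i v) * w j v) = of_bool (i = j)"
    "\<And>u v. u < m \<Longrightarrow> v < m \<Longrightarrow> (\<Sum>j<m. w j u * cnj (w j v)) = of_bool (u = v)"
proof -
  have "\<exists>x. is_eigvec m h (of_real (l j)) x" if "j < m" for j
    using that unfolding root_char_poly_iff_eigvec[symmetric] cp by (auto simp: poly_prod prod_zero_iff)
  then obtain x where x: "\<And>j. j < m \<Longrightarrow> is_eigvec m h (of_real (l j)) (x j)" by metis
  define nrm where "nrm j = sqrt (\<Sum>v<m. (cmod (x j v))\<^sup>2)" for j
  define w where "w j v = x j v / of_real (nrm j)" for j v
  have nrm: "nrm j > 0" "(\<Sum>v<m. cnj (x j v) * x j v) = of_real (nrm j) ^ 2" if j: "j < m" for j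
  proof -
    obtain u where u: "u < m" "x j u \<noteq> 0" using x[OF j] by (auto simp: is_eigvec_def)
    have pos: "(\<Sum>v<m. (cmod (x j v))\<^sup>2) > 0"
      by (rule sum_pos2[of _ u]) (use u in auto)
    then show "nrm j > 0" by (simp add: nrm_def)
    have "(\<Sum>v<m. cnj (x j v) * x j v) = of_real (\<Sum>v<m. (cmod (x j v))\<^sup>2)"
      unfolding of_real_sum complex_norm_square by (simp only: mult.commute)
    also have "(\<Sum>v<m. (cmod (x j v))\<^sup>2) = nrm j ^ 2" using pos by (simp add: nrm_def)
    finally show "(\<Sum>v<m. cnj (x j v) * x j v) = of_real (nrm j) ^ 2" by simp
  qed
  have eig: "(\<Sum>v<m. h u v * w j v) = of_real (l j) * w j u" if "u < m" "j < m" for u j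
    using x[OF that(2)] that(1) by (simp add: is_eigvec_def w_def flip: sum_divide_distrib)
  have orth: "(\<Sum>v<m. cnj (w i v) * w j v) = of_bool (i = j)" if "i < m" "j < m" for i j
  proof (cases "i = j")
    case True
    have "(\<Sum>v<m. cnj (w i v) * w j v) = (\<Sum>v<m. cnj (x i v) * x i v) / of_real (nrm i) ^ 2"
      by (simp add: True w_def sum_divide_distrib power2_eq_square)
    then show ?thesis using nrm[OF that(1)] True by simp
  next
    case False
    then have "l i \<noteq> l j" using inj that by (auto simp: inj_on_def)
    then have "(\<Sum>v<m. cnj (w i v) * w j v) = 0"
      using that by (intro hermitian_eigvecs_orthogonal[OF herm eig eig])
    then show ?thesis using False by simp
  qed
  show thesis
    by (rule that[OF eig orth orthonormal_rows_imp_columns[OF orth]])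
qed

section \<open>The spectrum of the cycle\<close>

text \<open>These are the numbers z + 1/z where z runs through the solutions of z^(2n) = i, the
  condition for u |-> z^u to close up around the cycle.\<close>

definition lam :: "nat \<Rightarrow> nat \<Rightarrow> real" where
  "lam n j = 2 * cos ((4 * real j + 1) * pi / (4 * real n))"

text \<open>Equal cosines mean angles that are equal or opposite modulo full turns. Opposite angles
  are excluded by parity: (4j + 1) + (4k + 1) is 2 modulo 4, hence not a multiple of 8n.\<close>

lemma inj_on_lam:
  assumes "n > 0"
  shows "inj_on (lam n) {..<2 * n}"
proof (rule inj_onI)
  fix j k assume jk: "j \<in> {..<2 * n}" "k \<in> {..<2 * n}" and "lam n j = lam n k"
  have cos_eq: "\<exists>m :: int. x = y + 2 * of_int m * pi \<or> x = - y + 2 * of_int m * pi"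
    if "cos x = cos y" for x y :: real
  proof -
    have "sin ((x + y) / 2) * sin ((y - x) / 2) = 0"
      using that cos_diff_cos[of x y] by simp
    then have "sin ((x + y) / 2) = 0 \<or> sin ((x - y) / 2) = 0"
      using sin_minus[of "(x - y) / 2"] by (auto simp: minus_divide_left)
    then obtain m :: int where "(x + y) / 2 = of_int m * pi \<or> (x - y) / 2 = of_int m * pi"
      unfolding sin_zero_iff_int2 by blast
    then show ?thesis by (intro exI[of _ m]) (auto simp: field_simps)
  qed
  obtain m :: int where
    "(4 * real j + 1) * pi / (4 * real n) = (4 * real k + 1) * pi / (4 * real n) + 2 * of_int m * pi \<or>
     (4 * real j + 1) * pi / (4 * real n) = - ((4 * real k + 1) * pi / (4 * real n)) + 2 * of_int m * pi"
    using cos_eq \<open>lam n j = lam n k\<close> unfolding lam_def by (metis mult_cancel_left zero_neq_numeral)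
  then show "j = k"
  proof
    assume "(4 * real j + 1) * pi / (4 * real n) = (4 * real k + 1) * pi / (4 * real n) + 2 * of_int m * pi"
    then have "((4 * real j + 1) - (4 * real k + 1) - of_int m * (8 * real n)) * pi = 0"
      using assms by (simp add: field_simps)
    then have "of_int (int j - int k - m * (2 * int n)) = (0 :: real)" by simp
    then have eq: "int j - int k = m * (2 * int n)" by linarith
    have "\<bar>m * (2 * int n)\<bar> < 2 * int n" using jk unfolding eq[symmetric] by auto
    then have "\<bar>m\<bar> < 1" using assms by (simp add: abs_mult)
    then show ?thesis using eq by simp
  next
    assume "(4 * real j + 1) * pi / (4 * real n) = - ((4 * real k + 1) * pi / (4 * real n)) + 2 * of_int m * pi"
    then have "((4 * real j + 1) + (4 * real k + 1) - of_int m * (8 * real n)) * pi = 0"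
      using assms by (simp add: field_simps)
    then have "of_int (2 * int j + 2 * int k + 1 - m * (4 * int n)) = (0 :: real)" by simp
    then have "2 * int j + 2 * int k + 1 - m * (4 * int n) = 0" by linarith
    then have "m * (4 * int n) = 2 * (int j + int k) + 1" by simp
    moreover have "even (m * (4 * int n))" "odd (2 * (int j + int k) + 1)" by simp_all
    ultimately show ?thesis by simp
  qed
qed

text \<open>Rescaled Chebyshev polynomials of the first kind, taking 2 cos t to 2 cos (j t). The
  initial value 2 fits this formula, so monicity holds only from index 1 on.\<close>

fun dickson :: "nat \<Rightarrow> complex poly" where
  "dickson 0 = [:2:]"
| "dickson (Suc 0) = [:0, 1:]"
| "dickson (Suc (Suc j)) = pCons 0 (dickson (Suc j)) - dickson j"

lemma poly_dickson: "poly (dickson j) (of_real (2 * cos t)) = of_real (2 * cos (j * t))"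
proof (induction j rule: dickson.induct)
  case (3 j)
  have "2 * cos t * (2 * cos ((j + 1) * t)) = 2 * cos ((j + 2) * t) + 2 * cos (j * t)"
  proof -
    have "(real (j + 2) * t + real j * t) / 2 = real (j + 1) * t" "(real (j + 2) * t - real j * t) / 2 = t"
      by (simp_all add: field_simps)
    then have "cos (real (j + 2) * t) + cos (real j * t) = 2 * cos (real (j + 1) * t) * cos t"
      using cos_plus_cos[of "real (j + 2) * t" "real j * t"] by simp
    then have "2 * (2 * cos (real (j + 1) * t) * cos t) = 2 * (cos (real (j + 2) * t) + cos (real j * t))"
      by simp
    then show ?thesis by (simp only: distrib_left mult_ac)
  qed
  moreover have "poly (dickson (Suc (Suc j))) (of_real (2 * cos t))
      = of_real (2 * cos t * (2 * cos ((j + 1) * t)) - 2 * cos (j * t))"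
    using 3 by (simp add: add.commute)
  ultimately show ?case by (simp add: add.commute)
qed auto

lemma degree_dickson: "j > 0 \<Longrightarrow> degree (dickson j) = j \<and> monic (dickson j)"
proof (induction j rule: dickson.induct)
  case (3 j)
  have lt: "degree (dickson j) < degree (pCons 0 (dickson (Suc j)))"
    using 3 by (cases j) (auto split: if_splits)
  have 1: "degree (dickson (Suc (Suc j))) = Suc (Suc j)"
    unfolding dickson.simps diff_conv_add_uminus using 3 lt by (subst degree_add_eq_left) auto
  have "poly.coeff (dickson j) (Suc (Suc j)) = 0" using lt 3 by (intro coeff_eq_0) (auto split: if_splits)
  then have "poly.coeff (dickson (Suc (Suc j))) (Suc (Suc j)) = 1" using 3 by auto
  then show ?case using 1 by simp
qed auto

lemma poly_dickson_even_0: "poly (dickson (2 * j)) 0 = 2 * (-1) ^ j"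
  by (induction j) auto

text \<open>For each of these angles t, 2n t is pi / 2 up to full turns, so cos (2n t) = 0. Thus the
  characteristic polynomial of the cycle is a Dickson polynomial and its constant term can be read
  off.\<close>

lemma dickson_eq_prod:
  assumes "n > 0"
  shows "dickson (2 * n) = (\<Prod>j<2 * n. [:- of_real (lam n j), 1:])"
proof (rule monic_poly_eq_prod_roots)
  show "monic (dickson (2 * n))" "degree (dickson (2 * n)) = 2 * n"
    using degree_dickson[of "2 * n"] assms by auto
  show "inj_on (\<lambda>j. complex_of_real (lam n j)) {..<2 * n}"
    using inj_on_lam[OF assms] by (auto simp: inj_on_def)
  fix j
  have "cos (real (2 * n) * ((4 * real j + 1) * pi / (4 * real n))) = cos (pi / 2 + 2 * pi * real j)"
    using assms by (intro arg_cong[of _ _ cos]) (simp add: field_simps)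
  also have "\<dots> = 0" using sin_npi[of "2 * j"] by (simp add: cos_add mult_ac)
  finally show "poly (dickson (2 * n)) (complex_of_real (lam n j)) = 0"
    unfolding lam_def poly_dickson by simp
qed

text \<open>The order \<open>2 * n\<close> is even, so the determinant is the value of the
  characteristic polynomial at 0, which is \<open>poly (dickson (2 * n)) 0\<close>.\<close>

lemma det_simple_spectrum:
  assumes "n > 0"
    and cp: "char_poly (mat (2 * n) (2 * n) (\<lambda>(u, v). h u v)) = (\<Prod>j<2 * n. [:- of_real (lam n j), 1:])"
  shows "cmod (det (mat (2 * n) (2 * n) (\<lambda>(u, v). h u v))) = 2"
proof -
  let ?A = "mat (2 * n) (2 * n) (\<lambda>(u, v). h u v) :: complex mat"
  have A: "?A \<in> carrier_mat (2 * n) (2 * n)" by simp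
  have "poly (char_poly ?A) 0 = det (- char_matrix ?A 0)" by (rule char_poly_matrix[OF A])
  also have "- char_matrix ?A 0 = (-1) \<cdot>\<^sub>m ?A"
    by (rule eq_matI) (auto simp: char_matrix_def)
  also have "det \<dots> = (-1) ^ (2 * n) * det ?A" by simp
  finally have "det ?A = 2 * (-1) ^ n"
    unfolding cp dickson_eq_prod[OF assms(1), symmetric] poly_dickson_even_0 by simp
  then show ?thesis by (simp add: norm_mult norm_power)
qed

section \<open>Angles in arithmetic progression and the fourth moment of the spectrum\<close>

lemma sum_cis_arith:
  assumes "cis d \<noteq> 1" "cis (m * d) = 1"
  shows "(\<Sum>j<m. cis (c + real j * d)) = 0"
proof -
  have "(\<Sum>j<m. cis (c + real j * d)) = cis c * (\<Sum>j<m. cis d ^ j)"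
    unfolding sum_distrib_left DeMoivre cis_mult ..
  also have "(\<Sum>j<m. cis d ^ j) = 0"
    using assms geometric_sum[of "cis d" m] by (simp add: DeMoivre)
  finally show ?thesis by simp
qed

lemma cis_eq_1_iff: "cis t = 1 \<longleftrightarrow> (\<exists>k::int. t = of_int k * 2 * pi)"
  by (metis cis.simps(1) cis_conv_exp complex_eq_iff cos_one_2pi_int cos_one_sin_zero one_complex.simps cis.simps(2))

lemma cis_frac_neq_1:
  assumes "n > m" "m > 0"
  shows "cis (2 * pi * real m / real n) \<noteq> 1"
proof
  assume "cis (2 * pi * real m / real n) = 1"
  then obtain k :: int where k: "2 * pi * real m / real n = of_int k * 2 * pi"
    unfolding cis_eq_1_iff by auto
  then have "(real m - of_int k * real n) * pi = 0" using assms by (simp add: field_simps)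
  then have "of_int (int m - k * int n) = (0 :: real)" by simp
  then have eq: "int m = k * int n" by linarith
  then have "k > 0" using assms by (metis mult_pos_pos of_nat_0_less_iff zero_less_mult_pos2 dual_order.strict_trans)
  then have "int n \<le> k * int n" by (simp add: mult_le_cancel_right1)
  then show False using eq assms by linarith
qed

text \<open>In (2 cos t)^4 = 6 + 8 cos 2t + 2 cos 4t only the constant survives summation: the other
  angles advance by 2 pi / n and 4 pi / n and go round a whole number of times.\<close>

lemma sum_lam_pow4:
  assumes "n \<ge> 2"
  shows "(\<Sum>j<2 * n. lam n j ^ 4) = 12 * real n"
proof -
  define t where "t j = (4 * real j + 1) * pi / (4 * real n)" for j
  have pow4: "lam n j ^ 4 = 6 + 8 * cos (2 * t j) + 2 * cos (4 * t j)" for j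
  proof -
    have 2: "cos (2 * t j) = 2 * cos (t j) ^ 2 - 1" by (rule cos_double_cos)
    have "cos (4 * t j) = 2 * cos (2 * t j) ^ 2 - 1"
      using cos_double_cos[of "2 * t j"] by simp
    then have "cos (4 * t j) = 2 * (2 * cos (t j) ^ 2 - 1) ^ 2 - 1" unfolding 2 .
    with 2 show ?thesis unfolding lam_def t_def[symmetric]
      by (simp only: power2_eq_square power4_eq_xxxx) (simp add: algebra_simps)
  qed
  have 2: "(\<Sum>j<2 * n. cos (2 * t j)) = 0"
  proof -
    have "cis (2 * pi * real 1 / real n) \<noteq> 1" using assms by (intro cis_frac_neq_1) auto
    moreover have "cis (real (2 * n) * (2 * pi / real n)) = 1"
      unfolding cis_eq_1_iff using assms by (intro exI[of _ 2]) simp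
    ultimately have "(\<Sum>j<2 * n. cis (pi / (2 * real n) + real j * (2 * pi / real n))) = 0"
      by (intro sum_cis_arith) auto
    then have "Re (\<Sum>j<2 * n. cis (pi / (2 * real n) + real j * (2 * pi / real n))) = 0" by simp
    moreover have "pi / (2 * real n) + real j * (2 * pi / real n) = 2 * t j" for j
      using assms by (simp add: t_def field_simps)
    ultimately show ?thesis by simp
  qed
  have 4: "(\<Sum>j<2 * n. cos (4 * t j)) = 0"
  \<comment> \<open>For \<open>n = 2\<close> the step 4 pi / n is a full turn and the geometric sum
    gives nothing; there each term vanishes by itself.\<close>
  proof (cases "n = 2")
    case True
    have "cos (4 * t j) = 0" for j
    proof -
      have "4 * t j = pi / 2 + pi * real (2 * j)" by (simp add: t_def True field_simps)
      then show ?thesis using sin_npi[of "2 * j"] by (simp add: cos_add mult_ac)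
    qed
    then show ?thesis by simp
  next
    case False
    have "cis (2 * pi * real 2 / real n) \<noteq> 1" using assms False by (intro cis_frac_neq_1) auto
    moreover have "cis (real (2 * n) * (4 * pi / real n)) = 1"
      unfolding cis_eq_1_iff using assms by (intro exI[of _ 4]) simp
    ultimately have "(\<Sum>j<2 * n. cis (pi / real n + real j * (4 * pi / real n))) = 0"
      by (intro sum_cis_arith) auto
    then have "Re (\<Sum>j<2 * n. cis (pi / real n + real j * (4 * pi / real n))) = 0" by simp
    moreover have "pi / real n + real j * (4 * pi / real n) = 4 * t j" for j
      using assms by (simp add: t_def field_simps)
    ultimately show ?thesis by simp
  qed
  show ?thesis unfolding pow4 by (simp add: sum.distrib 2 4 flip: sum_distrib_left)
qed

section \<open>Matrices cospectral with the cycle\<close>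

text \<open>Chebyshev polynomials of the second kind in x / 2 with the index shifted by one: the
  value at 2 cos t is sin (j t) / sin t.\<close>

fun cheb :: "nat \<Rightarrow> real \<Rightarrow> real" where
  "cheb 0 x = 0"
| "cheb (Suc 0) x = 1"
| "cheb (Suc (Suc j)) x = x * cheb (Suc j) x - cheb j x"

lemma cheb_cos: "cheb j (2 * cos t) * sin t = sin (j * t)"
proof (induction j "2 * cos t" rule: cheb.induct)
  case (3 j)
  have "(real (j + 2) * t + real j * t) / 2 = real (j + 1) * t" "(real (j + 2) * t - real j * t) / 2 = t"
    by (simp_all add: field_simps)
  then have "sin (real (j + 2) * t) + sin (real j * t) = 2 * sin (real (j + 1) * t) * cos t"
    using sin_plus_sin[of "real (j + 2) * t" "real j * t"] by simp
  moreover have "cheb (Suc (Suc j)) (2 * cos t) * sin t = 2 * cos t * sin (real (j + 1) * t) - sin (real j * t)"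
    using 3 by (simp add: left_diff_distrib mult.assoc)
  ultimately show ?case by (simp add: mult_ac)
qed auto

lemma sin_lam_angle_nz:
  assumes "n > 0"
  shows "sin ((4 * real i + 1) * pi / (4 * real n)) \<noteq> 0"
proof
  assume "sin ((4 * real i + 1) * pi / (4 * real n)) = 0"
  then obtain k :: int where "(4 * real i + 1) * pi / (4 * real n) = of_int k * pi"
    unfolding sin_zero_iff_int2 by blast
  then have "(of_int (4 * int i + 1) - of_int (k * (4 * int n))) * pi = 0"
    using assms by (simp add: field_simps)
  then have "of_int (4 * int i + 1) - of_int (k * (4 * int n)) = (0 :: real)" by simp
  then have "4 * int i + 1 = k * (4 * int n)" by linarith
  moreover have "even (k * (4 * int n))" "odd (4 * int i + 1)" by simp_all
  ultimately show False by simp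
qed

text \<open>Advancing the index by \<open>4 * n\<close> adds (4i + 1) pi to the angle, an odd
  multiple of pi.\<close>

lemma cheb_lam_period:
  assumes "n > 0"
  shows "cheb (j + 4 * n) (lam n i) = - cheb j (lam n i)"
proof -
  define t where "t = (4 * real i + 1) * pi / (4 * real n)"
  have "sin t \<noteq> 0" unfolding t_def using assms by (rule sin_lam_angle_nz)
  have "real (j + 4 * n) * t = j * t + pi * real (4 * i) + pi"
    using assms by (simp add: t_def field_simps)
  moreover have "sin (j * t + pi * real (4 * i)) = sin (j * t)"
    using sin_npi[of "4 * i"] cos_npi[of "4 * i"] by (simp add: sin_add mult.commute)
  ultimately have "sin (real (j + 4 * n) * t) = - sin (j * t)" by simp
  then have "cheb (j + 4 * n) (2 * cos t) * sin t = - cheb j (2 * cos t) * sin t"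
    unfolding cheb_cos mult_minus_left .
  then have "(cheb (j + 4 * n) (2 * cos t) + cheb j (2 * cos t)) * sin t = 0" by (simp add: distrib_right)
  then show ?thesis using \<open>sin t \<noteq> 0\<close> unfolding lam_def t_def[symmetric] by simp
qed

lemma lam_sq_less:
  assumes "n > 0"
  shows "(lam n i)\<^sup>2 < 4"
proof -
  define t where "t = (4 * real i + 1) * pi / (4 * real n)"
  have "sin t \<noteq> 0" unfolding t_def using assms by (rule sin_lam_angle_nz)
  then have "(sin t)\<^sup>2 > 0" by simp
  then have "(cos t)\<^sup>2 < 1" using sin_cos_squared_add[of t] by linarith
  then show ?thesis unfolding lam_def t_def[symmetric]
    by (simp add: power_mult_distrib)
qed

text \<open>The matrix \<open>h\<close> is continued by 0 beyond the vertices, so that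
  neighbourhoods and sums need no side conditions, and \<open>w j\<close> is a unit eigenvector for
  \<open>lam n j\<close>. The determinant is recorded for a divisibility argument.\<close>

locale cospectral =
  fixes n :: nat and h w :: "nat \<Rightarrow> nat \<Rightarrow> complex"
  assumes n: "n \<ge> 2"
    and herm: "\<And>u v. h v u = cnj (h u v)"
    and vals: "\<And>u v. h u v \<in> {0, 1, -1, \<i>, -\<i>}"
    and diag [simp]: "\<And>u. h u u = 0"
    and supp: "\<And>u v. h u v \<noteq> 0 \<Longrightarrow> u < 2 * n"
    and eig: "\<And>u j. u < 2 * n \<Longrightarrow> j < 2 * n \<Longrightarrow> (\<Sum>v<2 * n. h u v * w j v) = of_real (lam n j) * w j u"
    and ortho: "\<And>i j. i < 2 * n \<Longrightarrow> j < 2 * n \<Longrightarrow> (\<Sum>v<2 * n. cnj (w i v) * w j v) = of_bool (i = j)"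
    and compl: "\<And>u v. u < 2 * n \<Longrightarrow> v < 2 * n \<Longrightarrow> (\<Sum>j<2 * n. w j u * cnj (w j v)) = of_bool (u = v)"
    and det_h: "cmod (det (mat (2 * n) (2 * n) (\<lambda>(u, v). h u v))) = 2"
begin

definition nb :: "nat \<Rightarrow> nat set" where "nb u = {v. h u v \<noteq> 0}"

definition deg :: "nat \<Rightarrow> nat" where "deg u = card (nb u)"

text \<open>Closed sets are the unions of connected components; this spares a notion of
  path.\<close>

definition clsd :: "nat set \<Rightarrow> bool" where
  "clsd K \<longleftrightarrow> K \<subseteq> {..<2 * n} \<and> (\<forall>u\<in>K. nb u \<subseteq> K)"

lemma h_sym_nz: "h u v \<noteq> 0 \<longleftrightarrow> h v u \<noteq> 0"
  by (subst herm) simp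

lemma nb_sym: "v \<in> nb u \<longleftrightarrow> u \<in> nb v"
  using h_sym_nz by (simp add: nb_def)

lemma nb_irrefl [simp]: "u \<notin> nb u"
  by (simp add: nb_def)

lemma nb_less: "v \<in> nb u \<Longrightarrow> u < 2 * n \<and> v < 2 * n"
  using supp nb_sym by (auto simp: nb_def)

lemma nb_subset: "nb u \<subseteq> {..<2 * n}"
  using nb_less by auto

lemma finite_nb [simp]: "finite (nb u)"
  using nb_subset finite_subset by blast

lemma cmod_h: "cmod (h u v) = of_bool (v \<in> nb u)"
  using vals[of u v] by (auto simp: nb_def)

lemma h_mult_herm: "h u v * h v u = of_bool (v \<in> nb u)"
  using vals[of u v] by (subst (2) herm) (auto simp: nb_def)

lemma h_gint: "h u v \<in> gint"
  using vals[of u v] by (auto simp: gint_def)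

lemma sum_nb: "(\<Sum>v<2 * n. h u v * f v) = (\<Sum>v\<in>nb u. h u v * f v)"
  by (rule sum.mono_neutral_right) (use nb_subset in \<open>auto simp: nb_def\<close>)

lemma deg_eq_sum: "(\<Sum>v<2 * n. h u v * h v u) = of_nat (deg u)"
proof -
  have "(\<Sum>v<2 * n. h u v * h v u) = (\<Sum>v\<in>nb u. 1)"
    unfolding sum_nb by (rule sum.cong) (simp_all add: h_mult_herm)
  then show ?thesis by (simp add: deg_def)
qed

lemma h_spectral:
  assumes "u < 2 * n" "v < 2 * n"
  shows "(\<Sum>i<2 * n. of_real (lam n i) * w i u * cnj (w i v)) = h u v"
proof -
  have "(\<Sum>i<2 * n. of_real (lam n i) * w i u * cnj (w i v))
      = (\<Sum>i<2 * n. \<Sum>x<2 * n. h u x * (w i x * cnj (w i v)))"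
    using assms by (intro sum.cong refl) (simp add: sum_distrib_right mult.assoc flip: eig)
  also have "\<dots> = (\<Sum>x<2 * n. \<Sum>i<2 * n. h u x * (w i x * cnj (w i v)))" by (rule sum.swap)
  also have "\<dots> = (\<Sum>x<2 * n. h u x * of_bool (x = v))"
    using assms by (intro sum.cong refl) (simp flip: sum_distrib_left add: compl)
  also have "\<dots> = h u v" using assms by (simp add: of_bool_def if_distrib cong: if_cong)
  finally show ?thesis .
qed

subsection \<open>Expansion in the eigenbasis\<close>

lemma expand:
  assumes "u < 2 * n"
  shows "x u = (\<Sum>j<2 * n. w j u * (\<Sum>v<2 * n. cnj (w j v) * x v))"
proof -
  have "(\<Sum>j<2 * n. w j u * (\<Sum>v<2 * n. cnj (w j v) * x v))
      = (\<Sum>v<2 * n. \<Sum>j<2 * n. (w j u * cnj (w j v)) * x v)"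
    unfolding sum_distrib_left mult.assoc by (rule sum.swap)
  also have "\<dots> = (\<Sum>v<2 * n. of_bool (u = v) * x v)"
    using assms by (intro sum.cong refl) (simp add: compl flip: sum_distrib_right)
  also have "\<dots> = x u" using assms by (simp add: of_bool_def if_distrib if_distribR cong: if_cong)
  finally show ?thesis by simp
qed

lemma parseval:
  "(\<Sum>u<2 * n. (cmod (\<Sum>j<2 * n. c j * w j u))\<^sup>2) = (\<Sum>j<2 * n. (cmod (c j))\<^sup>2)"
proof -
  have "complex_of_real (\<Sum>u<2 * n. (cmod (\<Sum>j<2 * n. c j * w j u))\<^sup>2)
      = (\<Sum>u<2 * n. (\<Sum>j<2 * n. c j * w j u) * (\<Sum>i<2 * n. cnj (c i) * cnj (w i u)))"
    unfolding of_real_sum complex_norm_square by simp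
  also have "\<dots> = (\<Sum>u<2 * n. \<Sum>j<2 * n. \<Sum>i<2 * n. (c j * cnj (c i)) * (cnj (w i u) * w j u))"
    unfolding sum_product by (simp add: mult_ac)
  also have "\<dots> = (\<Sum>j<2 * n. \<Sum>i<2 * n. \<Sum>u<2 * n. (c j * cnj (c i)) * (cnj (w i u) * w j u))"
    by (subst sum.swap, rule sum.cong[OF refl], rule sum.swap)
  also have "\<dots> = (\<Sum>j<2 * n. \<Sum>i<2 * n. (c j * cnj (c i)) * of_bool (i = j))"
    by (intro sum.cong refl) (simp add: ortho flip: sum_distrib_left)
  also have "\<dots> = (\<Sum>j<2 * n. c j * cnj (c j))"
    by (intro sum.cong refl) (simp add: of_bool_def if_distrib cong: if_cong)
  also have "\<dots> = complex_of_real (\<Sum>j<2 * n. (cmod (c j))\<^sup>2)"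
    unfolding of_real_sum complex_norm_square ..
  finally show ?thesis unfolding of_real_eq_iff .
qed

text \<open>In the eigenbasis \<open>h\<close> scales each coefficient by a factor of modulus below
  2, and some coefficient is nonzero. The later uses depend on the strictness: they exclude
  configurations where equality would hold.\<close>

lemma spectral_bound:
  assumes "u0 < 2 * n" "x u0 \<noteq> 0"
  shows "(\<Sum>u<2 * n. (cmod (\<Sum>v<2 * n. h u v * x v))\<^sup>2) < 4 * (\<Sum>u<2 * n. (cmod (x u))\<^sup>2)"
proof -
  define c where "c j = (\<Sum>v<2 * n. cnj (w j v) * x v)" for j
  have x: "x u = (\<Sum>j<2 * n. c j * w j u)" if "u < 2 * n" for u
    using expand[OF that, of x] by (simp add: c_def mult.commute)
  have hx: "(\<Sum>v<2 * n. h u v * x v) = (\<Sum>j<2 * n. (of_real (lam n j) * c j) * w j u)" if "u < 2 * n" for u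
  proof -
    have "(\<Sum>v<2 * n. h u v * x v) = (\<Sum>v<2 * n. \<Sum>j<2 * n. c j * (h u v * w j v))"
      by (simp add: x sum_distrib_left mult_ac)
    also have "\<dots> = (\<Sum>j<2 * n. c j * (\<Sum>v<2 * n. h u v * w j v))"
      unfolding sum_distrib_left by (rule sum.swap)
    also have "\<dots> = (\<Sum>j<2 * n. (of_real (lam n j) * c j) * w j u)"
      using that by (intro sum.cong refl) (simp add: eig)
    finally show ?thesis .
  qed
  have sq: "(\<Sum>u<2 * n. (cmod (x u))\<^sup>2) = (\<Sum>j<2 * n. (cmod (c j))\<^sup>2)"
    using parseval[of c] by (simp add: x)
  have "(\<Sum>u<2 * n. (cmod (\<Sum>v<2 * n. h u v * x v))\<^sup>2) = (\<Sum>j<2 * n. (lam n j)\<^sup>2 * (cmod (c j))\<^sup>2)"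
    using parseval[of "\<lambda>j. of_real (lam n j) * c j"] by (simp add: hx norm_mult power_mult_distrib)
  also have "\<dots> < (\<Sum>j<2 * n. 4 * (cmod (c j))\<^sup>2)"
  proof (rule sum_strict_mono_ex1)
    have "\<not> (\<forall>j<2 * n. c j = 0)"
    proof
      assume "\<forall>j<2 * n. c j = 0"
      then have "(\<Sum>j<2 * n. c j * w j u0) = 0" by (intro sum.neutral) simp
      with x[OF assms(1)] assms(2) show False by simp
    qed
    then obtain j where j: "j < 2 * n" "c j \<noteq> 0" by blast
    have "(lam n j)\<^sup>2 < 4" using n by (intro lam_sq_less) simp
    then have "(lam n j)\<^sup>2 * (cmod (c j))\<^sup>2 < 4 * (cmod (c j))\<^sup>2"
      using j by (intro mult_strict_right_mono) auto
    then show "\<exists>j\<in>{..<2 * n}. (lam n j)\<^sup>2 * (cmod (c j))\<^sup>2 < 4 * (cmod (c j))\<^sup>2"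
      using j(1) by (intro bexI[of _ j]) simp_all
    show "\<forall>i\<in>{..<2 * n}. (lam n i)\<^sup>2 * (cmod (c i))\<^sup>2 \<le> 4 * (cmod (c i))\<^sup>2"
      using n by (intro ballI mult_right_mono less_imp_le[OF lam_sq_less]) simp_all
  qed auto
  finally show ?thesis unfolding sq sum_distrib_left .
qed

definition h2 :: "nat \<Rightarrow> nat \<Rightarrow> complex" where
  "h2 a c = (\<Sum>b<2 * n. h a b * h b c)"

text \<open>As \<open>h\<close> is Hermitian, the left-hand side is the trace of the fourth power,
  that is, the fourth moment of the spectrum.\<close>

lemma sum_h2_sq: "(\<Sum>a<2 * n. \<Sum>c<2 * n. (cmod (h2 a c))\<^sup>2) = 12 * real n"
proof -
  have h2: "h2 a c = (\<Sum>i<2 * n. (of_real (lam n i) ^ 2 * cnj (w i c)) * w i a)" if "a < 2 * n" "c < 2 * n" for a c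
  proof -
    have "h2 a c = (\<Sum>b<2 * n. \<Sum>i<2 * n. (of_real (lam n i) * cnj (w i c)) * (h a b * w i b))"
      unfolding h2_def
    proof (intro sum.cong refl)
      fix b assume "b \<in> {..<2 * n}"
      then have "h a b * h b c = h a b * (\<Sum>i<2 * n. of_real (lam n i) * w i b * cnj (w i c))"
        using that by (simp add: h_spectral)
      then show "h a b * h b c = (\<Sum>i<2 * n. (of_real (lam n i) * cnj (w i c)) * (h a b * w i b))"
        by (simp add: sum_distrib_left mult_ac)
    qed
    also have "\<dots> = (\<Sum>i<2 * n. (of_real (lam n i) * cnj (w i c)) * (\<Sum>b<2 * n. h a b * w i b))"
      unfolding sum_distrib_left by (rule sum.swap)
    also have "\<dots> = (\<Sum>i<2 * n. (of_real (lam n i) ^ 2 * cnj (w i c)) * w i a)"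
      using that by (intro sum.cong refl) (simp add: eig power2_eq_square)
    finally show ?thesis .
  qed
  have "(\<Sum>a<2 * n. \<Sum>c<2 * n. (cmod (h2 a c))\<^sup>2) = (\<Sum>c<2 * n. \<Sum>a<2 * n. (cmod (h2 a c))\<^sup>2)"
    by (rule sum.swap)
  also have "\<dots> = (\<Sum>c<2 * n. \<Sum>i<2 * n. (lam n i) ^ 4 * (cmod (w i c))\<^sup>2)"
    using parseval by (simp add: h2 norm_mult norm_power power_mult_distrib flip: power_mult)
  also have "\<dots> = (\<Sum>i<2 * n. (lam n i) ^ 4 * (\<Sum>c<2 * n. (cmod (w i c))\<^sup>2))"
    unfolding sum_distrib_left by (rule sum.swap)
  also have "\<dots> = (\<Sum>i<2 * n. (lam n i) ^ 4)"
  proof (intro sum.cong refl)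
    fix i assume i: "i \<in> {..<2 * n}"
    have "complex_of_real (\<Sum>c<2 * n. (cmod (w i c))\<^sup>2) = of_real 1"
      unfolding of_real_sum complex_norm_square using ortho[of i i] i by (simp add: mult.commute)
    then have "(\<Sum>c<2 * n. (cmod (w i c))\<^sup>2) = 1" unfolding of_real_eq_iff .
    then show "lam n i ^ 4 * (\<Sum>c<2 * n. (cmod (w i c))\<^sup>2) = lam n i ^ 4" by simp
  qed
  finally show ?thesis using sum_lam_pow4[OF n] by simp
qed

end

subsection \<open>Closed vertex sets have as many edges as vertices\<close>

lemma mpow_gint:
  assumes "\<And>x y. a x y \<in> gint"
  shows "mpow I a k u v \<in> gint"
  by (induction k arbitrary: u) (auto intro!: gint_sum simp: assms)

context cospectral
begin

text \<open>The polynomial \<open>cheb j\<close> of the matrix, defined through the eigenbasis so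
  that the sign-periodicity at the eigenvalues carries over at once. Integrality comes from the
  companion matrix instead.\<close>

definition hcheb :: "nat \<Rightarrow> nat \<Rightarrow> nat \<Rightarrow> complex" where
  "hcheb j u v = (\<Sum>i<2 * n. of_real (cheb j (lam n i)) * w i u * cnj (w i v))"

lemma hcheb_0: "hcheb 0 u v = 0"
  by (simp add: hcheb_def)

lemma hcheb_1: "u < 2 * n \<Longrightarrow> v < 2 * n \<Longrightarrow> hcheb (Suc 0) u v = of_bool (u = v)"
  by (simp add: hcheb_def compl)

lemma hcheb_rec:
  assumes "u < 2 * n"
  shows "hcheb (Suc (Suc j)) u v = (\<Sum>x<2 * n. h u x * hcheb (Suc j) x v) - hcheb j u v"
proof -
  have "(\<Sum>x<2 * n. h u x * hcheb (Suc j) x v)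
      = (\<Sum>x<2 * n. \<Sum>i<2 * n. of_real (cheb (Suc j) (lam n i)) * cnj (w i v) * (h u x * w i x))"
    unfolding hcheb_def sum_distrib_left by (simp add: mult_ac)
  also have "\<dots> = (\<Sum>i<2 * n. of_real (cheb (Suc j) (lam n i)) * cnj (w i v) * (\<Sum>x<2 * n. h u x * w i x))"
    unfolding sum_distrib_left by (rule sum.swap)
  also have "\<dots> = (\<Sum>i<2 * n. of_real (lam n i * cheb (Suc j) (lam n i)) * w i u * cnj (w i v))"
    using assms by (intro sum.cong refl) (simp add: eig)
  finally show ?thesis
    unfolding hcheb_def cheb.simps of_real_diff left_diff_distrib sum_subtractf by simp
qed

lemma hcheb_diag_real: "Im (hcheb j v v) = 0"
proof -
  have "Im (of_real c * z * cnj z) = 0" for c z by (simp add: mult.assoc complex_mult_cnj)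
  then show ?thesis unfolding hcheb_def Im_sum by (intro sum.neutral) blast
qed

lemma hcheb_period: "hcheb (j + 4 * n) u v = - hcheb j u v"
  unfolding hcheb_def using n by (simp add: cheb_lam_period sum_negf)

text \<open>The companion matrix of the recursion \<open>X\<^sub>j\<^sub>+\<^sub>2 = h X\<^sub>j\<^sub>+\<^sub>1 - X\<^sub>j\<close>; an eigenvalue \<open>2 cos t\<close> of \<open>h\<close>
  contributes the eigenvalues \<open>e\<^sup>i\<^sup>t\<close> and \<open>e\<^sup>-\<^sup>i\<^sup>t\<close>, so its powers have bounded traces.\<close>

definition cmat :: "nat \<times> bool \<Rightarrow> nat \<times> bool \<Rightarrow> complex" where
  "cmat x y = (if snd x then (if snd y then 0 else of_bool (fst x = fst y))
     else (if snd y then - of_bool (fst x = fst y) else h (fst x) (fst y)))"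

lemma cmat_gint: "cmat x y \<in> gint"
  by (auto simp: cmat_def h_gint)

lemma sum_times_bool:
  fixes f :: "'a \<times> bool \<Rightarrow> 'b :: comm_monoid_add"
  shows "sum f (K \<times> UNIV) = (\<Sum>x\<in>K. f (x, False) + f (x, True))"
proof -
  have "sum f (K \<times> UNIV) = (\<Sum>x\<in>K. \<Sum>b\<in>UNIV. f (x, b))"
    by (simp add: sum.cartesian_product)
  then show ?thesis by (simp add: UNIV_bool)
qed

lemma clsd_finite: "clsd K \<Longrightarrow> finite K"
  unfolding clsd_def using finite_subset by blast

lemma clsd_less: "clsd K \<Longrightarrow> u \<in> K \<Longrightarrow> u < 2 * n"
  unfolding clsd_def by auto

lemma sum_clsd:
  assumes "clsd K" "u \<in> K"
  shows "(\<Sum>x\<in>K. h u x * f x) = (\<Sum>x<2 * n. h u x * f x)"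
  by (rule sum.mono_neutral_left) (use assms in \<open>auto simp: clsd_def nb_def\<close>)

text \<open>Because \<open>K\<close> is closed, powers computed inside \<open>K\<close> are blocks
  of the Chebyshev matrices of the whole graph. So periodicity, known from the global spectrum,
  applies to \<open>K\<close> although the spectrum of \<open>K\<close> is unknown. The exponent
  starts at 1 to keep the smallest Chebyshev index at 0.\<close>

lemma mpow_cmat:
  assumes K: "clsd K" and "u \<in> K" "v \<in> K"
  shows "mpow (K \<times> UNIV) cmat (Suc j) (u, a) (v, b) =
    (if a then (if b then - hcheb j u v else hcheb (Suc j) u v)
     else (if b then - hcheb (Suc j) u v else hcheb (Suc (Suc j)) u v))"
  using assms(2)
proof (induction j arbitrary: u a)
  case 0
  have fin: "finite (K \<times> (UNIV :: bool set))" using clsd_finite[OF K] by simp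
  have [simp]: "u < 2 * n" "v < 2 * n" using K 0 assms(3) by (auto dest: clsd_less)
  have "mpow (K \<times> UNIV) cmat (Suc 0) (u, a) (v, b) = cmat (u, a) (v, b)"
    using fin assms(3) by (simp add: of_bool_def if_distrib cong: if_cong)
  moreover have "hcheb (Suc (Suc 0)) u v = h u v"
  proof -
    have "(\<Sum>x<2 * n. h u x * hcheb (Suc 0) x v) = (\<Sum>x<2 * n. h u x * of_bool (x = v))"
      by (intro sum.cong refl) (simp add: hcheb_1)
    then show ?thesis by (simp add: hcheb_rec hcheb_0 of_bool_def if_distrib cong: if_cong)
  qed
  ultimately show ?case by (simp add: cmat_def hcheb_1 hcheb_0)
next
  case (Suc j)
  let ?I = "K \<times> (UNIV :: bool set)"
  have u: "u < 2 * n" using K Suc.prems by (rule clsd_less)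
  have finK: "finite K" using K by (rule clsd_finite)
  have delta: "(\<Sum>x\<in>K. of_bool (u = x) * f x) = f u" for f :: "nat \<Rightarrow> complex"
  proof -
    have "(\<Sum>x\<in>K. of_bool (u = x) * f x) = (\<Sum>x\<in>K. if u = x then f x else 0)"
      by (intro sum.cong refl) simp
    then show ?thesis using finK Suc.prems by simp
  qed
  have "mpow ?I cmat (Suc (Suc j)) (u, a) (v, b)
      = (\<Sum>x\<in>K. cmat (u, a) (x, False) * mpow ?I cmat (Suc j) (x, False) (v, b)
               + cmat (u, a) (x, True) * mpow ?I cmat (Suc j) (x, True) (v, b))"
    by (subst mpow.simps(2), subst sum_times_bool) (rule refl)
  also have "\<dots> = (\<Sum>x\<in>K. cmat (u, a) (x, False) * (if b then - hcheb (Suc j) x v else hcheb (Suc (Suc j)) x v)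
               + cmat (u, a) (x, True) * (if b then - hcheb j x v else hcheb (Suc j) x v))"
    by (intro sum.cong refl) (simp only: Suc.IH if_True if_False)
  also have "\<dots> = (if a then (if b then - hcheb (Suc j) u v else hcheb (Suc (Suc j)) u v)
     else (if b then - hcheb (Suc (Suc j)) u v else hcheb (Suc (Suc (Suc j))) u v))"
  proof (cases a)
    case True
    have cm: "cmat (u, a) (x, False) = of_bool (u = x)" "cmat (u, a) (x, True) = 0" for x
      using True by (simp_all add: cmat_def)
    show ?thesis unfolding cm mult_zero_left add_0_right delta using True by simp
  next
    case False
    have split: "(\<Sum>x\<in>K. h u x * f x + - of_bool (u = x) * g x) = (\<Sum>x<2 * n. h u x * f x) - g u"
      for f g :: "nat \<Rightarrow> complex"
      using delta[of g] by (simp only: sum.distrib mult_minus_left sum_negf sum_clsd[OF K Suc.prems]) simp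
    have cm: "cmat (u, a) (x, False) = h u x" "cmat (u, a) (x, True) = - of_bool (u = x)" for x
      using False by (simp_all add: cmat_def)
    show ?thesis
    proof (cases b)
      case True
      show ?thesis unfolding cm split hcheb_rec[OF u, of j] using True False
        by (simp add: sum_negf)
    next
      case b: False
      show ?thesis unfolding cm split hcheb_rec[OF u, of "Suc j"] using b False
        by simp
    qed
  qed
  finally show ?case .
qed

text \<open>For closed \<open>K\<close> and positive \<open>j\<close> this is the trace over
  \<open>K\<close> of the Dickson polynomial \<open>dickson j\<close> of \<open>h\<close>, since sin
  ((j+1) t) - sin ((j-1) t) = 2 cos (j t) sin t. At \<open>j = 2\<close> the polynomial is h^2 -
  2.\<close>

definition ctr :: "nat set \<Rightarrow> nat \<Rightarrow> real" where
  "ctr K j = Re (\<Sum>x\<in>K \<times> UNIV. mpow (K \<times> UNIV) cmat j x x)"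

lemma ctr_Suc:
  assumes "clsd K"
  shows "ctr K (Suc j) = (\<Sum>v\<in>K. Re (hcheb (Suc (Suc j)) v v) - Re (hcheb j v v))"
  unfolding ctr_def sum_times_bool using assms by (simp add: mpow_cmat del: mpow.simps)

lemma ctr_period:
  assumes "clsd K" "j > 0"
  shows "ctr K (j + 4 * n) = - ctr K j"
proof -
  obtain i where j: "j = Suc i" using assms(2) gr0_conv_Suc by blast
  have "hcheb (Suc (Suc (i + 4 * n))) v v = - hcheb (Suc (Suc i)) v v" for v
    using hcheb_period[of "Suc (Suc i)" v v] by simp
  then show ?thesis
    unfolding j add_Suc ctr_Suc[OF assms(1)] by (simp add: hcheb_period sum_negf[symmetric])
qed

lemma ctr_bounded:
  assumes K: "clsd K"
  obtains B where "\<And>j. j > 0 \<Longrightarrow> \<bar>ctr K j\<bar> \<le> B"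
proof
  define B where "B = Max ((\<lambda>j. \<bar>ctr K j\<bar>) ` {..4 * n})"
  fix j :: nat assume "j > 0"
  then show "\<bar>ctr K j\<bar> \<le> B"
  proof (induction j rule: less_induct)
    case (less j)
    show ?case
    proof (cases "j \<le> 4 * n")
      case True
      then show ?thesis unfolding B_def by (intro Max_ge) auto
    next
      case False
      then have "\<bar>ctr K j\<bar> = \<bar>ctr K (j - 4 * n)\<bar>"
        using ctr_period[OF K, of "j - 4 * n"] by simp
      then show ?thesis using less.IH[of "j - 4 * n"] False n by simp
    qed
  qed
qed

lemma ctr_prime:
  assumes K: "clsd K" and p: "prime p" and "j > 0"
  shows "\<exists>k :: int. ctr K (j * p) = ctr K j + real p * of_int k"
proof -
  let ?I = "K \<times> (UNIV :: bool set)"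
  have fin: "finite ?I" using clsd_finite[OF K] by simp
  have "Im (mpow ?I cmat j x x) = 0" if "x \<in> ?I" for x
  proof -
    obtain i where j: "j = Suc i" using assms(3) gr0_conv_Suc by blast
    obtain u b where "x = (u, b)" "u \<in> K" using \<open>x \<in> ?I\<close> by auto
    then show ?thesis unfolding j by (auto simp: mpow_cmat[OF K] hcheb_diag_real simp del: mpow.simps)
  qed
  then have "\<exists>k :: int. Re (\<Sum>x\<in>?I. mpow ?I (mpow ?I cmat j) p x x)
      = Re (\<Sum>x\<in>?I. mpow ?I cmat j x x) + real p * of_int k"
    by (intro trace_prime_power_int[OF fin p] mpow_gint cmat_gint)
  then show ?thesis unfolding ctr_def by (simp add: mpow_mult[OF fin] cong: sum.cong)
qed

text \<open>Two numbers of modulus at most \<open>B\<close> that differ by a multiple of a prime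
  above \<open>2 * B\<close> coincide; the prime factors of \<open>g\<close> are split off one after
  the other.\<close>

lemma ctr_large_primes:
  assumes K: "clsd K" and B: "\<And>j. j > 0 \<Longrightarrow> \<bar>ctr K j\<bar> \<le> B"
    and "j > 0" "g > 0" "\<And>p. prime p \<Longrightarrow> p dvd g \<Longrightarrow> real p > 2 * B"
  shows "ctr K (j * g) = ctr K j"
  using assms(3-)
proof (induction g arbitrary: j rule: less_induct)
  case (less g)
  show ?case
  proof (cases "g = 1")
    case False
    then obtain p where p: "prime p" "p dvd g" using prime_factor_nat by blast
    then obtain g' where g: "g = p * g'" by auto
    have p1: "p > 1" using p prime_gt_1_nat by blast
    have g': "g' > 0" "g' < g" using less.prems(2) p1 by (auto simp: g)
    obtain k :: int where k: "ctr K (j * p) = ctr K j + real p * of_int k"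
      using ctr_prime[OF K p(1) less.prems(1)] by auto
    have "\<bar>real p * of_int k\<bar> \<le> 2 * B"
      using B[of "j * p"] B[of j] less.prems(1) p1 unfolding k by auto
    also have "\<dots> < real p" using less.prems(3)[OF p] .
    finally have "\<bar>real_of_int k\<bar> < 1" using p1 by (simp add: abs_mult)
    then have "k = 0" by linarith
    then have "ctr K (j * p) = ctr K j" using k by simp
    moreover have "ctr K (j * p * g') = ctr K (j * p)"
      using less.prems p1 g' by (intro less.IH) (auto simp: g)
    ultimately show ?thesis by (simp add: g mult.assoc)
  qed simp
qed

text \<open>Every unit modulo \<open>8n\<close> has a representative \<open>g\<close> with large prime factors only; the one with
  \<open>g \<equiv> 1 + 2n\<close> modulo \<open>4n\<close> changes the sign of the trace of \<open>h\<^sup>2 - 2\<close>, by periodicity.\<close>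

lemma ctr_2:
  assumes K: "clsd K"
  shows "ctr K 2 = 0"
proof -
  obtain B where B: "\<And>j. j > 0 \<Longrightarrow> \<bar>ctr K j\<bar> \<le> B" using ctr_bounded[OF K] by blast
  define m where "m = nat \<lceil>B\<rceil> + 1"
  \<comment> \<open>Every odd prime up to \<open>2 * m\<close> is a factor of this product, so
    \<open>1 + 2 * n * M\<close> has no prime factor up to \<open>2 * m\<close>. As \<open>M\<close>
    is odd, \<open>2 * g = 2 + M * (4 * n)\<close> lies an odd number of sign-changing periods
    beyond 2.\<close>
  define M where "M = (\<Prod>i<m. 2 * i + 1)"
  have oddM: "odd M" unfolding M_def by (induction m) auto
  define g where "g = 1 + 2 * n * M"
  have "real p > 2 * B" if p: "prime p" "p dvd g" for p
  proof (rule ccontr)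
    assume "\<not> real p > 2 * B"
    moreover have "B \<le> real (nat \<lceil>B\<rceil>)" by (rule real_nat_ceiling_ge)
    ultimately have "real p \<le> 2 * real (nat \<lceil>B\<rceil>)" by linarith
    then have "real p \<le> real (2 * m)" unfolding m_def by simp
    then have le: "p \<le> 2 * m" unfolding of_nat_le_iff .
    have "p dvd 2 * n * M"
    proof (cases "p = 2")
      case False
      then have "odd p" using p(1) primes_dvd_imp_eq two_is_prime_nat by blast
      then obtain i where i: "p = 2 * i + 1" by (elim oddE)
      then have "i < m" using le by simp
      then have "p dvd M" unfolding M_def i by (intro dvd_prodI) auto
      then show ?thesis by simp
    qed simp
    then have "p dvd 1" using p(2) unfolding g_def using dvd_add_left_iff by blast
    then show False using p(1) by simp
  qed
  then have eq: "ctr K (2 * g) = ctr K 2"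
    by (intro ctr_large_primes[OF K B]) (auto simp: g_def)
  have "ctr K (2 + k * (4 * n)) = (-1) ^ k * ctr K 2" for k
  proof (induction k)
    case (Suc k)
    then show ?case using ctr_period[OF K, of "2 + k * (4 * n)"] by (simp add: add_ac)
  qed simp
  from this[of M] have "ctr K (2 * g) = - ctr K 2"
    using oddM by (simp add: g_def algebra_simps)
  with eq show ?thesis by simp
qed

text \<open>The diagonal of h^2 consists of the degrees, so the vanishing trace of h^2 - 2 over
  \<open>K\<close> is a statement about degrees.\<close>

lemma sum_deg_clsd:
  assumes K: "clsd K"
  shows "(\<Sum>v\<in>K. deg v) = 2 * card K"
proof -
  have "Re (hcheb (Suc (Suc (Suc 0))) v v) - Re (hcheb (Suc 0) v v) = real (deg v) - 2" if "v \<in> K" for v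
  proof -
    have v: "v < 2 * n" using clsd_less[OF K that] .
    have "hcheb (Suc (Suc 0)) x v = h x v" if "x < 2 * n" for x
    proof -
      have "(\<Sum>y<2 * n. h x y * hcheb (Suc 0) y v) = (\<Sum>y<2 * n. h x y * of_bool (y = v))"
        using v by (intro sum.cong refl) (simp add: hcheb_1)
      then show ?thesis using that v
        by (simp add: hcheb_rec hcheb_0 of_bool_def if_distrib cong: if_cong)
    qed
    then have "(\<Sum>x<2 * n. h v x * hcheb (Suc (Suc 0)) x v) = of_nat (deg v)"
      unfolding deg_eq_sum[symmetric] by (intro sum.cong refl) simp
    then have "hcheb (Suc (Suc (Suc 0))) v v = of_nat (deg v) - 1"
      using v hcheb_rec[OF v, of "Suc 0" v] by (simp only: hcheb_1) simp
    then show ?thesis using v by (simp add: hcheb_1)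
  qed
  then have "(\<Sum>v\<in>K. real (deg v) - 2) = 0"
    using ctr_2[OF K] ctr_Suc[OF K, of "Suc 0"] by (simp add: numeral_2_eq_2)
  then have "real (\<Sum>v\<in>K. deg v) = real (2 * card K)" by (simp add: sum_subtractf)
  then show ?thesis unfolding of_nat_eq_iff .
qed

text \<open>A set that is not closed acquires at least one new edge with each vertex added to it.\<close>

lemma induced_edges_le:
  assumes "B \<subseteq> {..<2 * n}"
  shows "(\<Sum>v\<in>B. card (nb v \<inter> B)) \<le> 2 * card B"
  using assms
proof (induction "2 * n - card B" arbitrary: B rule: less_induct)
  case (less B)
  have fin: "finite B" using less.prems finite_subset by blast
  show ?case
  proof (cases "clsd B")
    case True
    then have "(\<Sum>v\<in>B. card (nb v \<inter> B)) = (\<Sum>v\<in>B. deg v)"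
      unfolding deg_def by (intro sum.cong refl arg_cong[of _ _ card]) (auto simp: clsd_def)
    then show ?thesis using sum_deg_clsd[OF True] by simp
  next
    case False
    then obtain u x where x: "x \<in> B" "u \<in> nb x" "u \<notin> B" using less.prems by (auto simp: clsd_def)
    have u: "u < 2 * n" using nb_less[OF x(2)] by simp
    have "card (insert u B) \<le> card {..<2 * n}"
      using less.prems u by (intro card_mono) auto
    then have "(\<Sum>v\<in>insert u B. card (nb v \<inter> insert u B)) \<le> 2 * card (insert u B)"
      using less.prems u fin x by (intro less.hyps) auto
    \<comment> \<open>The sum counts each edge twice, so the edge between \<open>x\<close> and
      \<open>u\<close> contributes 2, which is what the right-hand side gains from the vertex
      \<open>u\<close>.\<close>
    moreover have "(\<Sum>v\<in>insert u B. card (nb v \<inter> insert u B)) \<ge> (\<Sum>v\<in>B. card (nb v \<inter> B)) + 2"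
    proof -
      have "(\<Sum>v\<in>B. card (nb v \<inter> insert u B)) \<ge> (\<Sum>v\<in>B. card (nb v \<inter> B)) + 1"
      proof -
        have "(\<Sum>v\<in>B. card (nb v \<inter> B)) < (\<Sum>v\<in>B. card (nb v \<inter> insert u B))"
        proof (rule sum_strict_mono_ex1[OF fin])
          show "\<forall>v\<in>B. card (nb v \<inter> B) \<le> card (nb v \<inter> insert u B)"
            by (auto intro!: card_mono)
          have "card (nb x \<inter> B) < card (nb x \<inter> insert u B)"
            using x by (intro psubset_card_mono) auto
          then show "\<exists>v\<in>B. card (nb v \<inter> B) < card (nb v \<inter> insert u B)" using x by blast
        qed
        then show ?thesis by simp
      qed
      moreover have "card (nb u \<inter> insert u B) \<ge> 1"
        using x nb_sym[of u x] by (simp add: Suc_le_eq card_gt_0_iff) auto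
      ultimately show ?thesis using x fin by simp
    qed
    ultimately show ?thesis using x fin by simp
  qed
qed

end

subsection \<open>Local structure\<close>

context cospectral
begin

text \<open>The form of the norm bound for test vectors: checking each vertex separately replaces
  the computation of two norms.\<close>

lemma no_expansion:
  assumes "\<And>u. u < 2 * n \<Longrightarrow> 2 * cmod (x u) \<le> cmod (\<Sum>v<2 * n. h u v * x v)" and "u < 2 * n"
  shows "x u = 0"
proof (rule ccontr)
  assume "x u \<noteq> 0"
  then have "(\<Sum>u<2 * n. (cmod (\<Sum>v<2 * n. h u v * x v))\<^sup>2) < (\<Sum>u<2 * n. (2 * cmod (x u))\<^sup>2)"
    using spectral_bound[of u x] assms(2) by (simp add: power_mult_distrib sum_distrib_left)
  moreover have "(\<Sum>u<2 * n. (2 * cmod (x u))\<^sup>2) \<le> (\<Sum>u<2 * n. (cmod (\<Sum>v<2 * n. h u v * x v))\<^sup>2)"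
    using assms(1) by (intro sum_mono power_mono) auto
  ultimately show False by simp
qed

lemma h2_eq: "h2 a c = (\<Sum>b\<in>nb a \<inter> nb c. h a b * h b c)"
  unfolding h2_def
proof (rule sum.mono_neutral_right)
  show "nb a \<inter> nb c \<subseteq> {..<2 * n}" using nb_subset by auto
  show "\<forall>i\<in>{..<2 * n} - nb a \<inter> nb c. h a i * h i c = 0"
    using h_sym_nz by (auto simp: nb_def)
qed simp

lemma h2_herm: "h2 c a = cnj (h2 a c)"
  unfolding h2_def cnj_sum complex_cnj_mult by (simp only: herm[symmetric] mult.commute)

lemma h2_diag: "h2 a a = of_nat (deg a)"
  unfolding h2_def by (rule deg_eq_sum)

lemma sum_cmod_h: "(\<Sum>u<2 * n. (cmod (h u a))\<^sup>2) = real (deg a)"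
proof -
  have "complex_of_real (\<Sum>u<2 * n. (cmod (h u a))\<^sup>2) = of_real (real (deg a))"
    unfolding of_real_sum complex_norm_square herm[symmetric] using deg_eq_sum[of a] by (simp add: mult.commute)
  then show ?thesis unfolding of_real_eq_iff .
qed

lemma deg_le_3:
  assumes "a < 2 * n"
  shows "deg a \<le> 3"
proof -
  define x where "x u = (of_bool (u = a) :: complex)" for u
  have "(\<Sum>v<2 * n. h u v * x v) = h u a" for u
    using assms by (simp add: x_def of_bool_def if_distrib cong: if_cong)
  moreover have "(\<Sum>u<2 * n. (cmod (x u))\<^sup>2) = 1"
    using assms by (simp add: x_def of_bool_def if_distrib if_distribR cong: if_cong)
  ultimately have "real (deg a) < 4"
    using spectral_bound[of a x] assms by (simp add: x_def sum_cmod_h)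
  then show ?thesis by simp
qed

lemma deg_ge_1:
  assumes "a < 2 * n"
  shows "deg a \<ge> 1"
proof (rule ccontr)
  assume "\<not> deg a \<ge> 1"
  then have "deg a = 0" by simp
  moreover from this have "nb a = {}" by (simp add: deg_def)
  ultimately show False using sum_deg_clsd[of "{a}"] assms by (simp add: clsd_def)
qed

text \<open>By the norm bound 4 - h^2 is positive definite, and this is the positivity of its
  principal minor for \<open>a\<close> and \<open>c\<close>.\<close>

lemma h2_bound:
  assumes "a < 2 * n" "c < 2 * n" "a \<noteq> c"
  shows "(cmod (h2 a c))\<^sup>2 < (4 - real (deg a)) * (4 - real (deg c))"
proof -
  define al where "al = 4 - real (deg a)"
  have al: "al > 0" using deg_le_3[OF assms(1)] by (simp add: al_def)
  define z where "z = h2 a c"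
  \<comment> \<open>The value at \<open>a\<close> is chosen so that the entry of (4 - h^2) x at
    \<open>a\<close> is 0; among vectors supported on the two vertices with the given value at
    \<open>c\<close>, this minimises the quadratic form.\<close>
  define x where "x u = (if u = a then z else if u = c then of_real al else 0)" for u
  have hx: "(\<Sum>v<2 * n. h u v * x v) = h u a * z + h u c * of_real al" for u
  proof -
    have "(\<Sum>v<2 * n. h u v * x v) = (\<Sum>v\<in>{a, c}. h u v * x v)"
      by (rule sum.mono_neutral_right) (use assms in \<open>auto simp: x_def\<close>)
    then show ?thesis using assms(3) by (simp add: x_def)
  qed
  have xx: "(\<Sum>u<2 * n. (cmod (x u))\<^sup>2) = (cmod z)\<^sup>2 + al\<^sup>2"
  proof -
    have "(\<Sum>u<2 * n. (cmod (x u))\<^sup>2) = (\<Sum>u\<in>{a, c}. (cmod (x u))\<^sup>2)"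
      by (rule sum.mono_neutral_right) (use assms in \<open>auto simp: x_def\<close>)
    then show ?thesis using assms(3) al by (simp add: x_def)
  qed
  have "complex_of_real (\<Sum>u<2 * n. (cmod (h u a * z + h u c * of_real al))\<^sup>2)
      = (\<Sum>u<2 * n. h a u * h u a * (z * cnj z) + of_real (al\<^sup>2) * (h c u * h u c)
           + of_real al * z * (h c u * h u a) + of_real al * cnj z * (h a u * h u c))"
    unfolding of_real_sum complex_norm_square complex_cnj_add complex_cnj_mult herm[symmetric]
    by (intro sum.cong refl) (simp add: algebra_simps power2_eq_square)
  also have "\<dots> = of_nat (deg a) * (z * cnj z) + of_real (al\<^sup>2) * of_nat (deg c)
           + of_real al * z * cnj z + of_real al * cnj z * z"
    unfolding sum.distrib sum_distrib_left[symmetric] sum_distrib_right[symmetric] deg_eq_sum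
      h2_def[symmetric] z_def h2_herm[of c a] by simp
  also have "\<dots> = complex_of_real (real (deg a) * (cmod z)\<^sup>2 + al\<^sup>2 * real (deg c) + 2 * al * (cmod z)\<^sup>2)"
    unfolding of_real_add of_real_mult complex_norm_square by (simp add: algebra_simps)
  finally have "(\<Sum>u<2 * n. (cmod (\<Sum>v<2 * n. h u v * x v))\<^sup>2)
      = real (deg a) * (cmod z)\<^sup>2 + al\<^sup>2 * real (deg c) + 2 * al * (cmod z)\<^sup>2"
    unfolding hx of_real_eq_iff .
  moreover have "x c \<noteq> 0" using assms al by (simp add: x_def)
  ultimately have "real (deg a) * (cmod z)\<^sup>2 + al\<^sup>2 * real (deg c) + 2 * al * (cmod z)\<^sup>2 < 4 * ((cmod z)\<^sup>2 + al\<^sup>2)"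
    using spectral_bound[of c x] assms(2) xx by simp
  moreover have "real (deg a) = 4 - al" by (simp add: al_def)
  ultimately have "al * (cmod z)\<^sup>2 < al * (al * (4 - real (deg c)))"
    by (simp add: algebra_simps power2_eq_square)
  then show ?thesis using al unfolding al_def z_def by simp
qed

text \<open>Opposite corners of a negative quadrangle: the two paths of length 2 between them have
  cancelling weights.\<close>

definition bad :: "nat \<Rightarrow> nat \<Rightarrow> bool" where
  "bad a c \<longleftrightarrow> a \<noteq> c \<and> card (nb a \<inter> nb c) = 2 \<and> h2 a c = 0"

lemma h_path_unit: "b \<in> nb a \<inter> nb c \<Longrightarrow> h a b * h b c \<in> {1, -1, \<i>, -\<i>}"
  using vals[of a b] vals[of b c] nb_sym[of b c] by (auto simp: nb_def)

text \<open>Three common neighbours would force degree 3 at both ends and so an entry of h^2 of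
  modulus below 1, but a sum of three fourth roots of unity has modulus at least 1. For two common
  neighbours the bound excludes equal path weights, so the squared modulus is 2 unless they
  cancel.\<close>

lemma common_nb:
  assumes "a < 2 * n" "c < 2 * n" "a \<noteq> c"
  shows "card (nb a \<inter> nb c) \<le> 2"
    and "real (card (nb a \<inter> nb c)) - (cmod (h2 a c))\<^sup>2 = 2 * of_bool (bad a c)"
proof -
  let ?C = "nb a \<inter> nb c"
  define t where "t b = h a b * h b c" for b
  have t: "t b \<in> {1, -1, \<i>, -\<i>}" if "b \<in> ?C" for b
    using h_path_unit[OF that] by (simp add: t_def)
  have z: "h2 a c = sum t ?C" by (simp add: h2_eq t_def)
  have da: "card ?C \<le> deg a" and dc: "card ?C \<le> deg c" unfolding deg_def by (auto intro!: card_mono)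
  have le3: "card ?C \<le> 3" using da deg_le_3[OF assms(1)] by simp
  have not3: "card ?C \<noteq> 3"
  proof
    assume c3: "card ?C = 3"
    then obtain x y v where "?C = {x, y, v}" "x \<noteq> y" "y \<noteq> v" "x \<noteq> v" by (auto simp: card_3_iff)
    then have "h2 a c = t x + t y + t v" "t x \<in> {1, -1, \<i>, -\<i>}" "t y \<in> {1, -1, \<i>, -\<i>}" "t v \<in> {1, -1, \<i>, -\<i>}"
      using z t by auto
    then have "(cmod (h2 a c))\<^sup>2 \<ge> 1" by (auto simp: cmod_power2)
    moreover have "deg a = 3" "deg c = 3" using da dc c3 deg_le_3 assms by (auto intro!: antisym)
    then have "(cmod (h2 a c))\<^sup>2 < 1" using h2_bound[OF assms] by simp
    ultimately show False by simp
  qed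
  then show "card ?C \<le> 2" using le3 by simp
  then consider "card ?C = 0" | "card ?C = 1" | "card ?C = 2" by linarith
  then show "real (card ?C) - (cmod (h2 a c))\<^sup>2 = 2 * of_bool (bad a c)"
  proof cases
    case 1
    then have "?C = {}" by simp
    then have "h2 a c = 0" unfolding z by simp
    then show ?thesis using 1 by (simp add: bad_def)
  next
    case 2
    then obtain x where "?C = {x}" by (auto simp: card_1_singleton_iff)
    then have "h2 a c = t x" "t x \<in> {1, -1, \<i>, -\<i>}" using z t by auto
    then have "(cmod (h2 a c))\<^sup>2 = 1" by (auto simp: cmod_power2)
    then show ?thesis using 2 by (simp add: bad_def)
  next
    case 3
    then obtain x y where "?C = {x, y}" "x \<noteq> y" by (auto simp: card_2_iff)
    then have e: "h2 a c = t x + t y" "t x \<in> {1, -1, \<i>, -\<i>}" "t y \<in> {1, -1, \<i>, -\<i>}"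
      using z t by auto
    have "real (deg a) \<ge> 2" "real (deg c) \<ge> 2" "real (deg a) \<le> 3" "real (deg c) \<le> 3"
      using da dc 3 deg_le_3 assms by auto
    then have "(4 - real (deg a)) * (4 - real (deg c)) \<le> 2 * 2" by (intro mult_mono) auto
    then have "(cmod (h2 a c))\<^sup>2 < 4" using h2_bound[OF assms] by simp
    then have "h2 a c = 0 \<or> (cmod (h2 a c))\<^sup>2 = 2" using e by (auto simp: cmod_power2)
    then show ?thesis using 3 assms(3) by (auto simp: bad_def)
  qed
qed

lemma bad_sym: "bad a c \<longleftrightarrow> bad c a"
  unfolding bad_def h2_herm[of c a] Int_commute[of "nb c"] by auto

lemma bad_less: "bad a c \<Longrightarrow> a < 2 * n \<and> c < 2 * n"
  unfolding bad_def by (metis Int_iff card.empty card_eq_SucD equals0I nb_less numeral_2_eq_2 zero_neq_numeral)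

section \<open>Counting negative quadrangles by the fourth moment\<close>

definition D3 :: "nat set" where "D3 = {v. v < 2 * n \<and> deg v = 3}"

lemma deg_cases:
  assumes "a < 2 * n"
  shows "deg a = 1 \<or> deg a = 2 \<or> deg a = 3"
  using deg_le_3[OF assms] deg_ge_1[OF assms] by linarith

lemma sum_deg: "(\<Sum>v<2 * n. deg v) = 4 * n"
  using sum_deg_clsd[of "{..<2 * n}"] nb_subset by (simp add: clsd_def)

text \<open>The fourth moment is compared with the sum of the squared degrees, which counts common
  neighbours over ordered pairs. Off the diagonal they differ by 2 for each bad pair. As the degrees
  are 1, 2 or 3 with mean 2, the sum of their squares is determined by the number of threes.\<close>

lemma card_bad: "card {(a, c). bad a c} = 2 * card D3"
proof -
  have Bset: "{(a, c). bad a c} = (SIGMA a:{..<2 * n}. {c. c < 2 * n \<and> bad a c})"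
    using bad_less by auto
  have deg2: "real (deg v) ^ 2 = 2 * of_bool (v \<in> D3) + 3 * real (deg v) - 2" if "v < 2 * n" for v
    using deg_cases[OF that] that by (auto simp: D3_def)
  have "(\<Sum>v<2 * n. real (deg v) ^ 2) = 2 * real (card D3) + 8 * real n"
  proof -
    have "(\<Sum>v<2 * n. real (deg v) ^ 2) = (\<Sum>v<2 * n. 2 * of_bool (v \<in> D3) + 3 * real (deg v) - 2)"
      using deg2 by (intro sum.cong refl) simp
    also have "\<dots> = 2 * (\<Sum>v<2 * n. of_bool (v \<in> D3)) + 3 * real (\<Sum>v<2 * n. deg v) - 4 * real n"
      by (simp add: sum.distrib sum_subtractf sum_distrib_left)
    also have "(\<Sum>v<2 * n. of_bool (v \<in> D3)) = real (card D3)"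
    proof -
      have "D3 = {v \<in> {..<2 * n}. v \<in> D3}" by (auto simp: D3_def)
      then have "card D3 = card {v \<in> {..<2 * n}. v \<in> D3}" by simp
      also have "real \<dots> = (\<Sum>v<2 * n. of_bool (v \<in> D3))"
        by (simp add: sum_of_bool_eq Int_def)
      finally show ?thesis ..
    qed
    finally show ?thesis unfolding sum_deg by simp
  qed
  note sq = this
  have pairs: "(\<Sum>a<2 * n. \<Sum>c<2 * n. real (card (nb a \<inter> nb c))) = (\<Sum>b<2 * n. real (deg b) ^ 2)"
  proof -
    have ind: "real (card (nb a \<inter> nb c)) = (\<Sum>b<2 * n. of_bool (b \<in> nb a) * of_bool (b \<in> nb c))" for a c
    proof -
      have "{..<2 * n} \<inter> {b. b \<in> nb a \<and> b \<in> nb c} = nb a \<inter> nb c" using nb_subset by auto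
      then show ?thesis by (simp flip: of_bool_conj)
    qed
    have d: "(\<Sum>a<2 * n. of_bool (b \<in> nb a)) = real (deg b)" for b
    proof -
      have "{..<2 * n} \<inter> {a. b \<in> nb a} = nb b" using nb_subset nb_sym by auto
      then show ?thesis by (simp add: deg_def)
    qed
    have "(\<Sum>a<2 * n. \<Sum>c<2 * n. real (card (nb a \<inter> nb c)))
        = (\<Sum>a<2 * n. \<Sum>b<2 * n. \<Sum>c<2 * n. of_bool (b \<in> nb a) * of_bool (b \<in> nb c))"
      unfolding ind by (rule sum.cong[OF refl], rule sum.swap)
    also have "\<dots> = (\<Sum>b<2 * n. \<Sum>a<2 * n. \<Sum>c<2 * n. of_bool (b \<in> nb a) * of_bool (b \<in> nb c))"
      by (rule sum.swap)
    also have "\<dots> = (\<Sum>b<2 * n. real (deg b) ^ 2)"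
      unfolding sum_distrib_left[symmetric] sum_distrib_right[symmetric] d by (simp add: power2_eq_square)
    finally show ?thesis .
  qed
  have "(\<Sum>a<2 * n. \<Sum>c<2 * n. real (card (nb a \<inter> nb c)) - (cmod (h2 a c))\<^sup>2)
      = (\<Sum>a<2 * n. \<Sum>c<2 * n. 2 * of_bool (bad a c) + of_bool (a = c) * (real (deg a) - real (deg a) ^ 2))"
  proof (intro sum.cong refl)
    fix a c assume "a \<in> {..<2 * n}" "c \<in> {..<2 * n}"
    then show "real (card (nb a \<inter> nb c)) - (cmod (h2 a c))\<^sup>2
        = 2 * of_bool (bad a c) + of_bool (a = c) * (real (deg a) - real (deg a) ^ 2)"
      using common_nb(2)[of a c] by (cases "a = c") (auto simp: h2_diag bad_def deg_def)
  qed
  also have "\<dots> = 2 * real (card {(a, c). bad a c}) + (\<Sum>a<2 * n. real (deg a) - real (deg a) ^ 2)"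
  proof -
    have 1: "(\<Sum>a<2 * n. \<Sum>c<2 * n. of_bool (bad a c)) = real (card {(a, c). bad a c})"
      unfolding Bset by (simp add: Int_def)
    have 2: "(\<Sum>c<2 * n. of_bool (a = c) * (real (deg a) - real (deg a) ^ 2)) = real (deg a) - real (deg a) ^ 2"
      if "a \<in> {..<2 * n}" for a
    proof -
      have "{..<2 * n} \<inter> {c. a = c} = {a}" using that by auto
      then show ?thesis by (simp flip: sum_distrib_right)
    qed
    show ?thesis unfolding sum.distrib sum_distrib_left[symmetric] 1 using 2 by simp
  qed
  also have "(\<Sum>a<2 * n. real (deg a) - real (deg a) ^ 2) = real (\<Sum>v<2 * n. deg v) - (\<Sum>a<2 * n. real (deg a) ^ 2)"
    by (simp add: sum_subtractf)
  finally have "real (card {(a, c). bad a c}) = real (2 * card D3)"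
    using sum_h2_sq sq unfolding sum_subtractf pairs sum_deg by simp
  then show ?thesis unfolding of_nat_eq_iff .
qed

lemma edges_le:
  assumes "finite B" "P \<subseteq> B \<times> B" "\<And>u v. (u, v) \<in> P \<Longrightarrow> v \<in> nb u" "\<And>u v. (u, v) \<in> P \<Longrightarrow> (v, u) \<notin> P"
  shows "card P \<le> card B"
proof -
  define B' where "B' = B \<inter> {..<2 * n}"
  have PB: "P \<subseteq> B' \<times> B'" using assms(2,3) nb_less by (fastforce simp: B'_def)
  have finP: "finite P" using assms(1,2) finite_subset by blast
  have "2 * card P = card (P \<union> P\<inverse>)"
    using finP assms(4) by (subst card_Un_disjoint) (auto simp: card_inverse)
  also have "\<dots> \<le> card (SIGMA v:B'. nb v \<inter> B')"
    using PB assms(1,3) nb_sym by (intro card_mono) (auto simp: B'_def)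
  also have "\<dots> = (\<Sum>v\<in>B'. card (nb v \<inter> B'))"
    using assms(1) by (subst card_SigmaI) (auto simp: B'_def)
  also have "\<dots> \<le> 2 * card B'" by (rule induced_edges_le) (auto simp: B'_def)
  also have "\<dots> \<le> 2 * card B" using assms(1) by (simp add: card_mono B'_def)
  finally show ?thesis by simp
qed

text \<open>A tool for refuting local configurations: one lists more edges than vertices, each edge
  in one direction only.\<close>

lemma length_edges_le:
  assumes "distinct es" "\<forall>(u, v)\<in>set es. v \<in> nb u \<and> u \<in> set bs \<and> v \<in> set bs"
    "\<forall>(u, v)\<in>set es. (v, u) \<notin> set es"
  shows "length es \<le> length bs"
proof -
  have "length es = card (set es)" using assms(1) by (simp add: distinct_card)
  also have "\<dots> \<le> card (set bs)" using assms(2,3) by (intro edges_le) auto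
  also have "\<dots> \<le> length bs" by (rule card_length)
  finally show ?thesis .
qed

end

subsection \<open>Negative quadrangles\<close>

lemma det_gint:
  assumes "\<And>i j. f i j \<in> gint"
  shows "det (mat m m (\<lambda>(i, j). f i j)) \<in> gint"
proof -
  have "(\<Prod>i = 0..<m. mat m m (\<lambda>(i, j). f i j) $$ (i, p i)) \<in> gint" if "p permutes {0..<m}" for p
  proof (rule gint_prod)
    fix i assume "i \<in> {0..<m}"
    moreover then have "p i \<in> {0..<m}" using that by (simp add: permutes_in_image)
    ultimately show "mat m m (\<lambda>(i, j). f i j) $$ (i, p i) \<in> gint" using assms by simp
  qed
  moreover have "signof p \<in> gint" for p by (cases p rule: sign_cases) simp_all
  ultimately show ?thesis
    by (subst det_def'[of _ m]) (auto intro!: gint_sum)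
qed

context cospectral
begin

text \<open>If both vertices of a bad pair had degree 2, then one row and one column operation would give
  a row and a column that are divisible by 2, and 4 would divide the determinant.\<close>

lemma bad_has_deg_3:
  assumes "bad b d"
  shows "deg b = 3 \<or> deg d = 3"
proof (rule ccontr)
  assume not3: "\<not> (deg b = 3 \<or> deg d = 3)"
  have bd: "b < 2 * n" "d < 2 * n" "b \<noteq> d" using bad_less assms by (auto simp: bad_def)
  have c2: "card (nb b \<inter> nb d) = 2" using assms by (simp add: bad_def)
  then obtain a c where ac: "nb b \<inter> nb d = {a, c}" "a \<noteq> c" by (auto simp: card_2_iff)
  have "card (nb b) \<le> 2" "card (nb d) \<le> 2"
    using deg_cases[OF bd(1)] deg_cases[OF bd(2)] not3 unfolding deg_def by auto
  then have nb: "nb b = {a, c}" "nb d = {a, c}"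
    using card_seteq[of "nb b" "nb b \<inter> nb d"] card_seteq[of "nb d" "nb b \<inter> nb d"] c2 ac(1) by auto
  have zero: "h b a * h a d + h b c * h c d = 0"
    using assms ac unfolding bad_def h2_eq by simp
  \<comment> \<open>After multiplication by this factor row \<open>d\<close> agrees with row
    \<open>b\<close> at \<open>a\<close> and is opposite to it at \<open>c\<close>, so their sum is
    \<open>2 * h b a\<close> at \<open>a\<close> and 0 elsewhere.\<close>
  define u where "u = h b a * h a d"
  have "a \<in> nb b" "a \<in> nb d" using nb by simp_all
  then have ab: "a \<noteq> b" "d \<noteq> a" "a < 2 * n" using nb_irrefl nb_less by metis+
  have hb: "h b j = 0" "h d j = 0" if "j \<noteq> a" "j \<noteq> c" for j using nb that by (auto simp: nb_def)
  have ad: "h a d * h d a = 1" using nb h_mult_herm[of a d] nb_sym[of a d] by simp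
  have cd: "h c d * h d c = 1" using nb h_mult_herm[of c d] nb_sym[of c d] by simp
  have "u * h d a = h b a" using ad by (simp add: u_def mult.assoc)
  moreover have "u * h d c + h b c = (h b a * h a d + h b c * h c d) * h d c"
    using cd by (simp add: u_def distrib_right mult.assoc)
  ultimately have "u * h d a = h b a" "u * h d c + h b c = 0" using zero by simp_all
  note uda = this
  then have row: "u * h d j + h b j = (if j = a then 2 * h b a else 0)" for j
    using hb[of j] ac(2) by (cases "j = a"; cases "j = c") auto
  \<comment> \<open>\<open>F1\<close> is \<open>h\<close> after this row operation, and
    \<open>F2\<close> applies the conjugate operation to the transpose, which amounts to the column
    operation. \<open>F3\<close> and \<open>F4\<close> take a factor 2 out of row \<open>b\<close>,
    with one more transposition in between.\<close>
  define F1 where "F1 i j = (if i = b then if j = a then 2 * h b a else 0 else h i j)" for i j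
  define F2 where "F2 i j = (if i = b then if j = a then 2 * h a b else 0 else F1 j i)" for i j
  define F3 where "F3 i j = (if i = b then if j = a then h a b else 0 else F1 j i)" for i j
  define F4 where "F4 i j = (if i = b then if j = a then h b a else 0 else F3 j i)" for i j
  define A where "A F = mat (2 * n) (2 * n) (\<lambda>(i, j). F i j)" for F :: "nat \<Rightarrow> nat \<Rightarrow> complex"
  have A [simp]: "A F \<in> carrier_mat (2 * n) (2 * n)" for F by (simp add: A_def)
  have tr: "det (A (\<lambda>i j. F j i)) = det (A F)" for F
  proof -
    have "A (\<lambda>i j. F j i) = transpose_mat (A F)" by (rule eq_matI) (auto simp: A_def)
    then show ?thesis using det_transpose[of "A F" "2 * n"] by simp
  qed
  have "A F1 = addrow u b d (A h)"
    by (rule eq_matI) (use bd row uda(1) in \<open>auto simp: A_def F1_def\<close>)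
  then have 1: "det (A F1) = det (A h)" using bd by (simp add: det_addrow[of d "2 * n" b])
  have row': "cnj u * h j d + h j b = (if j = a then 2 * h a b else 0)" for j
  proof -
    have "cnj u * h j d + h j b = cnj (u * h d j + h b j)"
      unfolding complex_cnj_add complex_cnj_mult herm[symmetric] ..
    then show ?thesis unfolding row using herm[of a b] by simp
  qed
  from row'[of a] have uda': "cnj u * h a d = h a b" by simp
  have "A F2 = addrow (cnj u) b d (A (\<lambda>i j. F1 j i))"
    by (rule eq_matI) (use bd ab row' uda' in \<open>auto simp: A_def F2_def F1_def\<close>)
  then have 2: "det (A F2) = det (A F1)" using bd by (simp add: det_addrow[of d "2 * n" b] tr[of F1])
  have "A F2 = multrow b 2 (A F3)"
    by (rule eq_matI) (auto simp: A_def F2_def F3_def)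
  then have 3: "det (A F2) = 2 * det (A F3)" using bd by (simp add: det_multrow[of b "2 * n"])
  have "A (\<lambda>i j. F3 j i) = multrow b 2 (A F4)"
    by (rule eq_matI) (use ab in \<open>auto simp: A_def F4_def F3_def F1_def\<close>)
  then have 4: "det (A F3) = 2 * det (A F4)" using bd by (simp add: det_multrow[of b "2 * n"] flip: tr[of F3])
  have "F4 i j \<in> gint" for i j by (simp add: F4_def F3_def F1_def h_gint)
  then have "det (A F4) \<in> gint" unfolding A_def by (rule det_gint)
  then have "(cmod (det (A F4)))\<^sup>2 \<in> \<int>" by (rule gint_cmod_sq)
  then obtain k :: int where k: "(cmod (det (A F4)))\<^sup>2 = of_int k" by (auto elim: Ints_cases)
  have "cmod (4 * det (A F4)) = 2" using det_h 1 2 3 4 unfolding A_def[symmetric] by simp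
  then have half: "cmod (det (A F4)) = 1 / 2" by (simp add: norm_mult)
  have "of_int (4 * k) = (1 :: real)" using k unfolding half by (simp add: power2_eq_square)
  then have "4 * k = 1" by linarith
  then show False by presburger
qed

text \<open>As \<open>a\<close> has at most three neighbours, the two quadrangles share a neighbour
  \<open>b\<close> of \<open>a\<close>. They share only one, because two would have the three common
  neighbours \<open>a\<close>, \<open>c\<close>, \<open>c'\<close>. Then the two quadrangles
  together have more edges than vertices.\<close>

lemma bad_unique:
  assumes ac: "bad a c" and ac': "bad a c'"
  shows "c = c'"
proof (rule ccontr)
  assume neq: "c \<noteq> c'"
  note lt = bad_less[OF ac] bad_less[OF ac']
  have aneq: "a \<noteq> c" "a \<noteq> c'" using ac ac' by (auto simp: bad_def)
  have c2: "card (nb a \<inter> nb c) = 2" "card (nb a \<inter> nb c') = 2" using ac ac' by (auto simp: bad_def)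
  have "card ((nb a \<inter> nb c) \<union> (nb a \<inter> nb c')) \<le> deg a"
    unfolding deg_def by (intro card_mono) auto
  moreover have "card ((nb a \<inter> nb c) \<union> (nb a \<inter> nb c')) + card (nb a \<inter> nb c \<inter> nb c') = 4"
    using card_Un_Int[of "nb a \<inter> nb c" "nb a \<inter> nb c'"] c2 by (simp add: Int_ac)
  ultimately have "card (nb a \<inter> nb c \<inter> nb c') \<ge> 1" using deg_le_3[of a] lt by linarith
  moreover have "card (nb a \<inter> nb c \<inter> nb c') \<noteq> 2"
  proof
    assume "card (nb a \<inter> nb c \<inter> nb c') = 2"
    then obtain b d where "nb a \<inter> nb c \<inter> nb c' = {b, d}" "b \<noteq> d" by (auto simp: card_2_iff)
    then have "{a, c, c'} \<subseteq> nb b \<inter> nb d" "b < 2 * n" "d < 2 * n"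
      using nb_sym nb_less by blast+
    then have "card {a, c, c'} \<le> 2"
      using common_nb(1)[of b d] \<open>b \<noteq> d\<close> card_mono[of "nb b \<inter> nb d" "{a, c, c'}"] by simp
    then show False using neq aneq by simp
  qed
  moreover have "card (nb a \<inter> nb c \<inter> nb c') \<le> 2"
    using c2 card_mono[OF _ Int_lower1, of "nb a \<inter> nb c" "nb c'"] by simp
  ultimately have "card (nb a \<inter> nb c \<inter> nb c') = 1" by linarith
  then obtain b where b: "nb a \<inter> nb c \<inter> nb c' = {b}" by (auto simp: card_1_singleton_iff)
  have pair: "\<exists>d. S = {b, d} \<and> b \<noteq> d" if S: "card S = 2" "b \<in> S" for S
  proof -
    obtain x y where "S = {x, y}" "x \<noteq> y" using S(1) by (auto simp: card_2_iff)
    then show ?thesis using S(2) by (cases "b = x") auto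
  qed
  obtain d where d: "nb a \<inter> nb c = {b, d}" "b \<noteq> d" using pair[OF c2(1)] b by auto
  obtain d' where d': "nb a \<inter> nb c' = {b, d'}" "b \<noteq> d'" using pair[OF c2(2)] b by auto
  have dd': "d \<noteq> d'" using b d d' by auto
  have E: "b \<in> nb a" "d \<in> nb a" "d' \<in> nb a" "b \<in> nb c" "d \<in> nb c" "b \<in> nb c'" "d' \<in> nb c'"
    using d d' by auto
  have neqs: "a \<noteq> b" "a \<noteq> d" "a \<noteq> d'" "c \<noteq> b" "c \<noteq> d" "c' \<noteq> b" "c' \<noteq> d'"
    using E nb_irrefl by metis+
  note ds = neqs aneq neq dd' d(2) d'(2)
  show False
  \<comment> \<open>The vertices may coincide in two ways, \<open>c = d'\<close> and
    \<open>c' = d\<close>; each combination needs its own list.\<close>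
  proof (cases "c = d'")
    case cd: True
    show False
    proof (cases "c' = d")
      case True
      show False
        using length_edges_le[of "[(a, b), (a, d), (a, c), (c, b), (c, d), (d, b)]" "[a, b, c, d]"] E ds cd True by simp
    next
      case False
      show False
        using length_edges_le[of "[(a, b), (a, d), (a, c), (c, b), (c, d), (c', b), (c', c)]" "[a, b, c, d, c']"]
          E ds cd False by simp
    qed
  next
    case cd: False
    show False
    proof (cases "c' = d")
      case True
      show False
        using length_edges_le[of "[(a, b), (a, d), (a, d'), (c, b), (c, d), (d, b), (d, d')]" "[a, b, c, d, d']"]
          E ds cd True by simp
    next
      case False
      show False
        using length_edges_le[of "[(a, b), (a, d), (a, d'), (c, b), (c, d), (c', b), (c', d')]" "[a, b, c, d, c', d']"]
          E ds cd False by simp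
    qed
  qed
qed

text \<open>Every bad pair has an end of degree 3, and by uniqueness a vertex occurs at most once as
  first and once as second member. Since there are twice as many bad pairs as vertices of degree 3,
  all these estimates are sharp.\<close>

lemma bad_counting:
  shows "\<And>a c. bad a c \<Longrightarrow> \<not> (deg a = 3 \<and> deg c = 3)"
    and "\<And>a. a \<in> D3 \<Longrightarrow> \<exists>c. bad a c"
proof -
  define Bd where "Bd = {(a, c). bad a c}"
  define B1 where "B1 = {x \<in> Bd. fst x \<in> D3}"
  define B2 where "B2 = {x \<in> Bd. snd x \<in> D3}"
  have finBd: "finite Bd"
    by (rule finite_subset[of _ "{..<2 * n} \<times> {..<2 * n}"]) (auto simp: Bd_def bad_less)
  have fin: "finite B1" "finite B2" "finite D3" using finBd by (auto simp: B1_def B2_def D3_def)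
  have "inj_on fst B1"
    unfolding inj_on_def B1_def Bd_def using bad_unique by auto
  moreover have "inj_on snd B2"
    unfolding inj_on_def B2_def Bd_def using bad_unique[OF bad_sym[THEN iffD1] bad_sym[THEN iffD1]] by auto
  ultimately have inj: "inj_on fst B1" "inj_on snd B2" .
  have sub: "fst ` B1 \<subseteq> D3" "snd ` B2 \<subseteq> D3" by (auto simp: B1_def B2_def)
  have le: "card B1 \<le> card D3" "card B2 \<le> card D3"
    using card_inj_on_le[OF inj(1) sub(1)] card_inj_on_le[OF inj(2) sub(2)] fin by auto
  have "Bd = B1 \<union> B2"
    by (auto simp: Bd_def B1_def B2_def D3_def dest: bad_has_deg_3 bad_less)
  then have "2 * card D3 + card (B1 \<inter> B2) = card B1 + card B2"
    using card_Un_Int[of B1 B2] fin card_bad by (simp add: Bd_def)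
  then have *: "card (B1 \<inter> B2) = 0" "card B1 = card D3" using le by linarith+
  have disj: "B1 \<inter> B2 = {}" using *(1) fin by simp
  show "\<not> (deg a = 3 \<and> deg c = 3)" if "bad a c" for a c
  proof
    assume "deg a = 3 \<and> deg c = 3"
    then have "(a, c) \<in> B1 \<inter> B2" using that bad_less[OF that] by (auto simp: B1_def B2_def Bd_def D3_def)
    then show False using disj by blast
  qed
  have "fst ` B1 = D3"
    using sub(1) *(2) inj(1) fin by (intro card_subset_eq) (auto simp: card_image)
  then show "\<exists>c. bad a c" if "a \<in> D3" for a
    using that by (force simp: B1_def Bd_def)
qed

definition quad :: "nat \<Rightarrow> nat \<Rightarrow> nat \<Rightarrow> nat \<Rightarrow> nat \<Rightarrow> nat \<Rightarrow> bool" where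
  "quad a b c d a1 b1 \<longleftrightarrow> nb a = {b, d, a1} \<and> nb b = {a, c, b1} \<and> nb c = {b, d} \<and> nb d = {a, c} \<and>
     distinct [a, b, c, d, a1, b1] \<and> h a b * h b c + h a d * h d c = 0"

text \<open>Negativity can be read off from either pair of opposite corners.\<close>

lemma neg_quad_flip:
  assumes "h a b * h b c + h a d * h d c = 0" "b \<in> nb a" "d \<in> nb a" "b \<in> nb c" "d \<in> nb c"
  shows "h b a * h a d + h b c * h c d = 0"
proof -
  have 1: "h b a * h a b = 1" "h d c * h c d = 1"
    using assms nb_sym h_mult_herm[of b a] h_mult_herm[of d c] by simp_all
  have "h b a * (h a b * h b c + h a d * h d c) * h c d
      = (h b a * h a b) * h b c * h c d + h b a * h a d * (h d c * h c d)"
    by (simp add: algebra_simps)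
  then show ?thesis unfolding 1 assms(1) by (simp add: add.commute)
qed

lemma quad_swap: "quad a b c d a1 b1 \<Longrightarrow> quad b a d c b1 a1"
  unfolding quad_def using neg_quad_flip[of a b c d] by auto

lemma third_nb:
  assumes "deg a = 3" "b \<in> nb a" "d \<in> nb a" "b \<noteq> d"
  obtains a1 where "nb a = {b, d, a1}" "a1 \<noteq> b" "a1 \<noteq> d" "a1 \<noteq> a"
proof -
  have "card (nb a - {b, d}) = 1" using assms by (simp add: deg_def card_Diff_subset)
  then obtain a1 where a1: "nb a - {b, d} = {a1}" by (auto simp: card_1_singleton_iff)
  then have "nb a = {b, d, a1}" using assms by auto
  then show thesis using a1 that[of a1] nb_irrefl[of a] by auto
qed

text \<open>The opposite corner \<open>c\<close> of a bad pair containing \<open>a\<close> does not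
  have degree 3. The other two corners form a bad pair as well, so exactly one of them has degree 3,
  and it is adjacent to \<open>a\<close>.\<close>

lemma deg_3_quad:
  assumes "a \<in> D3"
  obtains b c d a1 b1 where "quad a b c d a1 b1"
proof -
  note found = that
  have degE: "nb v = {x, y}" if "v < 2 * n" "deg v \<noteq> 3" "x \<in> nb v" "y \<in> nb v" "x \<noteq> y" for v x y
  proof -
    have "card (nb v) \<le> card {x, y}" using deg_cases[OF that(1)] that(2,5) unfolding deg_def by auto
    then show ?thesis using that card_seteq[of "nb v" "{x, y}"] by auto
  qed
  obtain c where c: "bad a c" using bad_counting(2)[OF assms] by auto
  have da: "deg a = 3" using assms by (simp add: D3_def)
  have dc: "deg c \<noteq> 3" using bad_counting(1)[OF c] da by simp
  have "card (nb a \<inter> nb c) = 2" "a \<noteq> c" using c by (auto simp: bad_def)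
  have key: thesis if bd: "nb a \<inter> nb c = {b, d}" "b \<noteq> d" "deg b = 3" "deg d \<noteq> 3" for b d
  proof -
    have E: "b \<in> nb a" "d \<in> nb a" "b \<in> nb c" "d \<in> nb c" using bd by auto
    have E': "a \<in> nb b" "a \<in> nb d" "c \<in> nb b" "c \<in> nb d" using E nb_sym by auto
    have neg: "h a b * h b c + h a d * h d c = 0"
      using c bd unfolding bad_def h2_eq by simp
    have nc: "nb c = {b, d}" and nd: "nb d = {a, c}"
      using degE[of c b d] degE[of d a c] nb_less[OF E(4)] E E' bd dc \<open>a \<noteq> c\<close> by auto
    obtain a1 where a1: "nb a = {b, d, a1}" "a1 \<noteq> b" "a1 \<noteq> d" "a1 \<noteq> a"
      using third_nb[OF da E(1,2) bd(2)] .
    obtain b1 where b1: "nb b = {a, c, b1}" "b1 \<noteq> a" "b1 \<noteq> c" "b1 \<noteq> b"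
      using third_nb[OF bd(3) E'(1,3) \<open>a \<noteq> c\<close>] .
    have "a1 \<noteq> c" using a1(1) nc nb_sym[of c a] \<open>a \<noteq> c\<close> E nb_irrefl[of a] by auto
    moreover have "b1 \<noteq> d" using b1(1) nd nb_sym[of d b] bd(2) E nb_irrefl[of b] by auto
    moreover have ne: "a \<noteq> b" "a \<noteq> d" "c \<noteq> b" "c \<noteq> d" using E nb_irrefl by metis+
    moreover have "a1 \<noteq> b1"
    proof
      assume "a1 = b1"
      then have "a1 \<in> nb a" "a1 \<in> nb b" using a1 b1 by auto
      then show False
        using length_edges_le[of "[(a, b), (b, c), (c, d), (d, a), (a, a1), (b, a1)]" "[a, b, c, d, a1]"]
          E E' a1(2-) bd(2) ne \<open>a \<noteq> c\<close> \<open>a1 \<noteq> c\<close>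
        by auto
    qed
    ultimately have "distinct [a, b, c, d, a1, b1]"
      using a1(2-) b1(2-) \<open>a \<noteq> c\<close> bd(2) by simp
    then have "quad a b c d a1 b1" unfolding quad_def by (intro conjI a1(1) b1(1) nc nd neg)
    then show thesis by (rule found)
  qed
  obtain b d where bd: "nb a \<inter> nb c = {b, d}" "b \<noteq> d"
    using \<open>card (nb a \<inter> nb c) = 2\<close> by (auto simp: card_2_iff)
  have "bad b d"
  proof -
    have E: "b \<in> nb a" "d \<in> nb a" "b \<in> nb c" "d \<in> nb c" using bd by auto
    have sub: "{a, c} \<subseteq> nb b \<inter> nb d" using E nb_sym by auto
    have "card (nb b \<inter> nb d) \<le> 2" using common_nb(1)[of b d] nb_less E bd(2) by blast
    then have eq: "{a, c} = nb b \<inter> nb d" using sub \<open>a \<noteq> c\<close> by (intro card_seteq) auto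
    have "h a b * h b c + h a d * h d c = 0"
      using c bd unfolding bad_def h2_eq by simp
    then have "h b a * h a d + h b c * h c d = 0" using E by (rule neg_quad_flip)
    then show ?thesis unfolding bad_def h2_eq eq[symmetric] using \<open>a \<noteq> c\<close> bd(2) by simp
  qed
  then have "deg b = 3 \<and> deg d \<noteq> 3 \<or> deg d = 3 \<and> deg b \<noteq> 3"
    using bad_has_deg_3 bad_counting(1) by blast
  then show thesis using key[of b d] key[of d b] bd by (auto simp: insert_commute)
qed

end

subsection \<open>The arms of a negative quadrangle\<close>

context cospectral
begin

text \<open>A single common neighbour gives an entry of h^2 of modulus 1, whereas
  \<open>h2_bound\<close> for two vertices of degree 3 requires less than 1.\<close>

lemma deg_3_common_nb:
  assumes "x < 2 * n" "y < 2 * n" "x \<noteq> y" "deg x = 3" "deg y = 3"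
  shows "nb x \<inter> nb y \<noteq> {v}"
proof
  assume eq: "nb x \<inter> nb y = {v}"
  then have "v \<in> nb x" "y \<in> nb v" using nb_sym by blast+
  then have "cmod (h2 x y) = 1"
    unfolding h2_eq eq by (simp add: norm_mult cmod_h)
  then show False using h2_bound[OF assms(1-3)] assms(4,5) by simp
qed

lemma nb_eq_single: "u \<in> nb v \<Longrightarrow> deg v = 1 \<Longrightarrow> nb v = {u}"
  by (auto simp: deg_def card_1_singleton_iff)

lemma nb_eq_pair:
  assumes "u \<in> nb v" "deg v = 2"
  obtains t where "nb v = {u, t}" "t \<noteq> u" "t \<noteq> v"
proof -
  obtain x y where xy: "nb v = {x, y}" "x \<noteq> y" using assms(2) by (auto simp: deg_def card_2_iff)
  then have "x \<noteq> v" "y \<noteq> v" using nb_irrefl[of v] by auto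
  then show thesis using that[of x] that[of y] xy assms(1) by (cases "u = x") auto
qed

lemma sum_nb_le:
  assumes "u < 2 * n" "S \<subseteq> nb u" "\<And>v. v \<in> nb u \<Longrightarrow> v \<notin> S \<Longrightarrow> x v = 0"
  shows "(\<Sum>v<2 * n. h u v * x v) = (\<Sum>v\<in>S. h u v * x v)"
  unfolding sum_nb using assms by (intro sum.mono_neutral_right) auto

lemma h_cancel: "v \<in> nb u \<Longrightarrow> h u v * (h v u * z) = z"
  using h_mult_herm[of u v] by (simp flip: mult.assoc)

lemma quad_edges:
  assumes "quad a b c d a1 b1"
  shows "b \<in> nb a" "a \<in> nb b" "c \<in> nb b" "b \<in> nb c" "d \<in> nb c" "c \<in> nb d" "a \<in> nb d" "d \<in> nb a"
    "a1 \<in> nb a" "a \<in> nb a1" "b1 \<in> nb b" "b \<in> nb b1"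
  using assms nb_sym unfolding quad_def by blast+

lemma quad_less:
  assumes "quad a b c d a1 b1"
  shows "a < 2 * n" "b < 2 * n" "c < 2 * n" "d < 2 * n" "a1 < 2 * n" "b1 < 2 * n"
  using quad_edges[OF assms] nb_less by blast+

lemma quad_deg:
  assumes "quad a b c d a1 b1"
  shows "deg a = 3" "deg b = 3"
  using assms unfolding quad_def deg_def by auto

lemma quad_arms_nonadjacent:
  assumes q: "quad a b c d a1 b1"
  shows "b1 \<notin> nb a1"
proof
  assume "b1 \<in> nb a1"
  moreover have "distinct [a, b, c, d, a1, b1]" using q by (simp add: quad_def)
  ultimately show False
    using length_edges_le[of "[(a, b), (b, c), (c, d), (d, a), (a, a1), (b, b1), (a1, b1)]" "[a, b, c, d, a1, b1]"]
      quad_edges[OF q] by auto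
qed

text \<open>Otherwise \<open>a1\<close> and \<open>b\<close> would be two vertices of degree 3 whose
  only common neighbour is \<open>a\<close>.\<close>

lemma quad_arm_deg:
  assumes q: "quad a b c d a1 b1"
  shows "deg a1 \<le> 2"
proof (rule ccontr)
  assume "\<not> deg a1 \<le> 2"
  then have "deg a1 = 3" using deg_cases[of a1] quad_less[OF q] by auto
  have nbs: "nb b = {a, c, b1}" "nb c = {b, d}" and ds: "distinct [a, b, c, d, a1, b1]"
    using q by (auto simp: quad_def)
  have "c \<notin> nb a1" using nb_sym[of c a1] nbs(2) ds by auto
  then have "nb a1 \<inter> nb b = {a}" using nbs(1) quad_arms_nonadjacent[OF q] quad_edges[OF q] by auto
  then show False
    using deg_3_common_nb[of a1 b a] quad_less[OF q] quad_deg[OF q] \<open>deg a1 = 3\<close> ds by auto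
qed

lemma quad_neg:
  assumes q: "quad a b c d a1 b1"
  shows "h c d * h d a = - (h c b * h b a)" "h d c * (h c b * h b a) = - h d a"
proof -
  have "h a b * h b c + h a d * h d c = 0" using q by (simp add: quad_def)
  then have "cnj (h a b * h b c + h a d * h d c) = 0" by simp
  then have "h b a * h c b + h d a * h c d = 0"
    unfolding complex_cnj_add complex_cnj_mult herm[symmetric] .
  then show 1: "h c d * h d a = - (h c b * h b a)" by (simp add: add_eq_0_iff mult.commute)
  have "h d c * (h c b * h b a) = - (h d c * (h c d * h d a))" unfolding 1 by simp
  then show "h d c * (h c b * h b a) = - h d a" using h_cancel[of c d] quad_edges[OF q] by simp
qed

text \<open>The test vector is an eigenvector for the eigenvalue 2 of a quadrangle with two arms of length 2.\<close>

lemma quad_not_both_long: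
  assumes q: "quad a b c d a1 b1" and a1: "nb a1 = {a, a2}" and b1: "nb b1 = {b, b2}"
    and ne: "a2 \<noteq> a" "b2 \<noteq> b"
  shows False
proof -
  have nbs: "nb a = {b, d, a1}" "nb b = {a, c, b1}" "nb c = {b, d}" "nb d = {a, c}"
    and ds: "distinct [a, b, c, d, a1, b1]"
    using q by (auto simp: quad_def)
  note E = quad_edges[OF q]
  have e2: "a2 \<in> nb a1" "a1 \<in> nb a2" "b2 \<in> nb b1" "b1 \<in> nb b2" using a1 b1 nb_sym by auto
  have a2: "a2 \<notin> {b, c, d, a1, b1}"
    using e2(2) nbs b1 ds quad_arms_nonadjacent[OF q] nb_sym[of a1 b1] nb_irrefl[of a1] by auto
  have b2: "b2 \<notin> {a, c, d, a1, b1}"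
    using e2(4) nbs a1 ds quad_arms_nonadjacent[OF q] nb_irrefl[of b1] by auto
  have a2b2: "a2 \<noteq> b2"
  proof
    assume "a2 = b2"
    then show False
      using length_edges_le[of "[(a, b), (b, c), (c, d), (d, a), (a, a1), (b, b1), (a1, a2), (b1, a2)]"
          "[a, b, c, d, a1, b1, a2]"] E e2 ds a2 ne by auto
  qed
  have nonadj: "b2 \<notin> nb a2"
  proof
    assume "b2 \<in> nb a2"
    then show False
      using length_edges_le[of "[(a, b), (b, c), (c, d), (d, a), (a, a1), (b, b1), (a1, a2), (b1, b2), (a2, b2)]"
          "[a, b, c, d, a1, b1, a2, b2]"] E e2 ds a2 b2 a2b2 ne by auto
  qed
  \<comment> \<open>The moduli are 3, 3, 1, 1 on the quadrangle and 2, 1 on each arm, with the edge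
    weights transported from \<open>a\<close> as phases. Outside the support the bound is trivial,
    so \<open>a2\<close> and \<open>b2\<close> may have further neighbours.\<close>
  define x where "x = (\<lambda>_. 0 :: complex)(a := 3, b := 3 * h b a, c := h c b * h b a, d := h d a,
    a1 := 2 * h a1 a, a2 := h a2 a1 * h a1 a, b1 := 2 * (h b1 b * h b a), b2 := h b2 b1 * (h b1 b * h b a))"
  have xv: "x a = 3" "x b = 3 * h b a" "x c = h c b * h b a" "x d = h d a" "x a1 = 2 * h a1 a"
    "x a2 = h a2 a1 * h a1 a" "x b1 = 2 * (h b1 b * h b a)" "x b2 = h b2 b1 * (h b1 b * h b a)"
    using ds a2 b2 a2b2 ne by (auto simp: x_def)
  have x0: "x v = 0" if "v \<notin> {a, b, c, d, a1, b1, a2, b2}" for v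
    using that by (simp add: x_def)
  note lt = quad_less[OF q] nb_less[OF e2(1)] nb_less[OF e2(3)]
  have hx: "(\<Sum>v<2 * n. h u v * x v) = (\<Sum>v\<in>nb u. h u v * x v)" for u by (rule sum_nb)
  have "x a = 0"
  proof (rule no_expansion)
    fix u assume u: "u < 2 * n"
    consider "u = a" | "u = b" | "u = c" | "u = d" | "u = a1" | "u = b1" | "u = a2" | "u = b2"
      | "u \<notin> {a, b, c, d, a1, b1, a2, b2}" by blast
    then show "2 * cmod (x u) \<le> cmod (\<Sum>v<2 * n. h u v * x v)"
    proof cases
      case 1
      have "(\<Sum>v<2 * n. h u v * x v) = 3 * (h a b * (h b a * 1)) + h a d * (h d a * 1) + 2 * (h a a1 * (h a1 a * 1))"
        unfolding hx 1 nbs using ds by (simp add: xv)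
      then show ?thesis by (simp only: h_cancel E 1 xv) simp
    next
      case 2
      have "(\<Sum>v<2 * n. h u v * x v) = 3 * h b a + h b c * (h c b * h b a) + 2 * (h b b1 * (h b1 b * h b a))"
        unfolding hx 2 nbs using ds by (simp add: xv)
      then have "(\<Sum>v<2 * n. h u v * x v) = 6 * h b a" by (simp only: h_cancel E) simp
      then show ?thesis by (simp add: 2 xv norm_mult)
    next
      case 3
      have "(\<Sum>v<2 * n. h u v * x v) = 3 * (h c b * h b a) + h c d * h d a"
        unfolding hx 3 nbs using ds by (simp add: xv)
      then have "(\<Sum>v<2 * n. h u v * x v) = 2 * (h c b * h b a)" unfolding quad_neg(1)[OF q] by simp
      then show ?thesis by (simp add: 3 xv norm_mult)
    next
      case 4
      have "(\<Sum>v<2 * n. h u v * x v) = 3 * h d a + h d c * (h c b * h b a)"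
        unfolding hx 4 nbs using ds by (simp add: xv)
      then have "(\<Sum>v<2 * n. h u v * x v) = 2 * h d a" unfolding quad_neg(2)[OF q] by simp
      then show ?thesis by (simp add: 4 xv norm_mult)
    next
      case 5
      have "(\<Sum>v<2 * n. h u v * x v) = 3 * h a1 a + h a1 a2 * (h a2 a1 * h a1 a)"
        unfolding hx 5 a1 using ds ne by (simp add: xv)
      then have "(\<Sum>v<2 * n. h u v * x v) = 4 * h a1 a" by (simp only: h_cancel e2) simp
      then show ?thesis by (simp add: 5 xv norm_mult)
    next
      case 6
      have "(\<Sum>v<2 * n. h u v * x v) = 3 * (h b1 b * h b a) + h b1 b2 * (h b2 b1 * (h b1 b * h b a))"
        unfolding hx 6 b1 using ds ne by (simp add: xv)
      then have "(\<Sum>v<2 * n. h u v * x v) = 4 * (h b1 b * h b a)" by (simp only: h_cancel e2) simp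
      then show ?thesis by (simp add: 6 xv norm_mult)
    next
      case 7
      have disj: "nb a2 \<inter> {a, b, c, d, b1, a2, b2} = {}"
        using nonadj nb_sym[of _ a2] nbs b1 a2 a2b2 ne(1) nb_irrefl[of a2] by auto
      have zero: "x t = 0" if "t \<in> nb a2" "t \<notin> {a1}" for t
        using that disj by (intro x0) blast
      have "(\<Sum>v<2 * n. h u v * x v) = (\<Sum>v\<in>{a1}. h a2 v * x v)"
        unfolding 7 using lt e2 by (intro sum_nb_le zero) auto
      then show ?thesis using e2 by (simp add: 7 xv norm_mult cmod_h)
    next
      case 8
      have disj: "nb b2 \<inter> {a, b, c, d, a1, a2, b2} = {}"
        using nonadj nb_sym[of _ b2] nbs a1 b2 a2b2 ne(2) nb_irrefl[of b2] by auto
      have zero: "x t = 0" if "t \<in> nb b2" "t \<notin> {b1}" for t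
        using that disj by (intro x0) blast
      have "(\<Sum>v<2 * n. h u v * x v) = (\<Sum>v\<in>{b1}. h b2 v * x v)"
        unfolding 8 using lt e2 by (intro sum_nb_le zero) auto
      then show ?thesis using e2 by (simp add: 8 xv norm_mult cmod_h)
    next
      case 9
      then show ?thesis using x0 by simp
    qed
  qed (use lt in simp)
  then show False by (simp add: xv)
qed

text \<open>Likewise for arms of length 1 and 4.\<close>

lemma quad_arm_short:
  assumes q: "quad a b c d a1 b1" and a1: "nb a1 = {a}" and b1: "nb b1 = {b, b2}" "b2 \<noteq> b"
    and b2: "nb b2 = {b1, b3}" "b3 \<noteq> b1" and b4: "b4 \<in> nb b3" "b4 \<noteq> b2"
  shows False
proof -
  have nbs: "nb a = {b, d, a1}" "nb b = {a, c, b1}" "nb c = {b, d}" "nb d = {a, c}"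
    and ds: "distinct [a, b, c, d, a1, b1]"
    using q by (auto simp: quad_def)
  note E = quad_edges[OF q]
  have e2: "b2 \<in> nb b1" "b1 \<in> nb b2" "b3 \<in> nb b2" "b2 \<in> nb b3" "b3 \<in> nb b4" using b1 b2 b4 nb_sym by auto
  have b2n: "b2 \<notin> {a, c, d, a1, b1}"
    using e2(2) nbs a1 ds nb_irrefl[of b1] by auto
  have b3n: "b3 \<notin> {a, b, c, d, a1, b2}"
    using e2(4) nbs a1 b1 ds b2n nb_irrefl[of b2] by auto
  have "\<forall>v\<in>{a, b, c, d, a1, b1, b3}. b3 \<notin> nb v"
    using ds b2n b3n b2(2) by (auto simp: nbs a1 b1(1))
  then have b4n: "b4 \<notin> {a, b, c, d, a1, b1, b3}" using e2(5) by blast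
  \<comment> \<open>For the eigenvalue 2 the moduli are linear along an arm: here they fall from 5
    at \<open>b\<close> to 1 at \<open>b4\<close>. Further neighbours of \<open>b3\<close> and
    \<open>b4\<close> lie outside the support.\<close>
  define x where "x = (\<lambda>_. 0 :: complex)(a := 4, b := 5 * h b a, c := 2 * (h c b * h b a), d := h d a,
    a1 := 2 * h a1 a, b1 := 4 * (h b1 b * h b a), b2 := 3 * (h b2 b1 * (h b1 b * h b a)),
    b3 := 2 * (h b3 b2 * (h b2 b1 * (h b1 b * h b a))), b4 := h b4 b3 * (h b3 b2 * (h b2 b1 * (h b1 b * h b a))))"
  have xv: "x a = 4" "x b = 5 * h b a" "x c = 2 * (h c b * h b a)" "x d = h d a" "x a1 = 2 * h a1 a"
    "x b1 = 4 * (h b1 b * h b a)" "x b2 = 3 * (h b2 b1 * (h b1 b * h b a))"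
    "x b3 = 2 * (h b3 b2 * (h b2 b1 * (h b1 b * h b a)))"
    "x b4 = h b4 b3 * (h b3 b2 * (h b2 b1 * (h b1 b * h b a)))"
    using ds b1(2) b2(2) b4(2) b2n b3n b4n by (auto simp: x_def)
  have x0: "x v = 0" if "v \<notin> {a, b, c, d, a1, b1, b2, b3, b4}" for v
    using that by (simp add: x_def)
  note lt = quad_less[OF q] nb_less[OF e2(1)] nb_less[OF e2(3)] nb_less[OF e2(5)]
  have hx: "(\<Sum>v<2 * n. h u v * x v) = (\<Sum>v\<in>nb u. h u v * x v)" for u by (rule sum_nb)
  have "x a = 0"
  proof (rule no_expansion)
    fix u assume u: "u < 2 * n"
    consider "u = a" | "u = b" | "u = c" | "u = d" | "u = a1" | "u = b1" | "u = b2" | "u = b3" | "u = b4"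
      | "u \<notin> {a, b, c, d, a1, b1, b2, b3, b4}" by blast
    then show "2 * cmod (x u) \<le> cmod (\<Sum>v<2 * n. h u v * x v)"
    proof cases
      case 1
      have "(\<Sum>v<2 * n. h u v * x v) = 5 * (h a b * (h b a * 1)) + h a d * (h d a * 1) + 2 * (h a a1 * (h a1 a * 1))"
        unfolding hx 1 nbs using ds by (simp add: xv)
      then show ?thesis by (simp only: h_cancel E 1 xv) simp
    next
      case 2
      have "(\<Sum>v<2 * n. h u v * x v) = 4 * h b a + 2 * (h b c * (h c b * h b a)) + 4 * (h b b1 * (h b1 b * h b a))"
        unfolding hx 2 nbs using ds by (simp add: xv)
      then have "(\<Sum>v<2 * n. h u v * x v) = 10 * h b a" by (simp only: h_cancel E) simp
      then show ?thesis by (simp add: 2 xv norm_mult)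
    next
      case 3
      have "(\<Sum>v<2 * n. h u v * x v) = 5 * (h c b * h b a) + h c d * h d a"
        unfolding hx 3 nbs using ds by (simp add: xv)
      then have "(\<Sum>v<2 * n. h u v * x v) = 4 * (h c b * h b a)" unfolding quad_neg(1)[OF q] by simp
      then show ?thesis by (simp add: 3 xv norm_mult)
    next
      case 4
      have "(\<Sum>v<2 * n. h u v * x v) = 4 * h d a + 2 * (h d c * (h c b * h b a))"
        unfolding hx 4 nbs using ds by (simp add: xv)
      then have "(\<Sum>v<2 * n. h u v * x v) = 2 * h d a" unfolding quad_neg(2)[OF q] by simp
      then show ?thesis by (simp add: 4 xv norm_mult)
    next
      case 5
      have "(\<Sum>v<2 * n. h u v * x v) = 4 * h a1 a" unfolding hx 5 a1 by (simp add: xv)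
      then show ?thesis by (simp add: 5 xv norm_mult)
    next
      case 6
      have "(\<Sum>v<2 * n. h u v * x v) = 5 * (h b1 b * h b a) + 3 * (h b1 b2 * (h b2 b1 * (h b1 b * h b a)))"
        unfolding hx 6 b1 using b1(2) by (simp add: xv)
      then have "(\<Sum>v<2 * n. h u v * x v) = 8 * (h b1 b * h b a)" by (simp only: h_cancel e2) simp
      then show ?thesis by (simp add: 6 xv norm_mult)
    next
      case 7
      have "(\<Sum>v<2 * n. h u v * x v) = 4 * (h b2 b1 * (h b1 b * h b a)) + 2 * (h b2 b3 * (h b3 b2 * (h b2 b1 * (h b1 b * h b a))))"
        unfolding hx 7 b2 using b2(2) by (simp add: xv)
      then have "(\<Sum>v<2 * n. h u v * x v) = 6 * (h b2 b1 * (h b1 b * h b a))" by (simp only: h_cancel e2) simp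
      then show ?thesis by (simp add: 7 xv norm_mult)
    next
      case 8
      have disj: "nb b3 \<inter> {a, b, c, d, a1, b1, b3} = {}"
        using nb_sym[of _ b3] nbs a1 b1 b2n b3n b2(2) nb_irrefl[of b3] by auto
      have zero: "x t = 0" if "t \<in> nb b3" "t \<notin> {b2, b4}" for t
        using that disj by (intro x0) blast
      have "(\<Sum>v<2 * n. h u v * x v) = (\<Sum>v\<in>{b2, b4}. h b3 v * x v)"
        unfolding 8 using lt e2 b4 by (intro sum_nb_le zero) auto
      also have "\<dots> = 3 * (h b3 b2 * (h b2 b1 * (h b1 b * h b a)))
          + h b3 b4 * (h b4 b3 * (h b3 b2 * (h b2 b1 * (h b1 b * h b a))))"
        using b4(2) by (simp add: xv)
      also have "\<dots> = 4 * (h b3 b2 * (h b2 b1 * (h b1 b * h b a)))" by (simp only: h_cancel b4) simp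
      finally show ?thesis by (simp add: 8 xv norm_mult)
    next
      case 9
      have disj: "nb b4 \<inter> {a, b, c, d, a1, b1, b2, b4} = {}"
        using nb_sym[of _ b4] nbs a1 b1 b2 b4n b4(2) b1(2) nb_irrefl[of b4] by auto
      have zero: "x t = 0" if "t \<in> nb b4" "t \<notin> {b3}" for t
        using that disj by (intro x0) blast
      have "(\<Sum>v<2 * n. h u v * x v) = (\<Sum>v\<in>{b3}. h b4 v * x v)"
        unfolding 9 using lt e2 b4 by (intro sum_nb_le zero) auto
      then show ?thesis using e2 b4 by (simp add: 9 xv norm_mult cmod_h)
    next
      case 10
      then show ?thesis using x0 by simp
    qed
  qed (use lt in simp)
  then show False by (simp add: xv)
qed

definition short_arm :: "nat \<Rightarrow> nat \<Rightarrow> bool" where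
  "short_arm b b1 \<longleftrightarrow> nb b1 = {b} \<or>
     (\<exists>b2. b2 \<noteq> b \<and> nb b1 = {b, b2} \<and> nb b2 = {b1}) \<or>
     (\<exists>b2 b3. b2 \<noteq> b \<and> b3 \<noteq> b1 \<and> nb b1 = {b, b2} \<and> nb b2 = {b1, b3} \<and> nb b3 = {b2})"

text \<open>The arm cannot branch at \<open>b2\<close>, since \<open>b\<close> and \<open>b2\<close>
  would then have degree 3 and \<open>b1\<close> as only common neighbour; beyond \<open>b3\<close>
  it is cut off by the test vector of \<open>quad_arm_short\<close>.\<close>

lemma quad_short_arm:
  assumes q: "quad a b c d a1 b1" and a1: "nb a1 = {a}"
  shows "short_arm b b1"
proof -
  note E = quad_edges[OF q] and lt = quad_less[OF q]
  have nbs: "nb a = {b, d, a1}" "nb b = {a, c, b1}" "nb c = {b, d}" "nb d = {a, c}"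
    and ds: "distinct [a, b, c, d, a1, b1]"
    using q by (auto simp: quad_def)
  have "deg b1 \<le> 2" using quad_arm_deg[OF quad_swap[OF q]] .
  then consider "deg b1 = 1" | "deg b1 = 2" using deg_cases[OF lt(6)] by linarith
  then show ?thesis
  proof cases
    case 1
    then show ?thesis using nb_eq_single[OF E(12)] by (simp add: short_arm_def)
  next
    case 2
    then obtain b2 where b1: "nb b1 = {b, b2}" "b2 \<noteq> b" "b2 \<noteq> b1" using nb_eq_pair[OF E(12)] by blast
    have e2: "b2 \<in> nb b1" "b1 \<in> nb b2" using b1 nb_sym by auto
    have lt2: "b2 < 2 * n" using nb_less[OF e2(1)] by simp
    have "deg b2 \<noteq> 3"
    proof
      assume d3: "deg b2 = 3"
      have "\<forall>v\<in>{d, a1}. b1 \<notin> nb v" using ds by (auto simp: nbs a1)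
      then have "b2 \<noteq> d" "b2 \<noteq> a1" using e2(2) by blast+
      then have "b2 \<notin> nb a" "b2 \<notin> nb c" using b1(2) by (simp_all add: nbs)
      then have "a \<notin> nb b2" "c \<notin> nb b2" using nb_sym by blast+
      then have "nb b \<inter> nb b2 = {b1}" using nbs(2) e2 by auto
      then show False using deg_3_common_nb[of b b2 b1] lt lt2 b1(2) d3 quad_deg[OF q] by simp
    qed
    then consider "deg b2 = 1" | "deg b2 = 2" using deg_cases[OF lt2] by linarith
    then show ?thesis
    proof cases
      case 1
      then show ?thesis using nb_eq_single[OF e2(2)] b1 by (auto simp: short_arm_def)
    next
      case 2
      then obtain b3 where b2: "nb b2 = {b1, b3}" "b3 \<noteq> b1" "b3 \<noteq> b2" using nb_eq_pair[OF e2(2)] by blast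
      have "b2 \<in> nb b3" using b2 nb_sym[of b2 b3] by simp
      moreover have "b4 = b2" if "b4 \<in> nb b3" for b4
        using quad_arm_short[OF q a1 b1(1,2) b2(1,2) that] by blast
      ultimately have "nb b3 = {b2}" by blast
      then show ?thesis using b1 b2 unfolding short_arm_def by blast
    qed
  qed
qed

lemma D3_short_arms:
  assumes "v \<in> D3"
  obtains a b c d a1 b1 where "quad a b c d a1 b1" "nb a1 = {a}" "short_arm b b1" "v = a \<or> v = b"
proof -
  obtain b c d a1 b1 where q: "quad v b c d a1 b1" using deg_3_quad[OF assms] .
  note q' = quad_swap[OF q]
  note E = quad_edges[OF q] and lt = quad_less[OF q]
  have "deg a1 \<noteq> 2 \<or> deg b1 \<noteq> 2"
  proof (rule ccontr)
    assume "\<not> (deg a1 \<noteq> 2 \<or> deg b1 \<noteq> 2)"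
    then obtain a2 b2 where "nb a1 = {v, a2}" "a2 \<noteq> v" "nb b1 = {b, b2}" "b2 \<noteq> b"
      using nb_eq_pair[OF E(10)] nb_eq_pair[OF E(12)] by metis
    then show False using quad_not_both_long[OF q] by blast
  qed
  then have "deg a1 = 1 \<or> deg b1 = 1"
    using quad_arm_deg[OF q] quad_arm_deg[OF q'] deg_cases[OF lt(5)] deg_cases[OF lt(6)] by linarith
  then show thesis
  proof
    assume "deg a1 = 1"
    then have "nb a1 = {v}" using nb_eq_single[OF E(10)] by simp
    then show thesis using that[OF q _ quad_short_arm[OF q]] by simp
  next
    assume "deg b1 = 1"
    then have "nb b1 = {b}" using nb_eq_single[OF E(12)] by simp
    then show thesis using that[OF q' _ quad_short_arm[OF q']] by simp
  qed
qed

end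

text \<open>The last three polynomials are, up to a factor \<open>l\<close>, the characteristic
  polynomials of the quadrangles with arms of lengths 1 and 1, 1 and 2, 1 and 3. With l = 2 cos t
  their vanishing means 2 cos 6t = -1, cos 7t = 0 and 2 cos 8t = 1. At t = pi / 4n the first two
  lead to 9 = 4n and to 4 dividing 14, the third to n = 6.\<close>

lemma lam0_polys:
  assumes "n \<ge> 2" "n \<noteq> 6" and l: "l = lam n 0"
  shows "l \<noteq> 0" "l\<^sup>2 \<noteq> 1"
    "(l\<^sup>2) ^ 3 - 6 * (l\<^sup>2) ^ 2 + 9 * l\<^sup>2 - 1 \<noteq> 0"
    "(l\<^sup>2) ^ 3 - 7 * (l\<^sup>2) ^ 2 + 14 * l\<^sup>2 - 7 \<noteq> 0"
    "(l\<^sup>2) ^ 4 - 8 * (l\<^sup>2) ^ 3 + 20 * (l\<^sup>2) ^ 2 - 16 * l\<^sup>2 + 1 \<noteq> 0"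
proof -
  define t where "t = pi / (4 * real n)"
  have lt: "l = 2 * cos t" by (simp add: l lam_def t_def)
  have t: "0 < t" "t \<le> pi / 8" using assms(1) by (auto simp: t_def field_simps)
  define z where "z = 2 * cos (2 * t)"
  have y: "l\<^sup>2 = z + 2" unfolding lt z_def cos_double_cos by (simp add: power2_eq_square)
  have "z > 0" unfolding z_def using t by (auto intro!: cos_gt_zero)
  then show "l \<noteq> 0" "l\<^sup>2 \<noteq> 1" using y by auto
  have cos_eq: "a = b" if "cos a = cos b" "0 \<le> a" "a \<le> pi" "0 \<le> b" "b \<le> pi" for a b :: real
    using that cos_inj_pi by blast
  have c3: "2 * cos (6 * t) = z ^ 3 - 3 * z"
    using cos_treble_cos[of "2 * t"] by (simp add: z_def power3_eq_cube)
  have c2: "2 * cos (4 * t) = z\<^sup>2 - 2"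
    using cos_double_cos[of "2 * t"] by (simp add: z_def power2_eq_square)
  have c4: "2 * cos (8 * t) = (z\<^sup>2 - 2)\<^sup>2 - 2"
    unfolding c2[symmetric] using cos_double_cos[of "4 * t"] by (simp add: power2_eq_square)
  show "(l\<^sup>2) ^ 3 - 6 * (l\<^sup>2) ^ 2 + 9 * l\<^sup>2 - 1 \<noteq> 0"
  proof
    assume "(l\<^sup>2) ^ 3 - 6 * (l\<^sup>2) ^ 2 + 9 * l\<^sup>2 - 1 = 0"
    then have "z ^ 3 - 3 * z + 1 = 0" unfolding y by (simp add: eval_nat_numeral algebra_simps)
    then have "cos (6 * t) = cos (2 * pi / 3)" using c3 unfolding cos_120 by linarith
    then have "6 * t = 2 * pi / 3"
      by (rule cos_eq) (use t pi_gt_zero in linarith)+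
    then have "9 * pi = 4 * real n * pi" using assms(1) by (simp add: t_def field_simps)
    then have "real 9 = real (4 * n)" by simp
    then have "9 = 4 * n" unfolding of_nat_eq_iff .
    then show False by presburger
  qed
  show "(l\<^sup>2) ^ 3 - 7 * (l\<^sup>2) ^ 2 + 14 * l\<^sup>2 - 7 \<noteq> 0"
  proof
    assume "(l\<^sup>2) ^ 3 - 7 * (l\<^sup>2) ^ 2 + 14 * l\<^sup>2 - 7 = 0"
    then have p1: "l * ((l\<^sup>2) ^ 3 - 7 * (l\<^sup>2) ^ 2 + 14 * l\<^sup>2 - 7) = 0" by simp
    have "complex_of_real (2 * cos (real 7 * t)) = complex_of_real (l * ((l\<^sup>2) ^ 3 - 7 * (l\<^sup>2) ^ 2 + 14 * l\<^sup>2 - 7))"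
      unfolding poly_dickson[symmetric] lt[symmetric]
      by (simp add: eval_nat_numeral algebra_simps)
    then have "cos (7 * t) = 0" unfolding p1 of_real_eq_iff by simp
    then obtain i :: int where i: "odd i" "7 * t = of_int i * (pi / 2)" unfolding cos_zero_iff_int by blast
    then have "14 * pi = of_int (i * (4 * int n)) * pi" using assms(1) by (simp add: t_def field_simps)
    then have "of_int 14 = (of_int (i * (4 * int n)) :: real)" by simp
    then have "14 = i * (4 * int n)" unfolding of_int_eq_iff .
    then have "4 dvd (14 :: int)" by (metis dvd_mult dvd_triv_left)
    then show False by simp
  qed
  show "(l\<^sup>2) ^ 4 - 8 * (l\<^sup>2) ^ 3 + 20 * (l\<^sup>2) ^ 2 - 16 * l\<^sup>2 + 1 \<noteq> 0"
  proof
    assume "(l\<^sup>2) ^ 4 - 8 * (l\<^sup>2) ^ 3 + 20 * (l\<^sup>2) ^ 2 - 16 * l\<^sup>2 + 1 = 0"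
    then have "(z\<^sup>2 - 2)\<^sup>2 - 2 = 1" unfolding y by (simp add: eval_nat_numeral algebra_simps)
    then have "cos (8 * t) = cos (pi / 3)" using c4 unfolding cos_60 by linarith
    then have "8 * t = pi / 3"
      by (rule cos_eq) (use t pi_gt_zero in linarith)+
    then have "6 * pi = real n * pi" using assms(1) by (simp add: t_def field_simps)
    then have "real 6 = real n" by simp
    then show False using assms(2) unfolding of_nat_eq_iff by simp
  qed
qed

section \<open>Elimination in the eigenvector equations of a quadrangle\<close>

lemma two_eqs_zero:
  fixes P Q r s u v :: "'a :: idom"
  assumes "P * u = r * v" "Q * v = s * u" "P * Q - r * s \<noteq> 0"
  shows "u = 0 \<and> v = 0"
proof -
  have "(P * Q - r * s) * u = Q * (P * u) - r * (s * u)"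
    "(P * Q - r * s) * v = P * (Q * v) - s * (r * v)"
    by (simp_all add: algebra_simps)
  then have "(P * Q - r * s) * u = 0" "(P * Q - r * s) * v = 0"
    unfolding assms(2)[symmetric] assms(1)[symmetric]
    by (simp_all add: assms(1,2) mult.left_commute)
  then show ?thesis using assms(3) by simp
qed

text \<open>The equations are those of an eigenvector after removal of all phases; the negative edge
  shows in the two minus signs. Eliminating \<open>C\<close> and \<open>D\<close> introduces the
  factor \<open>y - 1\<close>. Two equations in \<open>A1\<close> and the last vertex of the other
  arm remain, with determinant \<open>y - 1\<close> times the polynomial belonging to that
  arm.\<close>

lemma quad_equations_zero:
  fixes l A B C D A1 B1 :: complex
  assumes e: "l * A = B - D + A1" "l * B = A + C + B1" "l * C = B + D" "l * D = C - A" "l * A1 = A"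
    and l: "l \<noteq> 0" "l\<^sup>2 \<noteq> 1"
    "(l\<^sup>2) ^ 3 - 6 * (l\<^sup>2) ^ 2 + 9 * l\<^sup>2 - 1 \<noteq> 0"
    "(l\<^sup>2) ^ 3 - 7 * (l\<^sup>2) ^ 2 + 14 * l\<^sup>2 - 7 \<noteq> 0"
    "(l\<^sup>2) ^ 4 - 8 * (l\<^sup>2) ^ 3 + 20 * (l\<^sup>2) ^ 2 - 16 * l\<^sup>2 + 1 \<noteq> 0"
    and arm: "l * B1 = B \<or> (\<exists>B2. l * B1 = B + B2 \<and> l * B2 = B1) \<or>
      (\<exists>B2 B3. l * B1 = B + B2 \<and> l * B2 = B1 + B3 \<and> l * B3 = B2)"
  shows "A = 0 \<and> B = 0 \<and> C = 0 \<and> D = 0 \<and> A1 = 0 \<and> B1 = 0"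
proof -
  define y where "y = l\<^sup>2"
  have ll: "l * l = y" by (simp add: y_def power2_eq_square)
  have y1: "y - 1 \<noteq> 0" using l(2) by (simp add: y_def)
  have "l * l * C = l * B + l * D" "l * l * D = l * C - l * A"
    using e(3,4) by (simp_all add: mult.assoc distrib_left right_diff_distrib)
  then have C: "(y - 1) * C = l * B - A" and D: "(y - 1) * D = B - l * A"
    unfolding ll e(3,4) by (simp_all add: algebra_simps)
  have "A1 = l * A - B + D" "B1 = l * B - A - C" using e(1,2) by simp_all
  then have "(y - 1) * A1 = (y - 1) * (l * A - B) + (y - 1) * D"
    "(y - 1) * B1 = (y - 1) * (l * B - A) - (y - 1) * C"
    by (simp_all only: distrib_left right_diff_distrib)
  then have i: "(y - 1) * A1 = (y - 2) * (l * A - B)" and ii: "(y - 1) * B1 = (y - 2) * (l * B - A)"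
    unfolding C D by (simp_all add: algebra_simps)
  have fin: ?thesis if "A1 = 0" "B = 0" "B1 = 0"
  proof -
    have "A = 0" using e(5) that by simp
    then have "C = 0" "D = 0" using C D y1 that by auto
    then show ?thesis using that \<open>A = 0\<close> by simp
  qed
  have "l * A = y * A1" unfolding e(5)[symmetric] ll[symmetric] by (rule mult.assoc[symmetric])
  then have "(y - 1) * A1 = (y - 2) * (y * A1 - B)" using i by simp
  then have "(y - 2) * B = (y - 2) * (y * A1) - (y - 1) * A1" by (simp add: right_diff_distrib)
  then have i': "(y\<^sup>2 - 3 * y + 1) * A1 = (y - 2) * B" by (simp add: power2_eq_square algebra_simps)
  from arm consider
    (1) "l * B1 = B" | (2) B2 where "l * B1 = B + B2" "l * B2 = B1"
    | (3) B2 B3 where "l * B1 = B + B2" "l * B2 = B1 + B3" "l * B3 = B2" by blast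
  then show ?thesis
  proof cases
    case 1
    have "l * B = y * B1" unfolding 1[symmetric] ll[symmetric] by (rule mult.assoc[symmetric])
    then have "(y - 1) * B1 = (y - 2) * (y * B1 - A)" using ii by simp
    then have "(y - 2) * A = (y - 2) * (y * B1) - (y - 1) * B1" by (simp add: right_diff_distrib)
    then have ii': "(y\<^sup>2 - 3 * y + 1) * B1 = ((y - 2) * l) * A1"
      unfolding e(5)[symmetric] by (simp add: power2_eq_square algebra_simps)
    have "(y\<^sup>2 - 3 * y + 1) * (y\<^sup>2 - 3 * y + 1) - ((y - 2) * l) * ((y - 2) * l)
        = (y - 1) * (y ^ 3 - 6 * y ^ 2 + 9 * y - 1)" unfolding y_def by (simp add: eval_nat_numeral algebra_simps)
    then have ne: "(y\<^sup>2 - 3 * y + 1) * (y\<^sup>2 - 3 * y + 1) - ((y - 2) * l) * ((y - 2) * l) \<noteq> 0"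
      using l(3) y1 unfolding y_def by simp
    have "(y\<^sup>2 - 3 * y + 1) * A1 = ((y - 2) * l) * B1" using i' unfolding 1[symmetric] by (simp add: mult.assoc)
    then have "A1 = 0 \<and> B1 = 0" using ii' ne by (rule two_eqs_zero)
    then show ?thesis using fin 1 by simp
  next
    case 2
    have B: "B = (y - 1) * B2" using 2 ll by (simp add: algebra_simps flip: 2(2))
    have "(y - 2) * (l * A1) = (y - 2) * (l * ((y - 1) * B2)) - (y - 1) * (l * B2)"
      using ii unfolding 2(2)[symmetric] e(5)[symmetric] B by (simp add: right_diff_distrib)
    then have "l * ((y - 1) * (y - 3) * B2) = l * ((y - 2) * A1)" by (simp add: algebra_simps)
    then have ii': "(y - 1) * (y - 3) * B2 = (y - 2) * A1" using l(1) by simp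
    have "(y\<^sup>2 - 3 * y + 1) * ((y - 1) * (y - 3)) - ((y - 2) * (y - 1)) * (y - 2)
        = (y - 1) * (y ^ 3 - 7 * y ^ 2 + 14 * y - 7)" by (simp add: eval_nat_numeral algebra_simps)
    then have ne: "(y\<^sup>2 - 3 * y + 1) * ((y - 1) * (y - 3)) - ((y - 2) * (y - 1)) * (y - 2) \<noteq> 0"
      using l(4) y1 unfolding y_def by simp
    have "(y\<^sup>2 - 3 * y + 1) * A1 = ((y - 2) * (y - 1)) * B2" using i' unfolding B by (simp add: mult.assoc)
    then have "A1 = 0 \<and> B2 = 0" using ii' ne by (rule two_eqs_zero)
    then show ?thesis using fin B 2 by simp
  next
    case 3
    have B1: "B1 = (y - 1) * B3" using 3 ll by (simp add: algebra_simps flip: 3(3))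
    have "B = l * ((y - 1) * B3) - l * B3" using 3 unfolding B1 by simp
    then have B: "B = l * (y - 2) * B3" by (simp add: algebra_simps)
    have eq: "(y - 1) * ((y - 1) * B3) = (y - 2) * ((l * l) * (y - 2) * B3 - l * A1)"
      using ii unfolding B1 B e(5)[symmetric] by (simp add: mult.assoc)
    have ii': "(y * (y - 2)\<^sup>2 - (y - 1)\<^sup>2) * B3 = ((y - 2) * l) * A1"
    proof -
      have "(y - 2) * (l * A1) = (y - 2) * (y * (y - 2) * B3) - (y - 1) * ((y - 1) * B3)"
        using eq unfolding ll by (simp add: right_diff_distrib)
      then show ?thesis by (simp add: power2_eq_square algebra_simps)
    qed
    have "(y\<^sup>2 - 3 * y + 1) * (y * (y - 2)\<^sup>2 - (y - 1)\<^sup>2) - ((y - 2) * (l * (y - 2))) * ((y - 2) * l)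
        = (y - 1) * (y ^ 4 - 8 * y ^ 3 + 20 * y ^ 2 - 16 * y + 1)" unfolding y_def by (simp add: eval_nat_numeral algebra_simps)
    then have ne: "(y\<^sup>2 - 3 * y + 1) * (y * (y - 2)\<^sup>2 - (y - 1)\<^sup>2) - ((y - 2) * (l * (y - 2))) * ((y - 2) * l) \<noteq> 0"
      using l(5) y1 unfolding y_def by simp
    have "(y\<^sup>2 - 3 * y + 1) * A1 = ((y - 2) * (l * (y - 2))) * B3" using i' unfolding B by (simp add: mult.assoc)
    then have "A1 = 0 \<and> B3 = 0" using ii' ne by (rule two_eqs_zero)
    then show ?thesis using fin B B1 by simp
  qed
qed

context cospectral
begin

text \<open>Multiplying each value by the weight of a path from \<open>a\<close> turns all edge
  weights into 1 except for a sign on one edge of the quadrangle. The vertices listed form a whole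
  component, so \<open>K\<close> is closed.\<close>

lemma quad_eigvec_zero:
  assumes n6: "n \<noteq> 6"
    and x: "\<And>u. u < 2 * n \<Longrightarrow> (\<Sum>v<2 * n. h u v * x v) = of_real (lam n 0) * x u"
    and q: "quad a b c d a1 b1" and a1: "nb a1 = {a}" and arm: "short_arm b b1"
  shows "\<exists>K. clsd K \<and> a \<in> K \<and> b \<in> K \<and> (\<forall>v\<in>K. x v = 0)"
proof -
  note E = quad_edges[OF q] and lt = quad_less[OF q]
  have nbs: "nb a = {b, d, a1}" "nb b = {a, c, b1}" "nb c = {b, d}" "nb d = {a, c}"
    and ds: "distinct [a, b, c, d, a1, b1]" and neg: "h a b * h b c + h a d * h d c = 0"
    using q by (auto simp: quad_def)
  define l where "l = complex_of_real (lam n 0)"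
  have xs: "(\<Sum>v\<in>nb u. h u v * x v) = l * x u" if "u < 2 * n" for u
    using x[OF that] unfolding sum_nb l_def .
  have xa: "h a b * x b + h a d * x d + h a a1 * x a1 = l * x a"
    using xs[OF lt(1)] ds by (simp add: nbs add.assoc)
  have xb: "h b a * x a + h b c * x c + h b b1 * x b1 = l * x b"
    using xs[OF lt(2)] ds by (simp add: nbs add.assoc)
  have xc: "h c b * x b + h c d * x d = l * x c"
    using xs[OF lt(3)] ds by (simp add: nbs add.assoc)
  have xd: "h d a * x a + h d c * x c = l * x d"
    using xs[OF lt(4)] ds by (simp add: nbs add.assoc)
  have xa1: "h a1 a * x a = l * x a1" using xs[OF lt(5)] by (simp add: a1)
  define B where "B = h a b * x b"
  define C where "C = h a b * (h b c * x c)"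
  define D where "D = - (h a d * x d)"
  define A1 where "A1 = h a a1 * x a1"
  define B1 where "B1 = h a b * (h b b1 * x b1)"
  have neg': "h a d * (h d c * z) = - (h a b * (h b c * z))" for z
  proof -
    have "h a d * h d c = - (h a b * h b c)" using neg by (simp add: eq_neg_iff_add_eq_0 add.commute)
    then show ?thesis by (simp flip: mult.assoc)
  qed
  have e1: "l * x a = B - D + A1" unfolding xa[symmetric] by (simp add: B_def D_def A1_def)
  have e2: "l * B = x a + C + B1"
  proof -
    have "l * B = h a b * (l * x b)" by (simp add: B_def)
    also have "\<dots> = h a b * (h b a * x a) + C + B1"
      unfolding xb[symmetric] by (simp add: C_def B1_def distrib_left)
    finally show ?thesis by (simp add: h_cancel E)
  qed
  have e3: "l * C = B + D"
  proof -
    have "l * C = h a b * (h b c * (l * x c))" by (simp add: C_def)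
    also have "\<dots> = h a b * (h b c * (h c b * x b)) + h a b * (h b c * (h c d * x d))"
      unfolding xc[symmetric] by (simp add: distrib_left)
    also have "h a b * (h b c * (h c d * x d)) = - (h a d * (h d c * (h c d * x d)))"
      by (simp add: neg')
    finally show ?thesis by (simp add: h_cancel E B_def D_def)
  qed
  have e4: "l * D = C - x a"
  proof -
    have "l * D = - (h a d * (l * x d))" by (simp add: D_def)
    also have "\<dots> = - (h a d * (h d a * x a)) - h a d * (h d c * x c)"
      unfolding xd[symmetric] by (simp add: distrib_left)
    finally show ?thesis by (simp add: h_cancel E neg' C_def)
  qed
  have e5: "l * A1 = x a"
  proof -
    have "l * A1 = h a a1 * (l * x a1)" by (simp add: A1_def)
    then show ?thesis unfolding xa1[symmetric] by (simp add: h_cancel E)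
  qed
  have l: "l \<noteq> 0" "l\<^sup>2 \<noteq> 1"
    "(l\<^sup>2) ^ 3 - 6 * (l\<^sup>2) ^ 2 + 9 * l\<^sup>2 - 1 \<noteq> 0"
    "(l\<^sup>2) ^ 3 - 7 * (l\<^sup>2) ^ 2 + 14 * l\<^sup>2 - 7 \<noteq> 0"
    "(l\<^sup>2) ^ 4 - 8 * (l\<^sup>2) ^ 3 + 20 * (l\<^sup>2) ^ 2 - 16 * l\<^sup>2 + 1 \<noteq> 0"
  proof -
    have c: "of_real r \<noteq> (0 :: complex)" if "r \<noteq> 0" for r using that by simp
    note p = lam0_polys[OF n n6 refl]
    have "lam n 0 ^ 2 - 1 \<noteq> 0" using p(2) by simp
    from this[THEN c] p(1)[THEN c] p(3)[THEN c] p(4)[THEN c] p(5)[THEN c]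
    show "l \<noteq> 0" "l\<^sup>2 \<noteq> 1"
      "(l\<^sup>2) ^ 3 - 6 * (l\<^sup>2) ^ 2 + 9 * l\<^sup>2 - 1 \<noteq> 0"
      "(l\<^sup>2) ^ 3 - 7 * (l\<^sup>2) ^ 2 + 14 * l\<^sup>2 - 7 \<noteq> 0"
      "(l\<^sup>2) ^ 4 - 8 * (l\<^sup>2) ^ 3 + 20 * (l\<^sup>2) ^ 2 - 16 * l\<^sup>2 + 1 \<noteq> 0"
      unfolding l_def of_real_add of_real_diff of_real_mult of_real_power of_real_numeral of_real_1 by simp_all
  qed
  have nz: "x v = 0" if "h u v * x v = 0" "v \<in> nb u" for u v using that by (auto simp: nb_def)
  have base: "\<forall>v\<in>{a, b, c, d, a1, b1}. x v = 0"
    if "x a = 0 \<and> B = 0 \<and> C = 0 \<and> D = 0 \<and> A1 = 0 \<and> B1 = 0"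
    using that nz[of a b] nz[of b c] nz[of a d] nz[of a a1] nz[of b b1] E
    unfolding B_def C_def D_def A1_def B1_def by (auto simp: nb_def)
  note zero = quad_equations_zero[OF e1 e2 e3 e4 e5 l]
  from arm consider (1) "nb b1 = {b}" | (2) b2 where "b2 \<noteq> b" "nb b1 = {b, b2}" "nb b2 = {b1}"
    | (3) b2 b3 where "b2 \<noteq> b" "b3 \<noteq> b1" "nb b1 = {b, b2}" "nb b2 = {b1, b3}" "nb b3 = {b2}"
    unfolding short_arm_def by blast
  then show ?thesis
  proof cases
    case 1
    have "l * x b1 = h b1 b * x b" using xs[OF lt(6)] by (simp add: 1)
    then have "l * B1 = h a b * (h b b1 * (h b1 b * x b))" by (simp add: B1_def)
    then have "l * B1 = B" by (simp add: h_cancel E B_def)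
    then have "\<forall>v\<in>{a, b, c, d, a1, b1}. x v = 0" by (intro base zero) simp
    moreover have "clsd {a, b, c, d, a1, b1}" unfolding clsd_def using lt by (simp add: nbs a1 1)
    ultimately show ?thesis by (intro exI[of _ "{a, b, c, d, a1, b1}"]) simp
  next
    case 2
    have b2: "b2 \<in> nb b1" "b1 \<in> nb b2" "b2 < 2 * n" using 2 nb_less[of b2 b1] by auto
    define B2 where "B2 = h a b * (h b b1 * (h b1 b2 * x b2))"
    have "l * x b1 = h b1 b * x b + h b1 b2 * x b2" using xs[OF lt(6)] 2 by simp
    then have "h a b * (h b b1 * (l * x b1)) = h a b * (h b b1 * (h b1 b * x b)) + B2"
      by (simp add: B2_def distrib_left)
    then have "l * B1 = h a b * (h b b1 * (h b1 b * x b)) + B2" by (simp add: B1_def mult.left_commute)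
    then have f1: "l * B1 = B + B2" by (simp add: h_cancel E B_def)
    have "l * x b2 = h b2 b1 * x b1" using xs[OF b2(3)] 2 by simp
    then have "l * B2 = h a b * (h b b1 * (h b1 b2 * (h b2 b1 * x b1)))" by (simp add: B2_def)
    then have f2: "l * B2 = B1" by (simp add: h_cancel b2 B1_def)
    have all: "x a = 0 \<and> B = 0 \<and> C = 0 \<and> D = 0 \<and> A1 = 0 \<and> B1 = 0"
      by (rule zero) (use f1 f2 in blast)
    then have "B2 = 0" using f1 by simp
    then have "x b2 = 0" using E b2 by (auto simp: B2_def nb_def)
    then have "\<forall>v\<in>{a, b, c, d, a1, b1, b2}. x v = 0" using base[OF all] by simp
    moreover have "clsd {a, b, c, d, a1, b1, b2}" unfolding clsd_def using lt b2 by (simp add: nbs a1 2)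
    ultimately show ?thesis by (intro exI[of _ "{a, b, c, d, a1, b1, b2}"]) simp
  next
    case 3
    have b2: "b2 \<in> nb b1" "b1 \<in> nb b2" "b3 \<in> nb b2" "b2 \<in> nb b3" "b2 < 2 * n" "b3 < 2 * n"
      using 3 nb_less[of b2 b1] nb_less[of b3 b2] by auto
    define B2 where "B2 = h a b * (h b b1 * (h b1 b2 * x b2))"
    define B3 where "B3 = h a b * (h b b1 * (h b1 b2 * (h b2 b3 * x b3)))"
    have "l * x b1 = h b1 b * x b + h b1 b2 * x b2" using xs[OF lt(6)] 3 by simp
    then have "h a b * (h b b1 * (l * x b1)) = h a b * (h b b1 * (h b1 b * x b)) + B2"
      by (simp add: B2_def distrib_left)
    then have "l * B1 = h a b * (h b b1 * (h b1 b * x b)) + B2" by (simp add: B1_def mult.left_commute)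
    then have f1: "l * B1 = B + B2" by (simp add: h_cancel E B_def)
    have "l * x b2 = h b2 b1 * x b1 + h b2 b3 * x b3" using xs[OF b2(5)] 3 by simp
    then have "h a b * (h b b1 * (h b1 b2 * (l * x b2))) = h a b * (h b b1 * (h b1 b2 * (h b2 b1 * x b1))) + B3"
      by (simp add: B3_def distrib_left)
    then have "l * B2 = h a b * (h b b1 * (h b1 b2 * (h b2 b1 * x b1))) + B3" by (simp add: B2_def mult.left_commute)
    then have f2: "l * B2 = B1 + B3" by (simp add: h_cancel b2 B1_def)
    have "l * x b3 = h b3 b2 * x b2" using xs[OF b2(6)] 3 by simp
    then have "l * B3 = h a b * (h b b1 * (h b1 b2 * (h b2 b3 * (h b3 b2 * x b2))))" by (simp add: B3_def)
    then have f3: "l * B3 = B2" by (simp add: h_cancel b2 B2_def)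
    have all: "x a = 0 \<and> B = 0 \<and> C = 0 \<and> D = 0 \<and> A1 = 0 \<and> B1 = 0"
      by (rule zero) (use f1 f2 f3 in blast)
    then have "B2 = 0" "B3 = 0" using f1 f2 by simp_all
    then have "x b2 = 0" "x b3 = 0" using E b2 by (auto simp: B2_def B3_def nb_def)
    then have "\<forall>v\<in>{a, b, c, d, a1, b1, b2, b3}. x v = 0" using base[OF all] by simp
    moreover have "clsd {a, b, c, d, a1, b1, b2, b3}" unfolding clsd_def using lt b2 by (simp add: nbs a1 3)
    ultimately show ?thesis by (intro exI[of _ "{a, b, c, d, a1, b1, b2, b3}"]) simp
  qed
qed

text \<open>\<open>W\<close> is what remains after discarding every closed set on which the
  eigenvector for the largest eigenvalue vanishes. It contains no vertex of degree 3, and since its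
  degrees add up to twice its size, all of them are 2.\<close>

lemma cyclic_part:
  assumes n6: "n \<noteq> 6"
  obtains W v where "clsd W" "v \<in> W" "w 0 v \<noteq> 0" "\<And>u. u \<in> W \<Longrightarrow> deg u = 2"
proof -
  have n0: "0 < 2 * n" using n by simp
  have "\<exists>v<2 * n. w 0 v \<noteq> 0"
  proof (rule ccontr)
    assume "\<not> (\<exists>v<2 * n. w 0 v \<noteq> 0)"
    then have "(\<Sum>v<2 * n. cnj (w 0 v) * w 0 v) = 0" by (intro sum.neutral) simp
    then show False using ortho[OF n0 n0] by simp
  qed
  then obtain v where v: "v < 2 * n" "w 0 v \<noteq> 0" by blast
  define Z where "Z = \<Union>{K. clsd K \<and> (\<forall>u\<in>K. w 0 u = 0)}"
  define W where "W = {..<2 * n} - Z"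
  have clW: "clsd W"
    unfolding clsd_def
  proof (intro conjI ballI subsetI)
    fix u t assume u: "u \<in> W" and t: "t \<in> nb u"
    have "t \<notin> Z"
    proof
      assume "t \<in> Z"
      then obtain K where K: "clsd K" "\<forall>u\<in>K. w 0 u = 0" "t \<in> K" by (auto simp: Z_def)
      then have "u \<in> K" using t nb_sym[of u t] by (auto simp: clsd_def)
      then show False using u K by (auto simp: W_def Z_def)
    qed
    then show "t \<in> W" using nb_less[OF t] by (simp add: W_def)
  qed (auto simp: W_def)
  have le2: "deg u \<le> 2" if "u \<in> W" for u
  proof (rule ccontr)
    assume "\<not> deg u \<le> 2"
    then have "u \<in> D3" using that deg_cases[of u] by (auto simp: D3_def W_def)
    then obtain a b c d a1 b1 where q: "quad a b c d a1 b1" "nb a1 = {a}" "short_arm b b1" "u = a \<or> u = b"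
      using D3_short_arms by metis
    then obtain K where "clsd K" "u \<in> K" "\<forall>t\<in>K. w 0 t = 0"
      using quad_eigvec_zero[OF n6 eig q(1-3)] n0 by blast
    then show False using that by (auto simp: W_def Z_def)
  qed
  have finW: "finite W" by (simp add: W_def)
  have "deg u = 2" if u: "u \<in> W" for u
  proof (rule ccontr)
    assume "deg u \<noteq> 2"
    then have "(\<Sum>t\<in>W. deg t) < (\<Sum>t\<in>W. 2)"
      using le2 u finW by (intro sum_strict_mono_ex1) (auto intro!: bexI[of _ u] simp: order.strict_iff_order)
    then show False using sum_deg_clsd[OF clW] by simp
  qed
  moreover have "v \<in> W" using v by (auto simp: W_def Z_def)
  ultimately show thesis using that clW v(2) by blast
qed

end

subsection \<open>The walk around the cycle\<close>

lemma three_term_recurrence: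
  fixes y :: "nat \<Rightarrow> complex" and z :: complex
  assumes z: "z \<noteq> 0" "z\<^sup>2 \<noteq> 1" and rec: "\<And>m. y (m + 2) = (z + inverse z) * y (m + 1) - y m"
  obtains a b where "\<And>m. y m = a * z ^ m + b * inverse z ^ m"
proof -
  define a where "a = (y 1 - inverse z * y 0) / (z - inverse z)"
  define b where "b = y 0 - a"
  have nz: "z - inverse z \<noteq> 0" using z by (simp add: power2_eq_square field_simps)
  have y1: "y 1 = a * z + b * inverse z"
  proof -
    have "a * (z - inverse z) = y 1 - inverse z * y 0" using nz by (simp add: a_def)
    then show ?thesis by (simp add: b_def algebra_simps)
  qed
  have zz: "z * (inverse z * t) = t" "inverse z * (z * t) = t" for t using z(1) by simp_all
  have "y m = a * z ^ m + b * inverse z ^ m \<and> y (m + 1) = a * z ^ (m + 1) + b * inverse z ^ (m + 1)" for m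
  proof (induction m)
    case 0
    then show ?case using y1 by (simp add: b_def)
  next
    case (Suc m)
    have "y (Suc m + 1) = (z + inverse z) * y (m + 1) - y m" using rec[of m] by simp
    also have "\<dots> = a * z ^ (Suc m + 1) + b * inverse z ^ (Suc m + 1)"
      using Suc by (simp add: algebra_simps zz)
    finally show ?case using Suc by simp
  qed
  then show thesis using that by blast
qed

context cospectral
begin

text \<open>A walk without backtracking, obtained by dependent choice on pairs of consecutive
  vertices: the next vertex depends on the one just left.\<close>

lemma cyclic_walk:
  assumes n6: "n \<noteq> 6"
  obtains v :: "nat \<Rightarrow> nat" where "w 0 (v 0) \<noteq> 0" "\<And>m. v m < 2 * n" "\<And>m. v (Suc m) \<in> nb (v m)"
    "\<And>m. nb (v (Suc m)) = {v m, v (Suc (Suc m))}" "\<And>m. v (Suc (Suc m)) \<noteq> v m"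
proof -
  obtain W v0 where W: "clsd W" "v0 \<in> W" "w 0 v0 \<noteq> 0" "\<And>u. u \<in> W \<Longrightarrow> deg u = 2"
    using cyclic_part[OF n6] by metis
  have "nb v0 \<noteq> {}" using W(4)[OF W(2)] by (auto simp: deg_def)
  then obtain v1 where v1: "v1 \<in> nb v0" by blast
  define P where "P m p \<longleftrightarrow> fst p \<in> W \<and> snd p \<in> nb (fst p) \<and> (m = 0 \<longrightarrow> fst p = v0)" for m :: nat and p :: "nat \<times> nat"
  define Q where "Q m p p' \<longleftrightarrow> fst p' = snd p \<and> nb (snd p) = {fst p, snd p'} \<and> snd p' \<noteq> fst p"
    for m :: nat and p p' :: "nat \<times> nat"
  have "\<exists>f. \<forall>m. P m (f m) \<and> Q m (f m) (f (Suc m))"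
  proof (rule dependent_nat_choice)
    show "\<exists>p. P 0 p" using W v1 by (intro exI[of _ "(v0, v1)"]) (simp add: P_def)
    fix p m assume p: "P m p"
    have W2: "snd p \<in> W" using p W(1) unfolding P_def clsd_def by blast
    have "fst p \<in> nb (snd p)" using p nb_sym unfolding P_def by blast
    then obtain t where t: "nb (snd p) = {fst p, t}" "t \<noteq> fst p" using nb_eq_pair[OF _ W(4)[OF W2]] by metis
    show "\<exists>p'. P (Suc m) p' \<and> Q m p p'"
      using W2 t by (intro exI[of _ "(snd p, t)"]) (simp add: P_def Q_def)
  qed
  then obtain f where f: "\<And>m. P m (f m)" "\<And>m. Q m (f m) (f (Suc m))" by blast
  have snd: "snd (f m) = fst (f (Suc m))" for m using f(2)[of m] by (simp add: Q_def)
  show thesis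
  proof (rule that[of "\<lambda>m. fst (f m)"])
    show "w 0 (fst (f 0)) \<noteq> 0" using f(1)[of 0] W(3) by (simp add: P_def)
    show "fst (f m) < 2 * n" for m using f(1)[of m] W(1) by (auto simp: P_def clsd_def)
    show "fst (f (Suc m)) \<in> nb (fst (f m))" for m using f(1)[of m] by (simp add: P_def snd)
    show "nb (fst (f (Suc m))) = {fst (f m), fst (f (Suc (Suc m)))}" "fst (f (Suc (Suc m))) \<noteq> fst (f m)" for m
      using f(2)[of m] by (simp_all add: Q_def snd)
  qed
qed

text \<open>Multiplied by the partial products \<open>g\<close> of the edge weights, the eigenvector
  along the walk satisfies a recurrence with roots \<open>z\<close> and \<open>inverse z\<close>,
  where \<open>z\<close> is a primitive 8n-th root of unity. A return in the same direction after
  \<open>k\<close> steps yields a quasi-period whose factor is a fourth root of unity, so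
  \<open>z ^ (4 * k) = 1\<close> and 2n divides \<open>k\<close>. Hence the first 2n vertices are
  distinct and exhaust the graph, and the weight of the cycle is \<open>z ^ (2 * n)\<close> or its
  inverse.\<close>

lemma cycle_structure:
  assumes n6: "n \<noteq> 6"
  obtains v g where "bij_betw v {..<2 * n} {..<2 * n}" "v (2 * n) = v 0" "v (Suc (2 * n)) = v 1"
    "\<And>m. nb (v (Suc m)) = {v m, v (Suc (Suc m))}"
    "g 0 = 1" "\<And>m. g (Suc m) = g m * h (v m) (v (Suc m))" "\<And>m. g m \<in> {1, -1, \<i>, -\<i>}"
    "g (2 * n) \<in> {\<i>, -\<i>}"
proof -
  obtain v where v0: "w 0 (v 0) \<noteq> 0" and lt: "\<And>m. v m < 2 * n" and adj: "\<And>m. v (Suc m) \<in> nb (v m)"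
    and nbv: "\<And>m. nb (v (Suc m)) = {v m, v (Suc (Suc m))}" and nobt: "\<And>m. v (Suc (Suc m)) \<noteq> v m"
    using cyclic_walk[OF n6] by metis
  define g where "g = rec_nat 1 (\<lambda>m z. z * h (v m) (v (Suc m)))"
  have g0: "g 0 = 1" and gS: "\<And>m. g (Suc m) = g m * h (v m) (v (Suc m))" by (simp_all add: g_def)
  have gu: "g m \<in> {1, -1, \<i>, -\<i>}" for m
  proof (induction m)
    case (Suc m)
    then show ?case using vals[of "v m" "v (Suc m)"] adj[of m] by (auto simp: gS nb_def)
  qed (simp add: g0)
  have gnz: "g m \<noteq> 0" for m using gu[of m] by auto
  have g4: "(g i / g j) ^ 4 = 1" for i j
    using gu[of i] gu[of j] by (auto simp: power4_eq_xxxx)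

  define z where "z = cis (pi / (4 * real n))"
  have n0: "n > 0" using n by simp
  have znz: "z \<noteq> 0" by (simp add: z_def)
  have zpow: "z ^ k = 1 \<longleftrightarrow> 8 * n dvd k" for k
  proof
    assume "z ^ k = 1"
    then have "cis (real k * (pi / (4 * real n))) = 1" by (simp add: z_def DeMoivre)
    then obtain i :: int where "real k * (pi / (4 * real n)) = of_int i * 2 * pi"
      unfolding cis_eq_1_iff by blast
    then have "of_int (int k) * pi = of_int (i * (8 * int n)) * pi" using n0 by (simp add: field_simps)
    then have "of_int (int k) = (of_int (i * (8 * int n)) :: real)" by simp
    then have "int k = i * int (8 * n)" unfolding of_int_eq_iff by simp
    then have "int (8 * n) dvd int k" by (metis dvd_triv_right)
    then show "8 * n dvd k" unfolding of_nat_dvd_iff .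
  next
    assume "8 * n dvd k"
    then obtain i where "k = 8 * n * i" by auto
    then have "real k * (pi / (4 * real n)) = of_int (int i) * 2 * pi" using n0 by simp
    then show "z ^ k = 1" unfolding z_def DeMoivre cis_eq_1_iff by blast
  qed
  have z2: "z\<^sup>2 \<noteq> 1" unfolding zpow using n by (auto dest: dvd_imp_le)
  have zl: "of_real (lam n 0) = z + inverse z"
    by (simp add: lam_def z_def complex_eq_iff)
  define y where "y m = g m * w 0 (v m)" for m
  have "y (m + 2) = (z + inverse z) * y (m + 1) - y m" for m
  proof -
    have "(\<Sum>u\<in>nb (v (Suc m)). h (v (Suc m)) u * w 0 u) = (z + inverse z) * w 0 (v (Suc m))"
      using eig[OF lt, of 0 "Suc m"] n0 unfolding sum_nb zl by simp
    then have "h (v (Suc m)) (v m) * w 0 (v m) + h (v (Suc m)) (v (Suc (Suc m))) * w 0 (v (Suc (Suc m)))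
        = (z + inverse z) * w 0 (v (Suc m))"
      using nobt[of m] by (simp add: nbv)
    then have "g (Suc m) * (h (v (Suc m)) (v m) * w 0 (v m)) + y (m + 2) = (z + inverse z) * y (m + 1)"
      by (simp add: y_def gS[of "Suc m"] algebra_simps flip: distrib_left)
    moreover have "g (Suc m) * (h (v (Suc m)) (v m) * w 0 (v m)) = y m"
      using h_cancel[OF adj[of m]] by (simp add: y_def gS[of m] mult.assoc)
    ultimately show ?thesis by (simp add: algebra_simps)
  qed
  then obtain a b where y: "\<And>m. y m = a * z ^ m + b * inverse z ^ m"
    using three_term_recurrence[OF znz z2] by metis
  have ab: "a \<noteq> 0 \<or> b \<noteq> 0" using y[of 0] v0 by (auto simp: y_def g0)

  text \<open>Two equal steps of the walk force the quasi-period \<open>y\<^sub>m\<^sub>+\<^sub>k = c y\<^sub>m\<close>.\<close>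
  have per: "z ^ k = g (i + k) / g i \<or> inverse z ^ k = g (i + k) / g i"
    if "v (i + k) = v i" "v (Suc (i + k)) = v (Suc i)" for i k
  proof -
    define c where "c = g (i + k) / g i"
    have gk: "g (i + k) = c * g i" using gnz[of i] by (simp add: c_def)
    have "y (i + k) = c * y i" by (simp add: y_def gk that)
    moreover have "y (Suc i + k) = c * y (Suc i)"
      by (simp add: y_def gS gk that)
    ultimately have "a * z ^ i * (z ^ k - c) + b * inverse z ^ i * (inverse z ^ k - c) = 0"
      "z * (a * z ^ i * (z ^ k - c)) + inverse z * (b * inverse z ^ i * (inverse z ^ k - c)) = 0"
      unfolding y by (simp_all add: power_add algebra_simps)
    moreover define p where "p = a * z ^ i * (z ^ k - c)"
    moreover define q where "q = b * inverse z ^ i * (inverse z ^ k - c)"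
    ultimately have pq: "p + q = 0" "z * p + inverse z * q = 0" by simp_all
    then have "q = - p" by (simp add: eq_neg_iff_add_eq_0 add.commute)
    then have "z * p = inverse z * p" using pq(2) by simp
    then have "z * (z * p) = z * (inverse z * p)" by (rule arg_cong)
    also have "\<dots> = p" using znz by simp
    finally have "z\<^sup>2 * p = p" by (simp only: power2_eq_square mult.assoc)
    then have "(z\<^sup>2 - 1) * p = 0" by (simp add: left_diff_distrib)
    then have "p = 0" "q = 0" using z2 \<open>q = - p\<close> by auto
    then show ?thesis using ab znz unfolding p_def q_def c_def[symmetric] by auto
  qed
  have dvd: "2 * n dvd k" if "v (i + k) = v i" "v (Suc (i + k)) = v (Suc i)" for i k
  proof -
    have "z ^ (k * 4) = 1 \<or> inverse z ^ (k * 4) = 1"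
      using per[OF that] g4[of "i + k" i] unfolding power_mult by metis
    then have "8 * n dvd k * 4" unfolding power_inverse using zpow[of "k * 4"] by (simp add: inverse_eq_1_iff)
    then show ?thesis by (simp add: mult.commute[of k])
  qed
  \<comment> \<open>The walk cannot come back along an edge in the opposite direction: removing a
    step at both ends lowers \<open>k\<close> by 2 until a loop (\<open>k = 0\<close>) or an
    immediate reversal (\<open>k = 1\<close>) appears. So every return is one in the same
    direction.\<close>
  have refl: "v (Suc i) \<noteq> v (i + k)" if "v i = v (Suc (i + k))" for i k
    using that
  proof (induction k arbitrary: i rule: less_induct)
    case (less k)
    show ?case
    proof
      assume eq: "v (Suc i) = v (i + k)"
      consider "k = 0" | "k = 1" | j where "k = Suc (Suc j)" by (metis One_nat_def not0_implies_Suc)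
      then show False
      proof cases
        case 1
        then show False using eq adj[of i] by simp
      next
        case 2
        then show False using less.prems nobt[of i] by simp
      next
        case 3
        have e: "v (Suc i) = v (Suc (Suc i + j))" using eq 3 by simp
        have "{v i, v (Suc (Suc i))} = {v (Suc i + j), v i}"
          using nbv[of i] nbv[of "Suc i + j"] e less.prems 3 by (simp add: insert_commute)
        then have "v (Suc (Suc i)) = v (Suc i + j)" using nobt[of i] by (metis doubleton_eq_iff)
        then show False using less.IH[of j "Suc i"] e 3 by simp
      qed
    qed
  qed
  have ret: "2 * n dvd k \<and> v (Suc (i + k)) = v (Suc i)" if r: "v (i + k) = v i" "k > 0" for i k
  proof -
    obtain k' where k: "k = Suc k'" using r(2) gr0_conv_Suc by blast
    have "v (Suc i) \<in> nb (v (Suc (i + k')))" using adj[of i] r by (simp add: k)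
    then have "v (Suc i) = v (i + k') \<or> v (Suc i) = v (Suc (i + k))" by (simp add: nbv k)
    then have "v (Suc (i + k)) = v (Suc i)" using refl[of i k'] r by (simp add: k)
    then show ?thesis using dvd r by blast
  qed
  have inj: "inj_on v {..<2 * n}"
  proof (rule linorder_inj_onI')
    fix i j assume "i \<in> {..<2 * n}" "j \<in> {..<2 * n}" "i < j"
    then show "v i \<noteq> v j" using ret[of i "j - i"] dvd_imp_le[of "2 * n" "j - i"] by auto
  qed
  have bij: "bij_betw v {..<2 * n} {..<2 * n}"
    using inj lt by (intro bij_betw_imageI endo_inj_surj) auto
  then have "v ` {..<2 * n} = {..<2 * n}" by (rule bij_betw_imp_surj_on)
  then have "v (2 * n) \<in> v ` {..<2 * n}" using lt[of "2 * n"] by blast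
  then obtain i where i: "i < 2 * n" "v i = v (2 * n)" by (elim imageE) simp
  have "2 * n dvd 2 * n - i" using ret[of i "2 * n - i"] i by simp
  then have "i = 0" using i(1) dvd_imp_le[of "2 * n" "2 * n - i"] by auto
  then have close: "v (0 + 2 * n) = v 0" "v (Suc (0 + 2 * n)) = v (Suc 0)" using i ret[of 0 "2 * n"] n0 by auto
  have "z ^ (2 * n) = \<i>"
  proof -
    have "real (2 * n) * (pi / (4 * real n)) = pi / 2" using n0 by simp
    then show ?thesis unfolding z_def DeMoivre by (simp only: cis_pi_half)
  qed
  then have "g (2 * n) \<in> {\<i>, -\<i>}" using per[OF close] g0 by (auto simp: power_inverse)
  then show thesis using that[of v g] bij close nbv g0 gS gu by simp
qed

end

section \<open>Mixed graphs\<close>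

lemma herm_adj_nth:
  assumes "u < nverts X" "v < nverts X"
  shows "herm_adj X $$ (u, v) = (if {u, v} \<in> uedges X then 1 else if (u, v) \<in> dedges X then \<i>
    else if (v, u) \<in> dedges X then - \<i> else 0)"
  using assms by (simp add: herm_adj_def)

lemma herm_adj_carrier [simp]: "herm_adj X \<in> carrier_mat (nverts X) (nverts X)"
  by (simp add: herm_adj_def)

lemma char_poly_herm_spec:
  assumes "herm_spec X = herm_spec Y"
  shows "char_poly (herm_adj X) = char_poly (herm_adj Y)" "nverts X = nverts Y"
proof -
  have "monic (char_poly (herm_adj Z))" "degree (char_poly (herm_adj Z)) = nverts Z" for Z
    using degree_monic_char_poly[OF herm_adj_carrier, of Z] by auto
  then have "char_poly (herm_adj Z) = (\<Prod>x\<in>#herm_spec Z. [:- x, 1:])" for Z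
    using complex_poly_decompose_multiset[of "char_poly (herm_adj Z)"] by (simp add: herm_spec_def)
  then show "char_poly (herm_adj X) = char_poly (herm_adj Y)" using assms by simp
  then show "nverts X = nverts Y"
    using \<open>\<And>Z. degree (char_poly (herm_adj Z)) = nverts Z\<close> by metis
qed

lemma cospectral_herm_adj:
  assumes "n \<ge> 2" and Y: "is_mixed_graph Y" and N: "nverts Y = 2 * n"
    and cp: "char_poly (herm_adj Y) = (\<Prod>j<2 * n. [:- of_real (lam n j), 1:])"
  shows "\<exists>w. cospectral n (\<lambda>u v. if u < 2 * n \<and> v < 2 * n then herm_adj Y $$ (u, v) else 0) w"
proof -
  define h where "h u v = (if u < 2 * n \<and> v < 2 * n then herm_adj Y $$ (u, v) else 0)" for u v
  have hm: "mat (2 * n) (2 * n) (\<lambda>(u, v). h u v) = herm_adj Y"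
    by (rule eq_matI) (use N in \<open>auto simp: h_def herm_adj_def\<close>)
  have asym: "(u, v) \<in> dedges Y \<Longrightarrow> (v, u) \<notin> dedges Y" for u v
    using Y unfolding is_mixed_graph_def by blast
  have irrefl: "{u, u} \<notin> uedges Y" "(u, u) \<notin> dedges Y" for u
    using Y unfolding is_mixed_graph_def by (auto simp: doubleton_eq_iff)
  have herm: "h v u = cnj (h u v)" for u v
    using asym[of u v] N by (auto simp: h_def herm_adj_nth insert_commute)
  have pos: "n > 0" using assms(1) by simp
  have hcp: "char_poly (mat (2 * n) (2 * n) (\<lambda>(u, v). h u v)) = (\<Prod>j<2 * n. [:- of_real (lam n j), 1:])"
    unfolding hm by (rule cp)
  obtain w where w:
    "\<And>u j. u < 2 * n \<Longrightarrow> j < 2 * n \<Longrightarrow> (\<Sum>v<2 * n. h u v * w j v) = of_real (lam n j) * w j u"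
    "\<And>i j. i < 2 * n \<Longrightarrow> j < 2 * n \<Longrightarrow> (\<Sum>v<2 * n. cnj (w i v) * w j v) = of_bool (i = j)"
    "\<And>u v. u < 2 * n \<Longrightarrow> v < 2 * n \<Longrightarrow> (\<Sum>j<2 * n. w j u * cnj (w j v)) = of_bool (u = v)"
    using hermitian_eigenbasis[of h, OF herm inj_on_lam[OF pos] hcp] by blast
  have "cospectral n h w"
  proof (rule cospectral.intro)
    show "h u v \<in> {0, 1, -1, \<i>, -\<i>}" for u v using N by (auto simp: h_def herm_adj_nth)
    show "h u u = 0" for u using irrefl[of u] N by (simp add: h_def herm_adj_nth)
    show "u < 2 * n" if "h u v \<noteq> 0" for u v using that by (simp add: h_def split: if_splits)
    show "cmod (det (mat (2 * n) (2 * n) (\<lambda>(u, v). h u v))) = 2"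
      using cp hm by (intro det_simple_spectrum[OF pos]) simp
  qed (fact assms(1) herm w)+
  then show ?thesis unfolding h_def by blast
qed

text \<open>The parameter \<open>c\<close> is the weight of the closing edge: the imaginary unit for
  the graph itself, its negative for the cycle traversed backwards.\<close>

definition cyc_entry :: "complex \<Rightarrow> nat \<Rightarrow> nat \<Rightarrow> nat \<Rightarrow> complex" where
  "cyc_entry c N u v = (if v = Suc u \<or> u = Suc v then 1 else if Suc u = N \<and> v = 0 then c
     else if u = 0 \<and> Suc v = N then cnj c else 0)"

lemma herm_adj_mixed_cycle1:
  assumes "N \<ge> 3" "u < N" "v < N"
  shows "herm_adj (mixed_cycle1 N) $$ (u, v) = cyc_entry \<i> N u v"
proof -
  have "{u, v} \<in> uedges (mixed_cycle1 N) \<longleftrightarrow> v = Suc u \<or> u = Suc v"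
    using assms by (auto simp: mixed_cycle1_def doubleton_eq_iff)
  moreover have "(a, b) \<in> dedges (mixed_cycle1 N) \<longleftrightarrow> Suc a = N \<and> b = 0" for a b
    using assms(1) by (auto simp: mixed_cycle1_def)
  moreover have "nverts (mixed_cycle1 N) = N" by (simp add: mixed_cycle1_def)
  ultimately show ?thesis using assms by (auto simp: herm_adj_nth cyc_entry_def)
qed

lemma sum_cyc_entry:
  assumes "N \<ge> 3" "u < N"
  shows "(\<Sum>v<N. cyc_entry c N u v * x v)
    = (if u = 0 then cnj c * x (N - 1) else x (u - 1)) + (if Suc u = N then c * x 0 else x (Suc u))"
proof -
  define p where "p = (if u = 0 then N - 1 else u - 1)"
  define q where "q = (if Suc u = N then 0 else Suc u)"
  have pq: "p < N" "q < N" "p \<noteq> q" using assms by (auto simp: p_def q_def)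
  have "cyc_entry c N u v = 0" if "v < N" "v \<noteq> p" "v \<noteq> q" for v
    using that assms by (auto simp: cyc_entry_def p_def q_def split: if_splits)
  then have "(\<Sum>v<N. cyc_entry c N u v * x v) = (\<Sum>v\<in>{p, q}. cyc_entry c N u v * x v)"
    using pq by (intro sum.mono_neutral_right) auto
  also have "\<dots> = cyc_entry c N u p * x p + cyc_entry c N u q * x q" using pq by simp
  also have "cyc_entry c N u p * x p = (if u = 0 then cnj c * x (N - 1) else x (u - 1))"
    using assms by (auto simp: cyc_entry_def p_def)
  also have "cyc_entry c N u q * x q = (if Suc u = N then c * x 0 else x (Suc u))"
    using assms by (auto simp: cyc_entry_def q_def)
  finally show ?thesis .
qed

text \<open>The powers \<open>z ^ u\<close> form an eigenvector for z + 1/z; the two equations at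
  the closing edge hold because \<open>z ^ (2 * n)\<close> is the imaginary unit.\<close>

lemma char_poly_mixed_cycle1:
  assumes "n \<ge> 2"
  shows "char_poly (herm_adj (mixed_cycle1 (2 * n))) = (\<Prod>j<2 * n. [:- of_real (lam n j), 1:])"
proof -
  have N: "2 * n \<ge> 3" using assms by simp
  have "mat (2 * n) (2 * n) (\<lambda>(u, v). cyc_entry \<i> (2 * n) u v) = herm_adj (mixed_cycle1 (2 * n))"
    using herm_adj_mixed_cycle1[OF N] by (intro eq_matI) (auto simp: herm_adj_def mixed_cycle1_def)
  moreover have "char_poly (mat (2 * n) (2 * n) (\<lambda>(u, v). cyc_entry \<i> (2 * n) u v))
      = (\<Prod>j<2 * n. [:- of_real (lam n j), 1:])"
  proof (rule char_poly_simple_spectrum)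
    show "inj_on (\<lambda>j. complex_of_real (lam n j)) {..<2 * n}"
      using inj_on_lam[of n] assms by (auto simp: inj_on_def)
    fix j
    define z where "z = cis ((4 * real j + 1) * pi / (4 * real n))"
    have znz: "z \<noteq> 0" by (simp add: z_def)
    have zl: "of_real (lam n j) = z + inverse z" by (simp add: lam_def z_def complex_eq_iff)
    have zN: "z ^ (2 * n) = \<i>"
    proof -
      have "real (2 * n) * ((4 * real j + 1) * pi / (4 * real n)) = pi / 2 + of_int (int j) * 2 * pi"
        using assms by (simp add: field_simps)
      then have "z ^ (2 * n) = cis (pi / 2) * cis (of_int (int j) * 2 * pi)"
        unfolding z_def DeMoivre cis_mult by (rule arg_cong)
      moreover have "cis (of_int (int j) * 2 * pi) = 1" unfolding cis_eq_1_iff by blast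
      ultimately show ?thesis by simp
    qed
    have pred: "z ^ (m - 1) = inverse z * z ^ m" if "m > 0" for m
      using znz that by (cases m) simp_all
    have "is_eigvec (2 * n) (cyc_entry \<i> (2 * n)) (of_real (lam n j)) (\<lambda>u. z ^ u)"
      unfolding is_eigvec_def
    proof (intro conjI allI impI)
      show "\<exists>u<2 * n. z ^ u \<noteq> 0" using assms znz by (intro exI[of _ 0]) simp
      fix u assume u: "u < 2 * n"
      have 1: "(if u = 0 then cnj \<i> * z ^ (2 * n - 1) else z ^ (u - 1)) = inverse z * z ^ u"
      proof (cases "u = 0")
        case True
        have "cnj \<i> * (inverse z * \<i>) = inverse z * (cnj \<i> * \<i>)" by (simp only: mult_ac)
        then show ?thesis using pred[of "2 * n"] assms zN True by simp
      qed (use pred[of u] in simp)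
      have 2: "(if Suc u = 2 * n then \<i> * z ^ 0 else z ^ Suc u) = z * z ^ u"
        using zN by (metis mult.right_neutral power_0 power_Suc)
      show "(\<Sum>v<2 * n. cyc_entry \<i> (2 * n) u v * z ^ v) = of_real (lam n j) * z ^ u"
        unfolding sum_cyc_entry[OF N u] 1 2 zl by (simp add: algebra_simps)
    qed
    then show "\<exists>x. is_eigvec (2 * n) (cyc_entry \<i> (2 * n)) (complex_of_real (lam n j)) x" by blast
  qed
  ultimately show ?thesis by simp
qed

text \<open>Pulling \<open>X\<close> back along \<open>f\<close> gives \<open>Z\<close>, and
  \<open>D\<close> with inverse \<open>cnj\<close> is the switching. This reduces the conclusion of
  \<open>DHS\<close> to one identity between entries.\<close>

lemma iso_switching_witness:
  assumes X: "is_mixed_graph X" and Y: "nverts Y = nverts X"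
    and f: "bij_betw f {..<nverts X} {..<nverts X}"
    and D: "\<And>u. u < nverts X \<Longrightarrow> D u \<in> {1, -1, \<i>, -\<i>}"
    and eq: "\<And>u v. u < nverts X \<Longrightarrow> v < nverts X \<Longrightarrow>
      herm_adj Y $$ (u, v) = cnj (D u) * herm_adj X $$ (f u, f v) * D v"
  shows "\<exists>Z. is_mixed_graph Z \<and> mixed_graph_iso Z X \<and> switching_equivalent Y Z"
proof -
  define N where "N = nverts X"
  define Z where "Z = \<lparr>nverts = N, uedges = {{x, y} | x y. x < N \<and> y < N \<and> {f x, f y} \<in> uedges X},
    dedges = {(x, y). x < N \<and> y < N \<and> (f x, f y) \<in> dedges X}\<rparr>"
  have fN: "f u < N" if "u < N" for u using f that by (auto simp: bij_betw_def N_def)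
  have ue: "{x, y} \<in> uedges Z \<longleftrightarrow> {f x, f y} \<in> uedges X" if "x < N" "y < N" for x y
    using that by (auto simp: Z_def doubleton_eq_iff insert_commute)
  have de: "(x, y) \<in> dedges Z \<longleftrightarrow> (f x, f y) \<in> dedges X" if "x < N" "y < N" for x y
    using that by (auto simp: Z_def)
  have nl: "x \<noteq> y" if "{f x, f y} \<in> uedges X \<or> (f x, f y) \<in> dedges X" for x y
    using X that unfolding is_mixed_graph_def by (auto simp: doubleton_eq_iff)
  have "is_mixed_graph Z"
    unfolding is_mixed_graph_def
  proof (intro conjI)
    show "uedges Z \<subseteq> {{x, y} |x y. x < nverts Z \<and> y < nverts Z \<and> x \<noteq> y}"
      "dedges Z \<subseteq> {(x, y). x < nverts Z \<and> y < nverts Z \<and> x \<noteq> y}"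
      using nl by (auto simp: Z_def) blast
    show "\<forall>(x, y)\<in>dedges Z. (y, x) \<notin> dedges Z \<and> {x, y} \<notin> uedges Z"
    proof clarify
      fix x y assume xy: "(x, y) \<in> dedges Z"
      then have lt: "x < N" "y < N" by (auto simp: Z_def)
      then have "(f x, f y) \<in> dedges X" using xy de by simp
      then show "(y, x) \<notin> dedges Z \<and> {x, y} \<notin> uedges Z"
        using X lt de ue unfolding is_mixed_graph_def by auto
    qed
  qed
  moreover have "mixed_graph_iso Z X"
    unfolding mixed_graph_iso_def using f ue de by (intro exI[of _ f]) (simp add: Z_def N_def)
  moreover have "switching_equivalent Y Z"
    unfolding switching_equivalent_def
  proof (intro conjI exI)
    show "nverts Y = nverts Z" using Y by (simp add: Z_def N_def)
    show "diagonal_mat (mat_diag N D)" by (auto simp: diagonal_mat_def mat_diag_def)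
    show "\<forall>j<nverts Y. mat_diag N D $$ (j, j) \<in> {1, - 1, \<i>, - \<i>}"
      using D Y by (simp add: mat_diag_def N_def)
    have unit: "cnj (D u) * D u = 1" if "u < N" for u using D[of u] that by (auto simp: N_def)
    have one: "mat_diag N (\<lambda>u. cnj (D u) * D u) = 1\<^sub>m N"
      by (rule eq_matI) (auto simp: mat_diag_def unit)
    have hZ: "herm_adj Z $$ (u, v) = herm_adj X $$ (f u, f v)" if "u < N" "v < N" for u v
      using that fN ue[OF that] de[OF that] de[OF that(2,1)]
      by (simp add: herm_adj_nth N_def Z_def)
    have cZ: "herm_adj Z \<in> carrier_mat N N" using herm_adj_carrier[of Z] by (simp add: Z_def)
    have cY: "herm_adj Y \<in> carrier_mat N N" using herm_adj_carrier[of Y] Y by (simp add: N_def)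
    have cM: "mat N N (\<lambda>(i, j). cnj (D i) * herm_adj Z $$ (i, j)) \<in> carrier_mat N N" by simp
    show "similar_mat_wit (herm_adj Y) (herm_adj Z) (mat_diag N (\<lambda>u. cnj (D u))) (mat_diag N D)"
    proof (rule similar_mat_witI[of _ _ N])
      show "mat_diag N (\<lambda>u. cnj (D u)) * mat_diag N D = 1\<^sub>m N" using one by simp
      show "mat_diag N D * mat_diag N (\<lambda>u. cnj (D u)) = 1\<^sub>m N" using one by (simp add: mult.commute)
      show "herm_adj Y = mat_diag N (\<lambda>u. cnj (D u)) * herm_adj Z * mat_diag N D"
        unfolding mat_diag_mult_left[OF cZ] mat_diag_mult_right[OF cM]
        by (rule eq_matI) (use cY eq hZ in \<open>auto simp: N_def\<close>)
    qed (use cY cZ in auto)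
  qed
  ultimately show ?thesis by blast
qed

text \<open>Switching by the partial products \<open>g\<close> moves the weight of the whole cycle
  to the closing edge, which receives \<open>g N\<close>. If this is the negative of the imaginary
  unit, the numbering of the cycle is reversed.\<close>

lemma DHS_mixed_cycle1:
  assumes n: "n \<ge> 2" and n6: "n \<noteq> 6"
  shows "DHS (mixed_cycle1 (2 * n))"
  unfolding DHS_def
proof (intro allI impI, elim conjE)
  fix Y assume Y: "is_mixed_graph Y" and sp: "herm_spec Y = herm_spec (mixed_cycle1 (2 * n))"
  define N where "N = 2 * n"
  have N: "N \<ge> 3" "N > 0" using n by (simp_all add: N_def)
  have nvX: "nverts (mixed_cycle1 N) = N" by (simp add: mixed_cycle1_def)
  have nv: "nverts Y = N" using char_poly_herm_spec(2)[OF sp] by (simp add: N_def mixed_cycle1_def)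
  define h where "h u v = (if u < 2 * n \<and> v < 2 * n then herm_adj Y $$ (u, v) else 0)" for u v
  obtain w where "cospectral n h w"
    using cospectral_herm_adj[OF n Y] nv char_poly_herm_spec(1)[OF sp] char_poly_mixed_cycle1[OF n]
    unfolding h_def N_def by metis
  then interpret cospectral n h w .
  obtain v g where v: "bij_betw v {..<N} {..<N}" "v N = v 0" "v (Suc N) = v 1"
    and nbv: "\<And>m. nb (v (Suc m)) = {v m, v (Suc (Suc m))}"
    and g: "g 0 = 1" "\<And>m. g (Suc m) = g m * h (v m) (v (Suc m))" "\<And>m. g m \<in> {1, -1, \<i>, -\<i>}"
      "g N \<in> {\<i>, -\<i>}"
    using cycle_structure[OF n6] unfolding N_def by metis
  have unit: "cnj (g m) * (g m * z) = z" for m z using g(3)[of m] by auto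
  have step: "h (v m) (v (Suc m)) = cnj (g m) * g (Suc m)" for m by (simp add: g(2) unit)
  have step': "h (v (Suc m)) (v m) = cnj (g (Suc m)) * g m" for m
    by (subst herm) (simp add: step mult.commute)
  have vinj: "v i = v j \<longleftrightarrow> i = j" if "i < N" "j < N" for i j
    using v(1) that by (auto simp: bij_betw_def inj_on_def)
  have nonadj: "h (v i) (v j) = 0" if ij: "i < N" "j < N" "j \<noteq> Suc i" "i \<noteq> Suc j"
    "\<not> (Suc i = N \<and> j = 0)" "\<not> (i = 0 \<and> Suc j = N)" for i j
  proof -
    have "v j \<notin> nb (v i)"
    proof (cases i)
      case 0
      have "nb (v i) = {v (N - 1), v 1}"
        using nbv[of "N - 1"] N v(2,3) by (simp add: 0)
      then show ?thesis using vinj[of j "N - 1"] vinj[of j 1] ij N 0 by auto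
    next
      case (Suc k)
      have "v (Suc i) = v (if Suc i = N then 0 else Suc i)" using v(2) by simp
      then have "nb (v i) = {v k, v (if Suc i = N then 0 else Suc i)}" using nbv[of k] by (simp add: Suc)
      then show ?thesis using vinj[of j k] vinj[of j "Suc i"] vinj[of j 0] ij N Suc by auto
    qed
    then show ?thesis by (simp add: nb_def)
  qed
  have entry: "h (v i) (v j) = cnj (g i) * cyc_entry (g N) N i j * g j" if "i < N" "j < N" for i j
  proof -
    consider "j = Suc i" | "i = Suc j" | "Suc i = N" "j = 0" "j \<noteq> Suc i" "i \<noteq> Suc j"
      | "i = 0" "Suc j = N" "j \<noteq> Suc i" "i \<noteq> Suc j"
      | "j \<noteq> Suc i" "i \<noteq> Suc j" "\<not> (Suc i = N \<and> j = 0)" "\<not> (i = 0 \<and> Suc j = N)" by blast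
    then show ?thesis
    proof cases
      case 1
      then show ?thesis by (simp add: step cyc_entry_def)
    next
      case 2
      then show ?thesis by (simp add: step' cyc_entry_def)
    next
      case 3
      then have "h (v i) (v j) = cnj (g i) * g N" using step[of i] v(2) by simp
      then show ?thesis using 3 g(1) by (simp add: cyc_entry_def)
    next
      case 4
      then have "h (v i) (v j) = cnj (g N) * g j" using step'[of j] v(2) by simp
      then show ?thesis using 4 g(1) N by (auto simp add: cyc_entry_def)
    next
      case 5
      then show ?thesis using nonadj[OF that] by (auto simp: cyc_entry_def)
    qed
  qed
  define idx where "idx = inv_into {..<N} v"
  have idx: "bij_betw idx {..<N} {..<N}" "\<And>u. u < N \<Longrightarrow> v (idx u) = u" "\<And>u. u < N \<Longrightarrow> idx u < N"
    using bij_betw_inv_into[OF v(1)] bij_betw_inv_into_right[OF v(1)]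
    by (auto simp: idx_def bij_betw_def)
  have hY: "herm_adj Y $$ (u, t) = cnj (g (idx u)) * cyc_entry (g N) N (idx u) (idx t) * g (idx t)"
    if "u < N" "t < N" for u t
    using entry[of "idx u" "idx t"] idx that by (simp add: h_def N_def)
  have X: "is_mixed_graph (mixed_cycle1 N)" using N by (intro is_mixed_graph_mixed_cycle1)
  from g(4) consider "g N = \<i>" | "g N = - \<i>" by blast
  then have "\<exists>Z. is_mixed_graph Z \<and> mixed_graph_iso Z (mixed_cycle1 N) \<and> switching_equivalent Y Z"
  proof cases
    case 1
    show ?thesis
      by (rule iso_switching_witness[OF X, where f = idx and D = "\<lambda>u. g (idx u)"])
        (use nv nvX idx g(3) hY herm_adj_mixed_cycle1[OF N(1)] 1 in auto)
  next
    case 2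
    have rev: "cyc_entry (- \<i>) N i j = cyc_entry \<i> N (N - 1 - i) (N - 1 - j)" if "i < N" "j < N" for i j
    proof -
      have "N - 1 - j = Suc (N - 1 - i) \<longleftrightarrow> i = Suc j" "N - 1 - i = Suc (N - 1 - j) \<longleftrightarrow> j = Suc i"
        "Suc (N - 1 - i) = N \<longleftrightarrow> i = 0" "N - 1 - j = 0 \<longleftrightarrow> Suc j = N"
        "N - 1 - i = 0 \<longleftrightarrow> Suc i = N" "Suc (N - 1 - j) = N \<longleftrightarrow> j = 0"
        using that by linarith+
      then show ?thesis using N(1) unfolding cyc_entry_def by auto
    qed
    have "bij_betw (\<lambda>i. N - 1 - i) {..<N} {..<N}"
      by (rule bij_betwI[of _ _ _ "\<lambda>i. N - 1 - i"]) auto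
    then have "bij_betw (\<lambda>u. N - 1 - idx u) {..<N} {..<N}"
      using bij_betw_trans[OF idx(1)] by (simp add: o_def)
    then show ?thesis
      by (intro iso_switching_witness[OF X, where f = "\<lambda>u. N - 1 - idx u" and D = "\<lambda>u. g (idx u)"])
        (use nv nvX idx g(3) hY herm_adj_mixed_cycle1[OF N(1)] 2 rev in auto)
  qed
  then show "\<exists>Z. is_mixed_graph Z \<and> mixed_graph_iso Z (mixed_cycle1 (2 * n)) \<and> switching_equivalent Y Z"
    unfolding N_def .
qed

section \<open>The exception\<close>

text \<open>The disjoint union of \<open>C\<^sup>1\<^sub>4\<close> and a negative quadrangle with arms of lengths 1 and 3.\<close>

definition mate12 :: mixed_graph where
  "mate12 = \<lparr>nverts = 12,
     uedges = {{0, 1}, {1, 2}, {2, 3}, {6, 7}, {4, 7}, {4, 8}, {5, 9}, {9, 10}, {10, 11}},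
     dedges = {(3, 0), (4, 5), (5, 6)}\<rparr>"

lemma is_mixed_graph_mate12: "is_mixed_graph mate12"
proof -
  have "{x, y} \<in> {{x, y} | x y. x < nverts mate12 \<and> y < nverts mate12 \<and> x \<noteq> y}"
    if "x < 12" "y < 12" "x \<noteq> y" for x y
    using that unfolding mate12_def by auto
  then have "uedges mate12 \<subseteq> {{x, y} | x y. x < nverts mate12 \<and> y < nverts mate12 \<and> x \<noteq> y}"
    by (subst mate12_def) (simp del: mem_Collect_eq)
  then show ?thesis unfolding is_mixed_graph_def by (auto simp: mate12_def doubleton_eq_iff)
qed

section \<open>The spectrum of the mate\<close>

definition mate_entry :: "nat \<Rightarrow> nat \<Rightarrow> complex" where
  "mate_entry u v = (if {u, v} \<in> uedges mate12 then 1 else if (u, v) \<in> dedges mate12 then \<i>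
    else if (v, u) \<in> dedges mate12 then - \<i> else 0)"

lemma lessThan_12: "{..<12} = {0, 1, 2, 3, 4, 5, 6, 7, 8, 9, 10, 11 :: nat}"
proof -
  have "{..<12 :: nat} = set [0..<12]" by auto
  also have "[0..<12] = [0, 1, 2, 3, 4, 5, 6, 7, 8, 9, 10, 11 :: nat]" by (simp add: upt_rec)
  finally show ?thesis by simp
qed

lemma sum_mate_entry:
  "(\<Sum>v<12. mate_entry 0 v * x v) = x 1 - \<i> * x 3"
  "(\<Sum>v<12. mate_entry 1 v * x v) = x 0 + x 2"
  "(\<Sum>v<12. mate_entry 2 v * x v) = x 1 + x 3"
  "(\<Sum>v<12. mate_entry 3 v * x v) = \<i> * x 0 + x 2"
  "(\<Sum>v<12. mate_entry 4 v * x v) = \<i> * x 5 + x 7 + x 8"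
  "(\<Sum>v<12. mate_entry 5 v * x v) = - \<i> * x 4 + \<i> * x 6 + x 9"
  "(\<Sum>v<12. mate_entry 6 v * x v) = - \<i> * x 5 + x 7"
  "(\<Sum>v<12. mate_entry 7 v * x v) = x 4 + x 6"
  "(\<Sum>v<12. mate_entry 8 v * x v) = x 4"
  "(\<Sum>v<12. mate_entry 9 v * x v) = x 5 + x 10"
  "(\<Sum>v<12. mate_entry 10 v * x v) = x 9 + x 11"
  "(\<Sum>v<12. mate_entry 11 v * x v) = x 10"
proof -
  note sum12 = arg_cong[of _ _ "sum _", OF lessThan_12]
  show
    "(\<Sum>v<12. mate_entry 0 v * x v) = x 1 - \<i> * x 3"
    "(\<Sum>v<12. mate_entry 1 v * x v) = x 0 + x 2"
    "(\<Sum>v<12. mate_entry 2 v * x v) = x 1 + x 3"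
    "(\<Sum>v<12. mate_entry 3 v * x v) = \<i> * x 0 + x 2"
    "(\<Sum>v<12. mate_entry 4 v * x v) = \<i> * x 5 + x 7 + x 8"
    "(\<Sum>v<12. mate_entry 5 v * x v) = - \<i> * x 4 + \<i> * x 6 + x 9"
    "(\<Sum>v<12. mate_entry 6 v * x v) = - \<i> * x 5 + x 7"
    "(\<Sum>v<12. mate_entry 7 v * x v) = x 4 + x 6"
    "(\<Sum>v<12. mate_entry 8 v * x v) = x 4"
    "(\<Sum>v<12. mate_entry 9 v * x v) = x 5 + x 10"
    "(\<Sum>v<12. mate_entry 10 v * x v) = x 9 + x 11"
    "(\<Sum>v<12. mate_entry 11 v * x v) = x 10"
    unfolding sum12 by (simp_all add: mate_entry_def mate12_def doubleton_eq_iff)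
qed

lemma mate_eigvecI:
  assumes "\<exists>u<12. x u \<noteq> 0"
    and "x 1 - \<i> * x 3 = l * x 0" "x 0 + x 2 = l * x 1" "x 1 + x 3 = l * x 2" "\<i> * x 0 + x 2 = l * x 3"
    "\<i> * x 5 + x 7 + x 8 = l * x 4" "- \<i> * x 4 + \<i> * x 6 + x 9 = l * x 5" "- \<i> * x 5 + x 7 = l * x 6"
    "x 4 + x 6 = l * x 7" "x 4 = l * x 8" "x 5 + x 10 = l * x 9" "x 9 + x 11 = l * x 10" "x 10 = l * x 11"
  shows "is_eigvec 12 mate_entry l x"
  unfolding is_eigvec_def
proof (intro conjI allI impI)
  fix u :: nat assume "u < 12"
  then have mem: "u \<in> {0, 1, 2, 3, 4, 5, 6, 7, 8, 9, 10, 11}" unfolding lessThan_12[symmetric] by simp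
  show "(\<Sum>v<12. mate_entry u v * x v) = l * x u"
    by (rule mem[unfolded insert_iff empty_iff, THEN rev_mp])
      (intro impI, elim disjE FalseE; hypsubst; rule trans, rule sum_mate_entry, rule assms)
qed (fact assms(1))

text \<open>These are the eigenvalues of the component with vertices 0 to 3, a cycle of order 4 with
  characteristic polynomial \<open>dickson 4\<close>; the vector is supported there.\<close>

lemma mate_eigvec_cycle:
  assumes l: "l ^ 4 = 4 * l\<^sup>2 - 2"
  shows "\<exists>x. is_eigvec 12 mate_entry l x"
proof -
  define x :: "nat \<Rightarrow> complex" where
    "x = (\<lambda>_. 0)(0 := 1 + \<i> - \<i> * l\<^sup>2, 1 := l * (1 - \<i>), 2 := l\<^sup>2 - 1 - \<i>, 3 := l ^ 3 - 2 * l)"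
  have "is_eigvec 12 mate_entry l x"
  proof (rule mate_eigvecI)
    have "l \<noteq> 0" "1 - \<i> \<noteq> 0" using l by (auto simp: complex_eq_iff)
    then show "\<exists>u<12. x u \<noteq> 0" by (intro exI[of _ 1]) (simp add: x_def)
    have "l * l ^ 3 = 4 * l\<^sup>2 - 2" using l by (simp add: eval_nat_numeral)
    then have "l * (l ^ 3 - 2 * l) = 2 * l\<^sup>2 - 2" by (simp add: power2_eq_square algebra_simps)
    then show "\<i> * x 0 + x 2 = l * x 3" by (simp add: x_def algebra_simps)
  qed (simp_all add: x_def power2_eq_square power3_eq_cube algebra_simps)
  then show ?thesis by blast
qed

text \<open>Working inwards from the leaf 11 expresses the values at 10, 9 and 5 by the one at 11,
  and the leaf 8 does the same for 4. The factor \<open>f\<close> clears the denominators that arise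
  where the two meet. The equation at vertex 5 is the one not solved by construction; it amounts to
  \<open>psi\<close>.\<close>

lemma mate_eigvec_quad:
  assumes y: "y = l\<^sup>2" and psi: "y ^ 4 - 8 * y ^ 3 + 20 * y\<^sup>2 - 16 * y + 1 = 0"
  shows "\<exists>x. is_eigvec 12 mate_entry l x"
proof -
  define f where "f = y\<^sup>2 - 3 * y + 1"
  define x :: "nat \<Rightarrow> complex" where
    "x = (\<lambda>_. 0)(4 := y * (y - 2)\<^sup>2, 5 := - \<i> * (l * (y - 2) * f), 6 := - (y * (y - 2) * (y - 3)),
       7 := l * (y - 2), 8 := l * (y - 2)\<^sup>2, 9 := - \<i> * ((y - 1) * f), 10 := - \<i> * (l * f), 11 := - \<i> * f)"
  have ll: "l * l = y" "l * (l * z) = y * z" for z by (simp_all add: y power2_eq_square)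
  have "is_eigvec 12 mate_entry l x"
  proof (rule mate_eigvecI)
    show "\<exists>u<12. x u \<noteq> 0"
    proof (cases "y = 2")
      case True
      then show ?thesis by (intro exI[of _ 11]) (simp add: x_def f_def)
    next
      case False
      have "l \<noteq> 0" using psi by (auto simp: y)
      then show ?thesis using False by (intro exI[of _ 7]) (simp add: x_def)
    qed
    have "y * (y - 2) * f = y * (y - 2)\<^sup>2 + y * (y - 2) * (y - 3) + (y - 1) * f
        + (y ^ 4 - 8 * y ^ 3 + 20 * y\<^sup>2 - 16 * y + 1)"
      by (simp add: f_def eval_nat_numeral algebra_simps)
    then have "- \<i> * (y * (y - 2) * f) = - \<i> * (y * (y - 2)\<^sup>2 + y * (y - 2) * (y - 3) + (y - 1) * f)"
      unfolding psi by simp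
    moreover have "l * x 5 = - \<i> * (y * (y - 2) * f)"
    proof -
      have "l * x 5 = - \<i> * ((l * l) * ((y - 2) * f))" unfolding x_def by simp
      then show ?thesis by (simp add: y power2_eq_square mult.assoc)
    qed
    moreover have "- \<i> * x 4 + \<i> * x 6 + x 9
        = - \<i> * (y * (y - 2)\<^sup>2 + y * (y - 2) * (y - 3) + (y - 1) * f)"
      unfolding x_def by (simp add: distrib_left)
    ultimately show "- \<i> * x 4 + \<i> * x 6 + x 9 = l * x 5" by (simp only:)
  qed (simp_all add: x_def f_def ll eval_nat_numeral algebra_simps)
  then show ?thesis by blast
qed

text \<open>The polynomial \<open>dickson 12\<close> is \<open>dickson 3\<close> composed with
  \<open>dickson 4\<close>. With u for the latter it is u (u^2 - 3), and the two factors are the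
  characteristic polynomials of the two components.\<close>

lemma herm_spec_mate12: "herm_spec mate12 = herm_spec (mixed_cycle1 12)"
proof -
  have "mat 12 12 (\<lambda>(u, v). mate_entry u v) = herm_adj mate12"
    by (rule eq_matI) (auto simp: herm_adj_def mate_entry_def mate12_def)
  moreover have "char_poly (mat 12 12 (\<lambda>(u, v). mate_entry u v)) = (\<Prod>j<12. [:- of_real (lam 6 j), 1:])"
  proof (rule char_poly_simple_spectrum)
    show "inj_on (\<lambda>j. complex_of_real (lam 6 j)) {..<12}"
      using inj_on_lam[of 6] by (auto simp: inj_on_def)
    fix j :: nat assume "j < 12"
    define l where "l = complex_of_real (lam 6 j)"
    have "dickson 12 = (\<Prod>j<12. [:- of_real (lam 6 j), 1:])" using dickson_eq_prod[of 6] by simp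
    then have "poly (dickson 12) l = (\<Prod>j<12. l - of_real (lam 6 j))" by (simp add: poly_prod)
    also have "\<dots> = 0" using \<open>j < 12\<close> by (intro prod_zero) (auto simp: l_def)
    finally have "poly (dickson 12) l = 0" .
    moreover have "poly (dickson 12) l
        = (l ^ 4 - 4 * l\<^sup>2 + 2) * ((l\<^sup>2) ^ 4 - 8 * (l\<^sup>2) ^ 3 + 20 * (l\<^sup>2)\<^sup>2 - 16 * l\<^sup>2 + 1)"
      by (simp add: eval_nat_numeral algebra_simps)
    ultimately have "l ^ 4 - 4 * l\<^sup>2 + 2 = 0 \<or> (l\<^sup>2) ^ 4 - 8 * (l\<^sup>2) ^ 3 + 20 * (l\<^sup>2)\<^sup>2 - 16 * l\<^sup>2 + 1 = 0"
      by simp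
    then show "\<exists>x. is_eigvec 12 mate_entry (complex_of_real (lam 6 j)) x"
    proof
      assume "l ^ 4 - 4 * l\<^sup>2 + 2 = 0"
      then have "l ^ 4 = 4 * l\<^sup>2 - 2" by (simp add: algebra_simps add_eq_0_iff)
      then show ?thesis using mate_eigvec_cycle l_def by blast
    qed (use mate_eigvec_quad l_def in blast)
  qed
  ultimately have "char_poly (herm_adj mate12) = char_poly (herm_adj (mixed_cycle1 12))"
    using char_poly_mixed_cycle1[of 6] by simp
  then show ?thesis by (simp add: herm_spec_def)
qed

text \<open>Switching multiplies entries by units, so it preserves the underlying graph.\<close>

lemma switching_equivalent_zero_pattern:
  assumes "switching_equivalent Y Z" "u < nverts Y" "v < nverts Y" "herm_adj Y $$ (u, v) \<noteq> 0"
  shows "herm_adj Z $$ (u, v) \<noteq> 0"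
proof -
  define N where "N = nverts Y"
  obtain D D' where diag: "diagonal_mat D" and unit: "\<And>j. j < N \<Longrightarrow> D $$ (j, j) \<in> {1, -1, \<i>, -\<i>}"
    and wit: "similar_mat_wit (herm_adj Y) (herm_adj Z) D' D"
    using assms(1) unfolding switching_equivalent_def N_def by blast
  have cY: "herm_adj Y \<in> carrier_mat N N" by (simp add: N_def)
  note W = similar_mat_witD2[OF cY wit]
  have D: "D = mat_diag N (\<lambda>j. D $$ (j, j))"
    using diag W(7) by (intro eq_matI) (auto simp: diagonal_mat_def mat_diag_def)
  have "D * herm_adj Y = D * (D' * (herm_adj Z * D))"
    using W by (simp add: assoc_mult_mat[of _ N N _ N _ N])
  also have "\<dots> = (D * D') * (herm_adj Z * D)"
    using W(5-7) by (intro assoc_mult_mat[symmetric, of _ N N _ N _ N]) auto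
  also have "\<dots> = herm_adj Z * D" using W(2,5,7) by simp
  finally have "(D * herm_adj Y) $$ (u, v) = (herm_adj Z * D) $$ (u, v)" by simp
  moreover have "(D * herm_adj Y) $$ (u, v) = D $$ (u, u) * herm_adj Y $$ (u, v)"
  proof -
    have "(mat_diag N (\<lambda>j. D $$ (j, j)) * herm_adj Y) $$ (u, v) = D $$ (u, u) * herm_adj Y $$ (u, v)"
      unfolding mat_diag_mult_left[OF cY] using assms(2,3)[folded N_def] by simp
    then show ?thesis unfolding D[symmetric] .
  qed
  moreover have "(herm_adj Z * D) $$ (u, v) = herm_adj Z $$ (u, v) * D $$ (v, v)"
  proof -
    have "(herm_adj Z * mat_diag N (\<lambda>j. D $$ (j, j))) $$ (u, v) = herm_adj Z $$ (u, v) * D $$ (v, v)"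
      unfolding mat_diag_mult_right[OF W(5)] using assms(2,3)[folded N_def] by simp
    then show ?thesis unfolding D[symmetric] .
  qed
  moreover have "D $$ (u, u) \<noteq> 0" using unit[of u] assms(2) by (auto simp: N_def)
  ultimately show ?thesis using assms(4) by auto
qed

text \<open>Vertex 4 of the mate has the three neighbours 5, 7 and 8, but a vertex of a cycle has
  only the two neighbours called \<open>p\<close> and \<open>q\<close>.\<close>

lemma not_DHS_mixed_cycle1_12: "\<not> DHS (mixed_cycle1 12)"
proof
  assume "DHS (mixed_cycle1 12)"
  then obtain Z where iso: "mixed_graph_iso Z (mixed_cycle1 12)" and sw: "switching_equivalent mate12 Z"
    using is_mixed_graph_mate12 herm_spec_mate12 unfolding DHS_def by blast
  have nvm: "nverts mate12 = 12" "nverts (mixed_cycle1 12) = 12" by (simp_all add: mate12_def mixed_cycle1_def)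
  have nvZ: "nverts Z = 12" using sw nvm by (simp add: switching_equivalent_def)
  obtain f where f: "bij_betw f {..<12} {..<12}"
    and fe: "\<And>x y. x < 12 \<Longrightarrow> y < 12 \<Longrightarrow> ({x, y} \<in> uedges Z \<longleftrightarrow> {f x, f y} \<in> uedges (mixed_cycle1 12)) \<and>
           ((x, y) \<in> dedges Z \<longleftrightarrow> (f x, f y) \<in> dedges (mixed_cycle1 12))"
    using iso unfolding mixed_graph_iso_def nvZ nvm by blast
  have flt: "f u < 12" if "u < 12" for u using f that by (auto simp: bij_betw_def)
  have hZ: "herm_adj Z $$ (u, v) = cyc_entry \<i> 12 (f u) (f v)" if "u < 12" "v < 12" for u v
  proof -
    have "herm_adj Z $$ (u, v) = herm_adj (mixed_cycle1 12) $$ (f u, f v)"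
      using that flt fe[OF that] fe[OF that(2,1)] by (simp add: herm_adj_nth nvZ nvm)
    then show ?thesis using herm_adj_mixed_cycle1[of 12] flt that by simp
  qed
  have adj: "cyc_entry \<i> 12 (f 4) (f v) \<noteq> 0" if "v \<in> {5, 7, 8}" for v
  proof -
    have "v < 12" using that by auto
    have "herm_adj mate12 $$ (4, v) \<noteq> 0"
      using that by (auto simp: herm_adj_nth nvm) (auto simp: mate12_def doubleton_eq_iff)
    then have "herm_adj Z $$ (4, v) \<noteq> 0"
      using switching_equivalent_zero_pattern[OF sw] \<open>v < 12\<close> by (simp add: nvm)
    then show ?thesis using hZ[of 4 v] \<open>v < 12\<close> by simp
  qed
  define p where "p = (if f 4 = 0 then 11 else f 4 - 1)"
  define q where "q = (if f 4 = 11 then 0 else Suc (f 4))"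
  have "f v = p \<or> f v = q" if "v \<in> {5, 7, 8}" for v
    using adj[OF that] flt[of v] that by (auto simp: cyc_entry_def p_def q_def split: if_splits)
  then have "f 5 = p \<or> f 5 = q" "f 7 = p \<or> f 7 = q" "f 8 = p \<or> f 8 = q" by simp_all
  moreover have "f 5 \<noteq> f 7" "f 5 \<noteq> f 8" "f 7 \<noteq> f 8"
    using inj_onD[OF bij_betw_imp_inj_on[OF f], of 5 7] inj_onD[OF bij_betw_imp_inj_on[OF f], of 5 8]
      inj_onD[OF bij_betw_imp_inj_on[OF f], of 7 8] by auto
  ultimately show False by metis
qed

theorem theorem4p8:
  fixes n :: nat
  assumes "n \<ge> 2"
  shows "DHS (mixed_cycle1 (2 * n)) \<longleftrightarrow> n \<noteq> 6"
  using DHS_mixed_cycle1[OF assms] not_DHS_mixed_cycle1_12 by auto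

end
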